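(* Let $R$ be a commutative local noetherian integral domain with Krull dimension one, $K$ its field of fractions, $\Lambda$ a module-finite $R$-algebra, and $A=K\otimes_R\Lambda$. Then we have a disjoint union \[ \operatorname{tors}\Lambda=\coprod_{\mathcal{T}\in\operatorname{tors}(\operatorname{fl}\Lambda)}\bigl[\mathcal{T},\,\overline{\mathcal{T}}\bigr]_{\Lambda}, \] and there is a bijection \[ \coprod_{\mathcal{T}\in\operatorname{tors}(\operatorname{fl}\Lambda)}\bigl[\mathcal{T},\,\overline{\mathcal{T}}\bigr]_{\Lambda}\xrightarrow{\;K(-)\;}\coprod_{\mathcal{T}\in\operatorname{tors}(\operatorname{fl}\Lambda)}\bigl[0,\,K(\overline{\mathcal{T}})\bigr]_{A} \] given on each component by $\mathcal{C}\mapsto K\mathcal{C}$.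
   Context: A module-finite $R$-algebra is a ring $\Lambda$ with a ring homomorphism $R\to\Lambda$ whose image is in the center of $\Lambda$ such that $\Lambda$ is finitely generated as an $R$-module; thus $A$ is a finite dimensional $K$-algebra. $\operatorname{mod}\Gamma$ is the category of finitely generated left $\Gamma$-modules and $\operatorname{fl}\Lambda$ the category of finite length left $\Lambda$-modules. $\operatorname{Fac}M$ is the full subcategory of factor modules of finite direct sums of copies of direct summands of $M$. Subcategories are full and closed under isomorphisms. A torsion class of $\operatorname{mod}\Gamma$ (resp. $\operatorname{fl}\Lambda$) is a subcategory that is the first member of a torsion pair; equivalently, a nonempty subcategory closed under factor modules and extensions. $\operatorname{tors}\Gamma$ is the set of torsion classes of $\operatorname{mod}\Gamma$, and $\operatorname{tors}(\operatorname{fl}\Lambda)$ that of $\operatorname{fl}\Lambda$ (each of which is also a torsion class of $\operatorname{mod}\Lambda$). For a subcategory $\mathcal{C}$ of $\operatorname{mod}\Lambda$, put $\overline{\mathcal{C}}=\{M\in\operatorname{mod}\Lambda\mid \operatorname{Fac}M\cap\operatorname{fl}\Lambda\subseteq\mathcal{C}\}$ and $K\mathcal{C}=\{K\otimes_RM\mid M\in\mathcal{C}\}\subseteq\operatorname{mod}A$. For subcategories $\mathcal{B},\mathcal{B}'$ of $\operatorname{mod}\Gamma$, $[\mathcal{B},\mathcal{B}']_{\Gamma}=\{\mathcal{C}\in\operatorname{tors}\Gamma\mid\mathcal{B}\subseteq\mathcal{C}\subseteq\mathcal{B}'\}$. *)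

theory Defs
  imports "HOL-Algebra.Ring_Divisibility" "HOL-Algebra.Module" "HOL-Algebra.Free_Abelian_Groups"
    "HOL-Algebra.Generated_Groups" "HOL-Library.Extended_Nat" "HOL-Library.Disjoint_Sets"
begin

section \<open>Left modules over a not necessarily commutative ring\<close>

text \<open>The locale \<^locale>\<open>module\<close> requires a commutative base ring.
  The fields \<open>mult\<close> and \<open>one\<close> of the record type \<^typ>\<open>('a, 'b) module\<close> carry no meaning for a module.\<close>

locale left_module = \<Gamma>?: ring \<Gamma> + M?: abelian_group M
  for \<Gamma> :: "('g, 'c) ring_scheme" (structure) and M :: "('g, 'a, 'd) module_scheme" (structure) +
  assumes smult_closed [simp, intro]:
      "\<lbrakk>a \<in> carrier \<Gamma>; x \<in> carrier M\<rbrakk> \<Longrightarrow> a \<odot>\<^bsub>M\<^esub> x \<in> carrier M"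
    and smult_l_distr:
      "\<lbrakk>a \<in> carrier \<Gamma>; b \<in> carrier \<Gamma>; x \<in> carrier M\<rbrakk> \<Longrightarrow>
        (a \<oplus> b) \<odot>\<^bsub>M\<^esub> x = a \<odot>\<^bsub>M\<^esub> x \<oplus>\<^bsub>M\<^esub> b \<odot>\<^bsub>M\<^esub> x"
    and smult_r_distr:
      "\<lbrakk>a \<in> carrier \<Gamma>; x \<in> carrier M; y \<in> carrier M\<rbrakk> \<Longrightarrow>
        a \<odot>\<^bsub>M\<^esub> (x \<oplus>\<^bsub>M\<^esub> y) = a \<odot>\<^bsub>M\<^esub> x \<oplus>\<^bsub>M\<^esub> a \<odot>\<^bsub>M\<^esub> y"
    and smult_assoc:
      "\<lbrakk>a \<in> carrier \<Gamma>; b \<in> carrier \<Gamma>; x \<in> carrier M\<rbrakk> \<Longrightarrow>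
        (a \<otimes> b) \<odot>\<^bsub>M\<^esub> x = a \<odot>\<^bsub>M\<^esub> (b \<odot>\<^bsub>M\<^esub> x)"
    and smult_one [simp]: "x \<in> carrier M \<Longrightarrow> \<one> \<odot>\<^bsub>M\<^esub> x = x"

definition mod_hom ::
    "('g, 'c) ring_scheme \<Rightarrow> ('g, 'a) module \<Rightarrow> ('g, 'b) module \<Rightarrow> ('a \<Rightarrow> 'b) set" where
  "mod_hom \<Gamma> M N = {f \<in> carrier M \<rightarrow> carrier N.
     (\<forall>x\<in>carrier M. \<forall>y\<in>carrier M. f (x \<oplus>\<^bsub>M\<^esub> y) = f x \<oplus>\<^bsub>N\<^esub> f y) \<and>
     (\<forall>a\<in>carrier \<Gamma>. \<forall>x\<in>carrier M. f (a \<odot>\<^bsub>M\<^esub> x) = a \<odot>\<^bsub>N\<^esub> f x)}"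

definition mod_iso :: "('g, 'c) ring_scheme \<Rightarrow> ('g, 'a) module \<Rightarrow> ('g, 'b) module \<Rightarrow> bool" where
  "mod_iso \<Gamma> M N \<longleftrightarrow> (\<exists>f\<in>mod_hom \<Gamma> M N. bij_betw f (carrier M) (carrier N))"

definition short_exact ::
    "('g, 'c) ring_scheme \<Rightarrow> ('g, 'a) module \<Rightarrow> ('a \<Rightarrow> 'b) \<Rightarrow> ('g, 'b) module
      \<Rightarrow> ('b \<Rightarrow> 'd) \<Rightarrow> ('g, 'd) module \<Rightarrow> bool" where
  "short_exact \<Gamma> L f M g N \<longleftrightarrow>
     f \<in> mod_hom \<Gamma> L M \<and> g \<in> mod_hom \<Gamma> M N \<and>
     inj_on f (carrier L) \<and> g ` carrier M = carrier N \<and> f ` carrier L = a_kernel M N g"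

definition finitely_generated :: "('g, 'c) ring_scheme \<Rightarrow> ('g, 'a) module \<Rightarrow> bool" where
  "finitely_generated \<Gamma> M \<longleftrightarrow>
     (\<exists>S \<subseteq> carrier M. finite S \<and>
        (\<forall>x\<in>carrier M. \<exists>c \<in> S \<rightarrow> carrier \<Gamma>. x = (\<Oplus>\<^bsub>M\<^esub>s\<in>S. c s \<odot>\<^bsub>M\<^esub> s)))"

text \<open>Finite length: there is a composition series (consecutive quotients are simple, i.e. no
  submodule lies strictly in between).\<close>

definition finite_length :: "('g, 'c) ring_scheme \<Rightarrow> ('g, 'a) module \<Rightarrow> bool" where
  "finite_length \<Gamma> M \<longleftrightarrow>
     (\<exists>n::nat. \<exists>N. N 0 = {\<zero>\<^bsub>M\<^esub>} \<and> N n = carrier M \<and>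
        (\<forall>i\<le>n. submodule (N i) \<Gamma> M) \<and>
        (\<forall>i<n. N i \<subset> N (Suc i) \<and>
           \<not> (\<exists>L. submodule L \<Gamma> M \<and> N i \<subset> L \<and> L \<subset> N (Suc i))))"

definition direct_summand :: "('g, 'c) ring_scheme \<Rightarrow> ('g, 'a) module \<Rightarrow> 'a set \<Rightarrow> bool" where
  "direct_summand \<Gamma> M U \<longleftrightarrow> submodule U \<Gamma> M \<and>
     (\<exists>W. submodule W \<Gamma> M \<and> U \<inter> W = {\<zero>\<^bsub>M\<^esub>} \<and> U <+>\<^bsub>M\<^esub> W = carrier M)"

definition direct_sum :: "nat \<Rightarrow> (nat \<Rightarrow> ('g, 'a) module) \<Rightarrow> ('g, nat \<Rightarrow> 'a) module" where
  "direct_sum n D =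
     \<lparr>carrier = (\<Pi>\<^sub>E i\<in>{..<n}. carrier (D i)), monoid.mult = undefined, one = undefined,
      ring.zero = (\<lambda>i\<in>{..<n}. \<zero>\<^bsub>D i\<^esub>),
      ring.add = (\<lambda>x y. \<lambda>i\<in>{..<n}. x i \<oplus>\<^bsub>D i\<^esub> y i),
      smult = (\<lambda>a x. \<lambda>i\<in>{..<n}. a \<odot>\<^bsub>D i\<^esub> x i)\<rparr>"


section \<open>The categories of finitely generated and of finite length modules\<close>

text \<open>A subcategory is a set of modules, so the carriers have to live in a fixed type. Every
  finitely generated left module over \<open>\<Gamma> :: 'g ring\<close> is isomorphic to some \<open>\<Gamma>\<^sup>n/U\<close>, whose
  elements (cosets of lists) have type \<^typ>\<open>'g list set\<close>; hence modules with carrier in this type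
  represent all isomorphism classes. See the lemma \<open>fg_module_has_copy\<close>.\<close>

definition mod_cat :: "('g, 'c) ring_scheme \<Rightarrow> ('g, 'g list set) module set" where
  "mod_cat \<Gamma> = {M. left_module \<Gamma> M \<and> finitely_generated \<Gamma> M}"

definition fl_cat :: "('g, 'c) ring_scheme \<Rightarrow> ('g, 'g list set) module set" where
  "fl_cat \<Gamma> = {M. left_module \<Gamma> M \<and> finite_length \<Gamma> M}"

definition zero_cat :: "('g, 'c) ring_scheme \<Rightarrow> ('g, 'g list set) module set" where
  "zero_cat \<Gamma> = {M \<in> mod_cat \<Gamma>. carrier M = {\<zero>\<^bsub>M\<^esub>}}"

definition Fac ::
    "('g, 'c) ring_scheme \<Rightarrow> ('g, 'g list set) module \<Rightarrow> ('g, 'g list set) module set" where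
  "Fac \<Gamma> M = {N \<in> mod_cat \<Gamma>. \<exists>n U. (\<forall>i<n. direct_summand \<Gamma> M (U i)) \<and>
     (let D = direct_sum n (\<lambda>i. M\<lparr>carrier := U i\<rparr>)
      in \<exists>f\<in>mod_hom \<Gamma> D N. f ` carrier D = carrier N)}"

definition is_subcategory ::
    "('g, 'c) ring_scheme \<Rightarrow> ('g, 'g list set) module set \<Rightarrow> ('g, 'g list set) module set \<Rightarrow> bool"
  where
  "is_subcategory \<Gamma> \<A> \<C> \<longleftrightarrow> \<C> \<subseteq> \<A> \<and> (\<forall>M\<in>\<C>. \<forall>N\<in>\<A>. mod_iso \<Gamma> M N \<longrightarrow> N \<in> \<C>)"

definition torsion_pair ::
    "('g, 'c) ring_scheme \<Rightarrow> ('g, 'g list set) module set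
      \<Rightarrow> ('g, 'g list set) module set \<Rightarrow> ('g, 'g list set) module set \<Rightarrow> bool" where
  "torsion_pair \<Gamma> \<A> \<T> \<F> \<longleftrightarrow> is_subcategory \<Gamma> \<A> \<T> \<and> is_subcategory \<Gamma> \<A> \<F> \<and>
     (\<forall>L\<in>\<T>. \<forall>N\<in>\<F>. \<forall>f\<in>mod_hom \<Gamma> L N. \<forall>x\<in>carrier L. f x = \<zero>\<^bsub>N\<^esub>) \<and>
     (\<forall>M\<in>\<A>. \<exists>L\<in>\<T>. \<exists>N\<in>\<F>. \<exists>f g. short_exact \<Gamma> L f M g N)"

definition torsion_classes ::
    "('g, 'c) ring_scheme \<Rightarrow> ('g, 'g list set) module set \<Rightarrow> ('g, 'g list set) module set set" where
  "torsion_classes \<Gamma> \<A> = {\<T>. \<exists>\<F>. torsion_pair \<Gamma> \<A> \<T> \<F>}"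

definition tors :: "('g, 'c) ring_scheme \<Rightarrow> ('g, 'g list set) module set set" where
  "tors \<Gamma> = torsion_classes \<Gamma> (mod_cat \<Gamma>)"

definition tors_fl :: "('g, 'c) ring_scheme \<Rightarrow> ('g, 'g list set) module set set" where
  "tors_fl \<Gamma> = torsion_classes \<Gamma> (fl_cat \<Gamma>)"

definition tors_interval ::
    "('g, 'c) ring_scheme \<Rightarrow> ('g, 'g list set) module set \<Rightarrow> ('g, 'g list set) module set
      \<Rightarrow> ('g, 'g list set) module set set" where
  "tors_interval \<Gamma> \<B> \<B>' = {\<C> \<in> tors \<Gamma>. \<B> \<subseteq> \<C> \<and> \<C> \<subseteq> \<B>'}"

definition fl_closure ::
    "('g, 'c) ring_scheme \<Rightarrow> ('g, 'g list set) module set \<Rightarrow> ('g, 'g list set) module set" where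
  "fl_closure \<Gamma> \<C> = {M \<in> mod_cat \<Gamma>. Fac \<Gamma> M \<inter> fl_cat \<Gamma> \<subseteq> \<C>}"


section \<open>Commutative algebra\<close>

definition local_ring :: "('r, 'c) ring_scheme \<Rightarrow> bool" where
  "local_ring R \<longleftrightarrow> cring R \<and> (\<exists>!\<mm>. maximalideal \<mm> R)"

definition krull_dim :: "('r, 'c) ring_scheme \<Rightarrow> enat" where
  "krull_dim R = Sup {enat n | n. \<exists>P. (\<forall>i\<le>n. primeideal (P i) R) \<and> (\<forall>i<n. P i \<subset> P (Suc i))}"

definition fraction_field ::
    "('r, 'c) ring_scheme \<Rightarrow> ('k, 'd) ring_scheme \<Rightarrow> ('r \<Rightarrow> 'k) \<Rightarrow> bool" where
  "fraction_field R K \<iota> \<longleftrightarrow> field K \<and> \<iota> \<in> ring_hom R K \<and> inj_on \<iota> (carrier R) \<and>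
     (\<forall>x\<in>carrier K. \<exists>a\<in>carrier R. \<exists>b\<in>carrier R - {\<zero>\<^bsub>R\<^esub>}. x = \<iota> a \<otimes>\<^bsub>K\<^esub> inv\<^bsub>K\<^esub> (\<iota> b))"

definition regular_module :: "('g, 'c) ring_scheme \<Rightarrow> ('g, 'g) module" where
  "regular_module \<Gamma> = \<lparr>carrier = carrier \<Gamma>, monoid.mult = monoid.mult \<Gamma>, one = one \<Gamma>,
     ring.zero = ring.zero \<Gamma>, ring.add = ring.add \<Gamma>, smult = monoid.mult \<Gamma>\<rparr>"

definition restrict_scalars :: "('r \<Rightarrow> 'g) \<Rightarrow> ('g, 'a) module \<Rightarrow> ('r, 'a) module" where
  "restrict_scalars \<phi> M = \<lparr>carrier = carrier M, monoid.mult = monoid.mult M, one = one M,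
     ring.zero = ring.zero M, ring.add = ring.add M, smult = (\<lambda>r. smult M (\<phi> r))\<rparr>"

locale module_finite_algebra = R?: cring R + \<Lambda>?: ring \<Lambda>
  for R (structure) and \<Lambda> (structure) +
  fixes \<eta>
  assumes structure_hom: "\<eta> \<in> ring_hom R \<Lambda>"
    and central: "\<lbrakk>r \<in> carrier R; x \<in> carrier \<Lambda>\<rbrakk> \<Longrightarrow> \<eta> r \<otimes>\<^bsub>\<Lambda>\<^esub> x = x \<otimes>\<^bsub>\<Lambda>\<^esub> \<eta> r"
    and module_finite: "finitely_generated R (restrict_scalars \<eta> (regular_module \<Lambda>))"


section \<open>Tensor products and base change to the field of fractions\<close>

text \<open>The tensor product of two modules over a commutative ring: the free abelian group on pairs,
  modulo the subgroup generated by the bilinearity relations.\<close>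

definition tensor_relations ::
    "('r, 'c) ring_scheme \<Rightarrow> ('r, 'a) module \<Rightarrow> ('r, 'b) module \<Rightarrow> ('a \<times> 'b \<Rightarrow>\<^sub>0 int) set" where
  "tensor_relations R V W =
     {frag_of (x \<oplus>\<^bsub>V\<^esub> x', y) - frag_of (x, y) - frag_of (x', y) | x x' y.
        x \<in> carrier V \<and> x' \<in> carrier V \<and> y \<in> carrier W} \<union>
     {frag_of (x, y \<oplus>\<^bsub>W\<^esub> y') - frag_of (x, y) - frag_of (x, y') | x y y'.
        x \<in> carrier V \<and> y \<in> carrier W \<and> y' \<in> carrier W} \<union>
     {frag_of (r \<odot>\<^bsub>V\<^esub> x, y) - frag_of (x, r \<odot>\<^bsub>W\<^esub> y) | r x y.
        r \<in> carrier R \<and> x \<in> carrier V \<and> y \<in> carrier W}"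

definition tensor_kernel ::
    "('r, 'c) ring_scheme \<Rightarrow> ('r, 'a) module \<Rightarrow> ('r, 'b) module \<Rightarrow> ('a \<times> 'b \<Rightarrow>\<^sub>0 int) set" where
  "tensor_kernel R V W =
     generate (free_Abelian_group (carrier V \<times> carrier W)) (tensor_relations R V W)"

definition tensor_group ::
    "('r, 'c) ring_scheme \<Rightarrow> ('r, 'a) module \<Rightarrow> ('r, 'b) module
      \<Rightarrow> ('a \<times> 'b \<Rightarrow>\<^sub>0 int) set monoid" where
  "tensor_group R V W = free_Abelian_group (carrier V \<times> carrier W) Mod tensor_kernel R V W"

text \<open>The biadditive extension of \<open>(k, a) \<cdot> (k', m) = (k k', a m)\<close> to formal sums. It induces both
  the product of \<open>K \<otimes>\<^sub>R \<Lambda>\<close> and its action on \<open>K \<otimes>\<^sub>R M\<close>. As with \<^const>\<open>rcoset_mult\<close>, the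
  induced operation on cosets is a union over representatives (all giving the same coset).\<close>

definition frag_action ::
    "('k, 'd) ring_scheme \<Rightarrow> ('l, 'a) module
      \<Rightarrow> ('k \<times> 'l \<Rightarrow>\<^sub>0 int) \<Rightarrow> ('k \<times> 'a \<Rightarrow>\<^sub>0 int) \<Rightarrow> ('k \<times> 'a \<Rightarrow>\<^sub>0 int)" where
  "frag_action K M \<alpha> \<tau> =
     frag_extend (\<lambda>(k, a). frag_extend (\<lambda>(k', m). frag_of (k \<otimes>\<^bsub>K\<^esub> k', a \<odot>\<^bsub>M\<^esub> m)) \<tau>) \<alpha>"

text \<open>\<open>K \<otimes>\<^sub>R M\<close> as a left module over \<open>K \<otimes>\<^sub>R \<Lambda>\<close>, for a left \<open>\<Lambda>\<close>-module \<open>M\<close>; the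
  \<open>R\<close>-module structures of \<open>K\<close> and \<open>M\<close> come from \<open>\<iota> : R \<rightarrow> K\<close> and \<open>\<eta> : R \<rightarrow> \<Lambda>\<close>.\<close>

definition base_change_module ::
    "('r, 'c) ring_scheme \<Rightarrow> ('k, 'd) ring_scheme \<Rightarrow> ('r \<Rightarrow> 'k) \<Rightarrow> ('r \<Rightarrow> 'l)
      \<Rightarrow> ('l, 'a) module \<Rightarrow> (('k \<times> 'l \<Rightarrow>\<^sub>0 int) set, ('k \<times> 'a \<Rightarrow>\<^sub>0 int) set) module" where
  "base_change_module R K \<iota> \<eta> M =
     (let V = restrict_scalars \<iota> (regular_module K); W = restrict_scalars \<eta> M;
          F = free_Abelian_group (carrier V \<times> carrier W); T = tensor_group R V W
      in \<lparr>carrier = carrier T, monoid.mult = undefined, one = undefined,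
          ring.zero = one T, ring.add = monoid.mult T,
          smult = (\<lambda>a t. \<Union>\<alpha>\<in>a. \<Union>\<tau>\<in>t. tensor_kernel R V W #>\<^bsub>F\<^esub> frag_action K M \<alpha> \<tau>)\<rparr>)"

definition base_change_ring ::
    "('r, 'c) ring_scheme \<Rightarrow> ('k, 'd) ring_scheme \<Rightarrow> ('r \<Rightarrow> 'k)
      \<Rightarrow> ('l, 'e) ring_scheme \<Rightarrow> ('r \<Rightarrow> 'l) \<Rightarrow> ('k \<times> 'l \<Rightarrow>\<^sub>0 int) set ring" where
  "base_change_ring R K \<iota> \<Lambda> \<eta> =
     (let V = restrict_scalars \<iota> (regular_module K);
          W = restrict_scalars \<eta> (regular_module \<Lambda>);
          F = free_Abelian_group (carrier V \<times> carrier W);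
          T = base_change_module R K \<iota> \<eta> (regular_module \<Lambda>)
      in \<lparr>carrier = carrier T, monoid.mult = smult T,
          one = tensor_kernel R V W #>\<^bsub>F\<^esub> frag_of (\<one>\<^bsub>K\<^esub>, \<one>\<^bsub>\<Lambda>\<^esub>),
          ring.zero = ring.zero T, ring.add = ring.add T\<rparr>)"

definition K_image ::
    "('r, 'c) ring_scheme \<Rightarrow> ('k, 'd) ring_scheme \<Rightarrow> ('r \<Rightarrow> 'k)
      \<Rightarrow> ('l, 'e) ring_scheme \<Rightarrow> ('r \<Rightarrow> 'l) \<Rightarrow> ('l, 'l list set) module set
      \<Rightarrow> (('k \<times> 'l \<Rightarrow>\<^sub>0 int) set, ('k \<times> 'l \<Rightarrow>\<^sub>0 int) set list set) module set" where
  "K_image R K \<iota> \<Lambda> \<eta> \<C> =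
     (let A = base_change_ring R K \<iota> \<Lambda> \<eta>
      in {N \<in> mod_cat A. \<exists>M\<in>\<C>. mod_iso A (base_change_module R K \<iota> \<eta> M) N})"


section \<open>Every finitely generated module has a copy in the chosen type\<close>

lemma transport_module:
  fixes M :: "('g, 'a) module" and h :: "'a \<Rightarrow> 'b"
  assumes M: "left_module \<Gamma> M" and h: "inj_on h (carrier M)"
  defines "g \<equiv> inv_into (carrier M) h"
  defines "N \<equiv> \<lparr>carrier = h ` carrier M, monoid.mult = undefined, one = undefined,
     ring.zero = h \<zero>\<^bsub>M\<^esub>, ring.add = (\<lambda>x y. h (g x \<oplus>\<^bsub>M\<^esub> g y)), smult = (\<lambda>a x. h (a \<odot>\<^bsub>M\<^esub> g x))\<rparr>"
  shows "left_module \<Gamma> N" "h \<in> mod_hom \<Gamma> M N" "bij_betw h (carrier M) (carrier N)"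
proof -
  interpret left_module \<Gamma> M by fact
  have g [simp]: "g (h x) = x" if "x \<in> carrier M" for x
    using that h by (simp add: g_def)
  have N [simp]: "carrier N = h ` carrier M" "ring.zero N = h \<zero>\<^bsub>M\<^esub>"
    "\<And>x y. x \<oplus>\<^bsub>N\<^esub> y = h (g x \<oplus>\<^bsub>M\<^esub> g y)" "\<And>a x. a \<odot>\<^bsub>N\<^esub> x = h (a \<odot>\<^bsub>M\<^esub> g x)"
    by (auto simp: N_def)
  show "h \<in> mod_hom \<Gamma> M N" by (auto simp: mod_hom_def)
  show "bij_betw h (carrier M) (carrier N)" using h by (auto simp: bij_betw_def)
  have "abelian_group N"
  proof (rule abelian_groupI)
    fix x assume "x \<in> carrier N"
    then obtain u where u: "u \<in> carrier M" "x = h u" by auto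
    show "\<exists>y\<in>carrier N. y \<oplus>\<^bsub>N\<^esub> x = \<zero>\<^bsub>N\<^esub>"
      by (rule bexI [where x = "h (\<ominus>\<^bsub>M\<^esub> u)"]) (use u in \<open>auto simp: M.l_neg\<close>)
  qed (auto simp: M.a_ac)
  moreover have "left_module_axioms \<Gamma> N"
    by unfold_locales (auto simp: smult_l_distr smult_r_distr smult_assoc)
  ultimately show "left_module \<Gamma> N"
    using \<Gamma>.ring_axioms by (simp add: left_module_def)
qed

lemma finitely_generated_iso:
  fixes M :: "('g, 'a) module" and N :: "('g, 'b) module"
  assumes M: "left_module \<Gamma> M" and N: "left_module \<Gamma> N"
    and h: "h \<in> mod_hom \<Gamma> M N" "bij_betw h (carrier M) (carrier N)"
    and fg: "finitely_generated \<Gamma> M"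
  shows "finitely_generated \<Gamma> N"
proof -
  interpret M: left_module \<Gamma> M by fact
  interpret N: left_module \<Gamma> N by fact
  have hc: "\<And>x. x \<in> carrier M \<Longrightarrow> h x \<in> carrier N"
    and hadd: "\<And>x y. \<lbrakk>x \<in> carrier M; y \<in> carrier M\<rbrakk> \<Longrightarrow> h (x \<oplus>\<^bsub>M\<^esub> y) = h x \<oplus>\<^bsub>N\<^esub> h y"
    and hsm: "\<And>a x. \<lbrakk>a \<in> carrier \<Gamma>; x \<in> carrier M\<rbrakk> \<Longrightarrow> h (a \<odot>\<^bsub>M\<^esub> x) = a \<odot>\<^bsub>N\<^esub> h x"
    using h(1) by (auto simp: mod_hom_def)
  have h0: "h \<zero>\<^bsub>M\<^esub> = \<zero>\<^bsub>N\<^esub>"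
    using hadd[of "\<zero>\<^bsub>M\<^esub>" "\<zero>\<^bsub>M\<^esub>"] hc[of "\<zero>\<^bsub>M\<^esub>"] by (simp add: N.M.add.r_cancel_one')
  have hsum: "h (\<Oplus>\<^bsub>M\<^esub>s\<in>S. f s) = (\<Oplus>\<^bsub>N\<^esub>s\<in>S. h (f s))"
    if "finite S" "f \<in> S \<rightarrow> carrier M" for S :: "'a set" and f
    using that
  proof (induction S rule: finite_induct)
    case empty
    then show ?case by (simp add: h0)
  next
    case (insert s S)
    have c: "(\<Oplus>\<^bsub>M\<^esub>s\<in>S. f s) \<in> carrier M"
      using insert.prems by (intro M.M.finsum_closed) auto
    have "h (\<Oplus>\<^bsub>M\<^esub>s\<in>insert s S. f s) = h (f s) \<oplus>\<^bsub>N\<^esub> h (\<Oplus>\<^bsub>M\<^esub>s\<in>S. f s)"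
      using insert c hadd by (subst M.M.finsum_insert) auto
    also have "\<dots> = (\<Oplus>\<^bsub>N\<^esub>s\<in>insert s S. h (f s))"
      using insert hc by (subst N.M.finsum_insert) auto
    finally show ?case .
  qed
  obtain S where S: "S \<subseteq> carrier M" "finite S"
    "\<forall>x\<in>carrier M. \<exists>c \<in> S \<rightarrow> carrier \<Gamma>. x = (\<Oplus>\<^bsub>M\<^esub>s\<in>S. c s \<odot>\<^bsub>M\<^esub> s)"
    using fg by (auto simp: finitely_generated_def)
  have injS: "inj_on h S"
    using h(2) S(1) by (meson bij_betw_imp_inj_on inj_on_subset)
  show ?thesis
    unfolding finitely_generated_def
  proof (intro exI conjI ballI)
    show "h ` S \<subseteq> carrier N" "finite (h ` S)" using S hc by auto
  next
    fix y assume "y \<in> carrier N"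
    then obtain x where x: "x \<in> carrier M" "y = h x"
      using h(2) by (auto simp: bij_betw_def)
    then obtain c where c: "c \<in> S \<rightarrow> carrier \<Gamma>" "x = (\<Oplus>\<^bsub>M\<^esub>s\<in>S. c s \<odot>\<^bsub>M\<^esub> s)"
      using S by blast
    let ?d = "c \<circ> inv_into S h"
    have "y = (\<Oplus>\<^bsub>N\<^esub>s\<in>S. h (c s \<odot>\<^bsub>M\<^esub> s))"
      unfolding x c(2) using c S by (intro hsum) auto
    also have "\<dots> = (\<Oplus>\<^bsub>N\<^esub>s\<in>S. ?d (h s) \<odot>\<^bsub>N\<^esub> h s)"
      using c S hc injS hsm by (intro N.M.finsum_cong') (auto simp: Pi_iff subset_iff)
    also have "\<dots> = (\<Oplus>\<^bsub>N\<^esub>t\<in>h ` S. ?d t \<odot>\<^bsub>N\<^esub> t)"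
      using c S hc injS by (intro N.M.finsum_reindex[symmetric]) (auto simp: Pi_iff subset_iff)
    finally have "y = (\<Oplus>\<^bsub>N\<^esub>t\<in>h ` S. ?d t \<odot>\<^bsub>N\<^esub> t)" .
    moreover have "?d \<in> h ` S \<rightarrow> carrier \<Gamma>" using c injS by auto
    ultimately show "\<exists>c\<in>h ` S \<rightarrow> carrier \<Gamma>. y = (\<Oplus>\<^bsub>N\<^esub>s\<in>h ` S. c s \<odot>\<^bsub>N\<^esub> s)" by blast
  qed
qed

lemma fg_module_has_copy:
  fixes \<Gamma> :: "('g, 'c) ring_scheme" and M :: "('g, 'a) module"
  assumes M: "left_module \<Gamma> M" and fg: "finitely_generated \<Gamma> M"
  shows "\<exists>N\<in>mod_cat \<Gamma>. mod_iso \<Gamma> M N"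
proof -
  interpret left_module \<Gamma> M by fact
  obtain S where S: "S \<subseteq> carrier M" "finite S"
    "\<forall>x\<in>carrier M. \<exists>c \<in> S \<rightarrow> carrier \<Gamma>. x = (\<Oplus>\<^bsub>M\<^esub>s\<in>S. c s \<odot>\<^bsub>M\<^esub> s)"
    using fg by (auto simp: finitely_generated_def)
  obtain ss where ss: "set ss = S" using S finite_list by blast
  define h where
    "h x = {map c ss | c. c \<in> S \<rightarrow> carrier \<Gamma> \<and> x = (\<Oplus>\<^bsub>M\<^esub>s\<in>S. c s \<odot>\<^bsub>M\<^esub> s)}" for x
  have "inj_on h (carrier M)"
  proof (rule inj_onI)
    fix x y assume xy: "x \<in> carrier M" "y \<in> carrier M" "h x = h y"
    then obtain c where c: "c \<in> S \<rightarrow> carrier \<Gamma>" "x = (\<Oplus>\<^bsub>M\<^esub>s\<in>S. c s \<odot>\<^bsub>M\<^esub> s)"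
      using S by blast
    then have "map c ss \<in> h x" unfolding h_def by blast
    then have "map c ss \<in> h y" using xy(3) by simp
    then obtain d where d: "d \<in> S \<rightarrow> carrier \<Gamma>" "y = (\<Oplus>\<^bsub>M\<^esub>s\<in>S. d s \<odot>\<^bsub>M\<^esub> s)"
      "map c ss = map d ss"
      by (auto simp: h_def)
    then have "\<forall>s\<in>S. c s = d s" using ss by auto
    then show "x = y" unfolding c d using d S
      by (intro M.finsum_cong') (auto simp: Pi_iff subset_iff)
  qed
  note N = transport_module[OF M this]
  show ?thesis
    using N finitely_generated_iso[OF M N fg] unfolding mod_cat_def mod_iso_def by blast
qed

end

theory Submission
  imports Defs
begin

text \<open>A torsion class \<open>\<T>\<close> with torsion-free class \<open>\<F>\<close> consists of the objects without nonzero
  homomorphisms to members of \<open>\<F>\<close> (\<open>torsion_pair_perp\<close>). Conversely, if finitely generated modules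
  are noetherian, then the finitely generated modules without nonzero homomorphisms to given modules
  form a torsion class (\<open>torsion_classI\<close>, \<open>hom_vanishes_ext\<close>). The proof works throughout with such
  vanishing conditions.

  Because \<open>R\<close> is local of dimension one, a finitely generated \<open>\<Lambda>\<close>-module has finite length if and only
  if it is torsion over \<open>R\<close> (\<open>fl_cat_eq\<close>). Submodules and factor modules of torsion modules are
  torsion, so a torsion pair of \<open>mod \<Lambda>\<close> restricts to one of \<open>fl \<Lambda>\<close>. If \<open>\<T>\<close> is a torsion class of
  \<open>fl \<Lambda>\<close> with torsion-free class \<open>\<F>\<close>, then the closure of \<open>\<T>\<close> consists of all \<open>M\<close> without nonzero
  homomorphisms to members of \<open>\<F>\<close> (\<open>fl_closure_perp\<close>). A torsion class \<open>\<C>\<close> of \<open>mod \<Lambda>\<close> lies in the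
  interval of \<open>\<T>\<close> exactly when \<open>\<T>\<close> is the class of the finite length members of \<open>\<C>\<close>; this gives the
  disjoint union.

  For the bijection, \<open>K \<otimes>\<^sub>R M\<close> enters only as a localization of \<open>M\<close>: an \<open>A\<close>-module \<open>N\<close> with a
  \<open>\<Lambda>\<close>-linear map \<open>j : M \<rightarrow> N\<close> that has torsion kernel and whose image contains, for each \<open>n\<close> in \<open>N\<close>,
  some \<open>s n\<close> with \<open>s \<in> R\<close> nonzero. Homomorphisms of \<open>A\<close>-modules \<open>N \<rightarrow> Y\<close> are then the \<open>\<Lambda>\<close>-linear maps \<open>M \<rightarrow> Y\<close>
  (\<open>is_loc_extend\<close>), and clearing denominators shows that if there is no nonzero homomorphism
  \<open>L \<rightarrow> M\<close> between finitely generated \<open>\<Lambda>\<close>-modules, there is none from \<open>L\<close> to the localization of \<open>M\<close>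
  (\<open>hom_vanishes_localization\<close>). Three arguments use this.

  \<^item> The class \<open>K\<C>\<close> is a torsion class (\<open>loc_image_tors\<close>): a finitely generated \<open>A\<close>-module is the
    localization of a lattice, and localizing the canonical sequence of the lattice gives the canonical sequence of the module.
  \<^item> The map is injective (\<open>loc_image_reflects\<close>): let \<open>\<C>1\<close> and \<open>\<C>2\<close> have the same finite length members
    and \<open>K\<C>1 = K\<C>2\<close>, and let \<open>I\<close> be the image of a homomorphism from a member of \<open>\<C>1\<close> to a torsion-free
    module for \<open>\<C>2\<close>. The localization of \<open>I\<close> is zero, so \<open>I\<close> has finite length. As a factor module of a
    member of \<open>\<C>1\<close> it then lies in both classes, and \<open>I = 0\<close>.
  \<^item> The map is surjective (\<open>loc_image_surj\<close>): a torsion class \<open>\<D>\<close> of \<open>A\<close> below the localization of the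
    closure of \<open>\<T>\<close> comes from the class of all \<open>M\<close> in the closure of \<open>\<T>\<close> whose localization lies in
    \<open>\<D>\<close>. By the universal property this class is again given by vanishing of homomorphisms.

  The last part shows that \<open>A = K \<otimes>\<^sub>R \<Lambda>\<close> is a ring and that \<open>K \<otimes>\<^sub>R M\<close> is a localization of \<open>M\<close>. A
  common denominator makes every element of the tensor product elementary, so all identities are
  checked on elementary tensors.\<close>

section \<open>Submodules and homomorphisms of left modules\<close>

text \<open>The submodule of \<open>M\<close> with carrier \<open>U\<close>, as a module.\<close>

abbreviation restr :: "('g, 'a) module \<Rightarrow> 'a set \<Rightarrow> ('g, 'a) module" (infixl "\<restriction>" 80) where
  "M \<restriction> U \<equiv> M\<lparr>carrier := U\<rparr>"

context left_module
begin

lemma smult_zero [simp]: "a \<in> carrier \<Gamma> \<Longrightarrow> a \<odot>\<^bsub>M\<^esub> \<zero>\<^bsub>M\<^esub> = \<zero>\<^bsub>M\<^esub>"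
  using smult_r_distr[of a "\<zero>\<^bsub>M\<^esub>" "\<zero>\<^bsub>M\<^esub>"] by (simp add: M.add.l_cancel_one)

lemma zero_smult [simp]: "x \<in> carrier M \<Longrightarrow> \<zero> \<odot>\<^bsub>M\<^esub> x = \<zero>\<^bsub>M\<^esub>"
  using smult_l_distr[of "\<zero>" "\<zero>" x] by (simp add: M.add.l_cancel_one)

lemma minus_smult: "a \<in> carrier \<Gamma> \<Longrightarrow> x \<in> carrier M \<Longrightarrow> (\<ominus> a) \<odot>\<^bsub>M\<^esub> x = \<ominus>\<^bsub>M\<^esub> (a \<odot>\<^bsub>M\<^esub> x)"
  using smult_l_distr[of "\<ominus> a" a x] by (simp add: M.minus_equality \<Gamma>.l_neg)

lemma smult_minus: "a \<in> carrier \<Gamma> \<Longrightarrow> x \<in> carrier M \<Longrightarrow> a \<odot>\<^bsub>M\<^esub> (\<ominus>\<^bsub>M\<^esub> x) = \<ominus>\<^bsub>M\<^esub> (a \<odot>\<^bsub>M\<^esub> x)"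
  using smult_r_distr[of a "\<ominus>\<^bsub>M\<^esub> x" x] by (simp add: M.minus_equality M.l_neg)

lemma smult_diff:
  "a \<in> carrier \<Gamma> \<Longrightarrow> x \<in> carrier M \<Longrightarrow> y \<in> carrier M \<Longrightarrow>
    a \<odot>\<^bsub>M\<^esub> (x \<ominus>\<^bsub>M\<^esub> y) = a \<odot>\<^bsub>M\<^esub> x \<ominus>\<^bsub>M\<^esub> a \<odot>\<^bsub>M\<^esub> y"
  by (simp add: a_minus_def smult_r_distr smult_minus)

lemma diff_eq_zero_iff:
  assumes "x \<in> carrier M" "y \<in> carrier M"
  shows "x \<ominus>\<^bsub>M\<^esub> y = \<zero>\<^bsub>M\<^esub> \<longleftrightarrow> x = y"
proof
  assume "x \<ominus>\<^bsub>M\<^esub> y = \<zero>\<^bsub>M\<^esub>"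
  then have "(x \<ominus>\<^bsub>M\<^esub> y) \<oplus>\<^bsub>M\<^esub> y = y" using assms by simp
  then show "x = y" using assms by (simp add: a_minus_def M.a_assoc M.l_neg)
qed (use assms in \<open>simp add: a_minus_def M.r_neg\<close>)

lemma minus_diff: "x \<in> carrier M \<Longrightarrow> y \<in> carrier M \<Longrightarrow> \<ominus>\<^bsub>M\<^esub> (x \<ominus>\<^bsub>M\<^esub> y) = y \<ominus>\<^bsub>M\<^esub> x"
  by (simp add: a_minus_def M.minus_add M.a_comm)

lemma diff_trans:
  "x \<in> carrier M \<Longrightarrow> y \<in> carrier M \<Longrightarrow> z \<in> carrier M \<Longrightarrow>
    (x \<ominus>\<^bsub>M\<^esub> y) \<oplus>\<^bsub>M\<^esub> (y \<ominus>\<^bsub>M\<^esub> z) = x \<ominus>\<^bsub>M\<^esub> z"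
  by (simp add: a_minus_def M.a_assoc M.r_neg1)

lemma diff_add_diff:
  "a \<in> carrier M \<Longrightarrow> b \<in> carrier M \<Longrightarrow> c \<in> carrier M \<Longrightarrow> d \<in> carrier M \<Longrightarrow>
    (a \<ominus>\<^bsub>M\<^esub> b) \<oplus>\<^bsub>M\<^esub> (c \<ominus>\<^bsub>M\<^esub> d) = (a \<oplus>\<^bsub>M\<^esub> c) \<ominus>\<^bsub>M\<^esub> (b \<oplus>\<^bsub>M\<^esub> d)"
  by (simp add: a_minus_def M.minus_add M.a_ac)

lemma left_submoduleI:
  assumes "U \<subseteq> carrier M" "\<zero>\<^bsub>M\<^esub> \<in> U"
    "\<And>x y. x \<in> U \<Longrightarrow> y \<in> U \<Longrightarrow> x \<oplus>\<^bsub>M\<^esub> y \<in> U"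
    "\<And>a x. a \<in> carrier \<Gamma> \<Longrightarrow> x \<in> U \<Longrightarrow> a \<odot>\<^bsub>M\<^esub> x \<in> U"
  shows "submodule U \<Gamma> M"
proof -
  have "\<ominus>\<^bsub>M\<^esub> x \<in> U" if "x \<in> U" for x
    using assms(4)[of "\<ominus> \<one>" x] that assms(1) by (auto simp: minus_smult)
  then show ?thesis using assms
    by (intro submodule.intro subgroup.intro submodule_axioms.intro)
       (auto simp: a_inv_def[symmetric])
qed

lemma
  assumes "submodule U \<Gamma> M"
  shows submoduleD: "U \<subseteq> carrier M" "\<zero>\<^bsub>M\<^esub> \<in> U"
    "\<And>x y. x \<in> U \<Longrightarrow> y \<in> U \<Longrightarrow> x \<oplus>\<^bsub>M\<^esub> y \<in> U"
    "\<And>x. x \<in> U \<Longrightarrow> \<ominus>\<^bsub>M\<^esub> x \<in> U"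
    "\<And>a x. a \<in> carrier \<Gamma> \<Longrightarrow> x \<in> U \<Longrightarrow> a \<odot>\<^bsub>M\<^esub> x \<in> U"
    and submodule_diff: "\<And>x y. x \<in> U \<Longrightarrow> y \<in> U \<Longrightarrow> x \<ominus>\<^bsub>M\<^esub> y \<in> U"
proof -
  interpret U: submodule U \<Gamma> M by fact
  show 1: "U \<subseteq> carrier M" using U.subset by simp
  show "\<zero>\<^bsub>M\<^esub> \<in> U" using U.one_closed by simp
  show 2: "\<And>x y. x \<in> U \<Longrightarrow> y \<in> U \<Longrightarrow> x \<oplus>\<^bsub>M\<^esub> y \<in> U" using U.m_closed by simp
  show 3: "\<And>x. x \<in> U \<Longrightarrow> \<ominus>\<^bsub>M\<^esub> x \<in> U" using U.m_inv_closed by (simp add: a_inv_def)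
  show "\<And>a x. a \<in> carrier \<Gamma> \<Longrightarrow> x \<in> U \<Longrightarrow> a \<odot>\<^bsub>M\<^esub> x \<in> U" by (rule U.smult_closed)
  show "\<And>x y. x \<in> U \<Longrightarrow> y \<in> U \<Longrightarrow> x \<ominus>\<^bsub>M\<^esub> y \<in> U" using 2 3 by (simp add: a_minus_def)
qed

lemma submodule_carrier: "submodule (carrier M) \<Gamma> M"
  by (rule left_submoduleI) auto

lemma submodule_zero: "submodule {\<zero>\<^bsub>M\<^esub>} \<Gamma> M"
  by (rule left_submoduleI) auto

lemma submodule_Int:
  assumes "submodule U \<Gamma> M" "submodule V \<Gamma> M"
  shows "submodule (U \<inter> V) \<Gamma> M"
  by (rule left_submoduleI) (use submoduleD[OF assms(1)] submoduleD[OF assms(2)] in auto)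

lemma submodule_Inter:
  assumes "\<U> \<noteq> {}" "\<And>U. U \<in> \<U> \<Longrightarrow> submodule U \<Gamma> M"
  shows "submodule (\<Inter>\<U>) \<Gamma> M"
proof (rule left_submoduleI)
  show "\<Inter>\<U> \<subseteq> carrier M" using assms(1) submoduleD(1)[OF assms(2)] by blast
qed (use submoduleD[OF assms(2)] in auto)

text \<open>The sum of two submodules.\<close>

lemma submodule_sum:
  assumes U: "submodule U \<Gamma> M" and V: "submodule V \<Gamma> M"
  shows "submodule {x \<oplus>\<^bsub>M\<^esub> y | x y. x \<in> U \<and> y \<in> V} \<Gamma> M" (is "submodule ?S \<Gamma> M")
    and "U \<subseteq> {x \<oplus>\<^bsub>M\<^esub> y | x y. x \<in> U \<and> y \<in> V}"
    and "V \<subseteq> {x \<oplus>\<^bsub>M\<^esub> y | x y. x \<in> U \<and> y \<in> V}"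
proof -
  note u = submoduleD[OF U] and v = submoduleD[OF V]
  show "submodule ?S \<Gamma> M"
  proof (rule left_submoduleI)
    show "?S \<subseteq> carrier M" using u(1) v(1) by (auto simp: subset_iff)
    have "\<zero>\<^bsub>M\<^esub> = \<zero>\<^bsub>M\<^esub> \<oplus>\<^bsub>M\<^esub> \<zero>\<^bsub>M\<^esub>" by simp
    then show "\<zero>\<^bsub>M\<^esub> \<in> ?S" using u(2) v(2) by blast
  next
    fix x y assume "x \<in> ?S" "y \<in> ?S"
    then obtain a b c d where x: "x = a \<oplus>\<^bsub>M\<^esub> b" "a \<in> U" "b \<in> V" and y: "y = c \<oplus>\<^bsub>M\<^esub> d" "c \<in> U" "d \<in> V"
      by blast
    then have "x \<oplus>\<^bsub>M\<^esub> y = (a \<oplus>\<^bsub>M\<^esub> c) \<oplus>\<^bsub>M\<^esub> (b \<oplus>\<^bsub>M\<^esub> d)"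
      using u(1) v(1) by (simp add: subset_iff M.a_ac)
    then show "x \<oplus>\<^bsub>M\<^esub> y \<in> ?S" using x y u(3) v(3) by blast
  next
    fix a x assume a: "a \<in> carrier \<Gamma>" and "x \<in> ?S"
    then obtain b c where x: "x = b \<oplus>\<^bsub>M\<^esub> c" "b \<in> U" "c \<in> V" by blast
    then have "a \<odot>\<^bsub>M\<^esub> x = a \<odot>\<^bsub>M\<^esub> b \<oplus>\<^bsub>M\<^esub> a \<odot>\<^bsub>M\<^esub> c"
      using u(1) v(1) a by (simp add: subset_iff smult_r_distr)
    then show "a \<odot>\<^bsub>M\<^esub> x \<in> ?S" using x u(5) v(5) a by blast
  qed
  show "U \<subseteq> ?S"
  proof
    fix x assume "x \<in> U"
    then have "x = x \<oplus>\<^bsub>M\<^esub> \<zero>\<^bsub>M\<^esub>" using u(1) by auto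
    then show "x \<in> ?S" using \<open>x \<in> U\<close> v(2) by blast
  qed
  show "V \<subseteq> ?S"
  proof
    fix x assume "x \<in> V"
    then have "x = \<zero>\<^bsub>M\<^esub> \<oplus>\<^bsub>M\<^esub> x" using v(1) by auto
    then show "x \<in> ?S" using \<open>x \<in> V\<close> u(2) by blast
  qed
qed

lemma submodule_cyclic:
  assumes x: "x \<in> carrier M"
  shows "submodule {a \<odot>\<^bsub>M\<^esub> x | a. a \<in> carrier \<Gamma>} \<Gamma> M" (is "submodule ?S \<Gamma> M")
    and "x \<in> {a \<odot>\<^bsub>M\<^esub> x | a. a \<in> carrier \<Gamma>}"
proof -
  show "submodule ?S \<Gamma> M"
  proof (rule left_submoduleI)
    show "\<zero>\<^bsub>M\<^esub> \<in> ?S" using x zero_smult[of x] by (metis (mono_tags, lifting) \<Gamma>.zero_closed mem_Collect_eq)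
    show "y \<oplus>\<^bsub>M\<^esub> z \<in> ?S" if "y \<in> ?S" "z \<in> ?S" for y z
      using that x by (auto simp: smult_l_distr[symmetric])
    show "b \<odot>\<^bsub>M\<^esub> y \<in> ?S" if "b \<in> carrier \<Gamma>" "y \<in> ?S" for b y
      using that x by (auto simp: smult_assoc[symmetric])
  qed (use x in auto)
  show "x \<in> ?S" using x by (intro CollectI exI[of _ "\<one>"]) auto
qed

end

text \<open>The span of a set: the smallest submodule containing it.\<close>

definition mod_span :: "('g, 'c) ring_scheme \<Rightarrow> ('g, 'a) module \<Rightarrow> 'a set \<Rightarrow> 'a set" where
  "mod_span \<Gamma> M S = \<Inter>{U. submodule U \<Gamma> M \<and> S \<subseteq> U}"

lemma mod_span_least: "submodule U \<Gamma> M \<Longrightarrow> S \<subseteq> U \<Longrightarrow> mod_span \<Gamma> M S \<subseteq> U"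
  by (auto simp: mod_span_def)

lemma mod_span_superset: "S \<subseteq> mod_span \<Gamma> M S"
  by (auto simp: mod_span_def)

lemma mod_span_mono: "S \<subseteq> S' \<Longrightarrow> mod_span \<Gamma> M S \<subseteq> mod_span \<Gamma> M S'"
  by (auto simp: mod_span_def)

lemma submodule_mod_span:
  assumes "left_module \<Gamma> M" "S \<subseteq> carrier M" shows "submodule (mod_span \<Gamma> M S) \<Gamma> M"
proof -
  interpret left_module \<Gamma> M by fact
  show ?thesis unfolding mod_span_def using assms submodule_carrier by (intro submodule_Inter) auto
qed

lemma mod_span_insert:
  assumes M: "left_module \<Gamma> M" and S: "insert x S \<subseteq> carrier M" and y: "y \<in> mod_span \<Gamma> M (insert x S)"
  obtains a z where "a \<in> carrier \<Gamma>" "z \<in> mod_span \<Gamma> M S" "y = a \<odot>\<^bsub>M\<^esub> x \<oplus>\<^bsub>M\<^esub> z"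
proof -
  interpret left_module \<Gamma> M by fact
  have x: "x \<in> carrier M" and S': "S \<subseteq> carrier M" using S by auto
  note c = submodule_cyclic[OF x] and s = submodule_mod_span[OF M S']
  note sm = submodule_sum[OF c(1) s]
  have "mod_span \<Gamma> M (insert x S) \<subseteq> {u \<oplus>\<^bsub>M\<^esub> v | u v. u \<in> {a \<odot>\<^bsub>M\<^esub> x | a. a \<in> carrier \<Gamma>} \<and> v \<in> mod_span \<Gamma> M S}"
    by (rule mod_span_least[OF sm(1)]) (use sm(2,3) c(2) mod_span_superset[of S \<Gamma> M] in blast)
  then show thesis using y that by blast
qed

text \<open>The submodule \<open>U\<close> of \<open>M\<close> is finitely generated. For \<open>U = carrier M\<close> this agrees with the
  definition by linear combinations (\<open>finitely_generated_iff\<close>).\<close>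

definition fg_sub :: "('g, 'c) ring_scheme \<Rightarrow> ('g, 'a) module \<Rightarrow> 'a set \<Rightarrow> bool" where
  "fg_sub \<Gamma> M U \<longleftrightarrow> (\<exists>S. finite S \<and> S \<subseteq> U \<and> U \<subseteq> mod_span \<Gamma> M S)"

lemma left_module_restr:
  assumes "left_module \<Gamma> M" "submodule U \<Gamma> M" shows "left_module \<Gamma> (M \<restriction> U)"
proof -
  interpret left_module \<Gamma> M by fact
  note u = submoduleD[OF assms(2)]
  have [simp, intro]: "x \<in> U \<Longrightarrow> x \<in> carrier M" for x using u(1) by auto
  have "abelian_group (M \<restriction> U)"
  proof (rule abelian_groupI)
    fix x assume "x \<in> carrier (M \<restriction> U)"
    then show "\<exists>y\<in>carrier (M \<restriction> U). y \<oplus>\<^bsub>M \<restriction> U\<^esub> x = \<zero>\<^bsub>M \<restriction> U\<^esub>"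
      using u M.l_neg by (intro bexI[of _ "\<ominus>\<^bsub>M\<^esub> x"]) auto
  qed (use u in \<open>auto simp: M.a_ac\<close>)
  moreover have "left_module_axioms \<Gamma> (M \<restriction> U)"
    by unfold_locales (use u in \<open>auto simp: smult_l_distr smult_r_distr smult_assoc\<close>)
  ultimately show ?thesis using \<Gamma>.ring_axioms by (simp add: left_module_def)
qed

lemma submodule_restr_iff:
  assumes "left_module \<Gamma> M" "submodule U \<Gamma> M"
  shows "submodule V \<Gamma> (M \<restriction> U) \<longleftrightarrow> submodule V \<Gamma> M \<and> V \<subseteq> U"
proof -
  interpret M: left_module \<Gamma> M by fact
  interpret U: left_module \<Gamma> "M \<restriction> U" by (rule left_module_restr[OF assms])
  note u = M.submoduleD[OF assms(2)]
  show ?thesis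
  proof
    assume V: "submodule V \<Gamma> (M \<restriction> U)"
    note v = U.submoduleD[OF V, simplified]
    show "submodule V \<Gamma> M \<and> V \<subseteq> U"
      using v u by (intro conjI M.left_submoduleI) auto
  next
    assume V: "submodule V \<Gamma> M \<and> V \<subseteq> U"
    note v = M.submoduleD[OF conjunct1[OF V]]
    show "submodule V \<Gamma> (M \<restriction> U)"
      by (rule U.left_submoduleI) (use v V in auto)
  qed
qed

lemma mod_span_restr:
  assumes "left_module \<Gamma> M" "submodule U \<Gamma> M" "S \<subseteq> U"
  shows "mod_span \<Gamma> (M \<restriction> U) S = mod_span \<Gamma> M S"
proof -
  interpret M: left_module \<Gamma> M by fact
  have "submodule V \<Gamma> M \<Longrightarrow> S \<subseteq> V \<Longrightarrow> submodule (V \<inter> U) \<Gamma> M \<and> S \<subseteq> V \<inter> U" for V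
    using M.submodule_Int assms by auto
  then show ?thesis
    unfolding mod_span_def submodule_restr_iff[OF assms(1,2)] by blast
qed

lemma fg_sub_restr:
  assumes "left_module \<Gamma> M" "submodule U \<Gamma> M" "V \<subseteq> U"
  shows "fg_sub \<Gamma> (M \<restriction> U) V \<longleftrightarrow> fg_sub \<Gamma> M V"
proof -
  have "mod_span \<Gamma> (M \<restriction> U) S = mod_span \<Gamma> M S" if "S \<subseteq> V" for S
    using mod_span_restr[OF assms(1,2)] assms(3) that by (meson subset_trans)
  then show ?thesis unfolding fg_sub_def by blast
qed

lemma finitely_generated_iff:
  fixes \<Gamma> (structure)
  assumes M: "left_module \<Gamma> M"
  shows "finitely_generated \<Gamma> M \<longleftrightarrow> fg_sub \<Gamma> M (carrier M)"
proof -
  interpret left_module \<Gamma> M by fact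
  have "mod_span \<Gamma> M S = {(\<Oplus>\<^bsub>M\<^esub>s\<in>S. c s \<odot>\<^bsub>M\<^esub> s) | c. c \<in> S \<rightarrow> carrier \<Gamma>}" (is "_ = ?T S")
    if "finite S" "S \<subseteq> carrier M" for S
  proof
    have sc: "c s \<odot>\<^bsub>M\<^esub> s \<in> carrier M" if "c \<in> S \<rightarrow> carrier \<Gamma>" "s \<in> S" for c s
      using that \<open>S \<subseteq> carrier M\<close> by auto
    show "mod_span \<Gamma> M S \<subseteq> ?T S"
    proof (rule mod_span_least)
      show "submodule (?T S) \<Gamma> M"
      proof (rule left_submoduleI)
        show "?T S \<subseteq> carrier M" using sc by (auto intro!: M.finsum_closed)
        have "(\<Oplus>\<^bsub>M\<^esub>s\<in>S. \<zero> \<odot>\<^bsub>M\<^esub> s) = (\<Oplus>\<^bsub>M\<^esub>s\<in>S. \<zero>\<^bsub>M\<^esub>)"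
          using that by (intro M.finsum_cong') auto
        then show "\<zero>\<^bsub>M\<^esub> \<in> ?T S"
          by (intro CollectI exI[of _ "\<lambda>_. \<zero>"]) auto
      next
        fix x y assume "x \<in> ?T S" "y \<in> ?T S"
        then obtain c d where cd: "c \<in> S \<rightarrow> carrier \<Gamma>" "x = (\<Oplus>\<^bsub>M\<^esub>s\<in>S. c s \<odot>\<^bsub>M\<^esub> s)"
          "d \<in> S \<rightarrow> carrier \<Gamma>" "y = (\<Oplus>\<^bsub>M\<^esub>s\<in>S. d s \<odot>\<^bsub>M\<^esub> s)" by blast
        have "x \<oplus>\<^bsub>M\<^esub> y = (\<Oplus>\<^bsub>M\<^esub>s\<in>S. c s \<odot>\<^bsub>M\<^esub> s \<oplus>\<^bsub>M\<^esub> d s \<odot>\<^bsub>M\<^esub> s)"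
          unfolding cd using sc cd by (intro M.finsum_addf[symmetric]) auto
        also have "\<dots> = (\<Oplus>\<^bsub>M\<^esub>s\<in>S. (c s \<oplus> d s) \<odot>\<^bsub>M\<^esub> s)"
          using cd that by (intro M.finsum_cong') (auto simp: Pi_iff subset_iff smult_l_distr)
        finally show "x \<oplus>\<^bsub>M\<^esub> y \<in> ?T S"
          using cd by (intro CollectI exI[of _ "\<lambda>s. c s \<oplus> d s"]) auto
      next
        fix a x assume a: "a \<in> carrier \<Gamma>" and "x \<in> ?T S"
        then obtain c where c: "c \<in> S \<rightarrow> carrier \<Gamma>" "x = (\<Oplus>\<^bsub>M\<^esub>s\<in>S. c s \<odot>\<^bsub>M\<^esub> s)" by blast
        have "a \<odot>\<^bsub>M\<^esub> (\<Oplus>\<^bsub>M\<^esub>s\<in>T. c s \<odot>\<^bsub>M\<^esub> s) = (\<Oplus>\<^bsub>M\<^esub>s\<in>T. (a \<otimes> c s) \<odot>\<^bsub>M\<^esub> s)" if "T \<subseteq> S" for T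
          using finite_subset[OF that \<open>finite S\<close>] that
        proof (induction T)
          case (insert t T)
          have "(\<Oplus>\<^bsub>M\<^esub>s\<in>T. c s \<odot>\<^bsub>M\<^esub> s) \<in> carrier M" using insert sc c by (intro M.finsum_closed) auto
          then show ?case using insert sc c(1) a \<open>S \<subseteq> carrier M\<close>
            by (auto simp: smult_r_distr smult_assoc Pi_iff subset_iff M.finsum_insert)
        qed (use a in simp)
        then show "a \<odot>\<^bsub>M\<^esub> x \<in> ?T S"
          using c a by (intro CollectI exI[of _ "\<lambda>s. a \<otimes> c s"]) auto
      qed
      show "S \<subseteq> ?T S"
      proof
        fix t assume t: "t \<in> S"
        let ?c = "\<lambda>s. if s = t then \<one> else \<zero>"
        have "(\<Oplus>\<^bsub>M\<^esub>s\<in>S. ?c s \<odot>\<^bsub>M\<^esub> s) = (\<Oplus>\<^bsub>M\<^esub>s\<in>S. if t = s then s else \<zero>\<^bsub>M\<^esub>)"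
          using that by (intro M.finsum_cong') auto
        also have "\<dots> = t" using t that by (intro M.finsum_singleton) auto
        finally show "t \<in> ?T S" by (intro CollectI exI[of _ ?c]) auto
      qed
    qed
    show "?T S \<subseteq> mod_span \<Gamma> M S"
    proof safe
      fix c assume c: "c \<in> S \<rightarrow> carrier \<Gamma>"
      note sp = submoduleD[OF submodule_mod_span[OF M that(2)]]
      have "(\<Oplus>\<^bsub>M\<^esub>s\<in>T. c s \<odot>\<^bsub>M\<^esub> s) \<in> mod_span \<Gamma> M S" if "T \<subseteq> S" for T
        using finite_subset[OF that \<open>finite S\<close>] that
      proof (induction T)
        case (insert t T)
        have "c t \<odot>\<^bsub>M\<^esub> t \<in> mod_span \<Gamma> M S"
          using insert.prems c mod_span_superset[of S \<Gamma> M] by (intro sp(5)) auto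
        moreover have "(\<Oplus>\<^bsub>M\<^esub>s\<in>insert t T. c s \<odot>\<^bsub>M\<^esub> s) = c t \<odot>\<^bsub>M\<^esub> t \<oplus>\<^bsub>M\<^esub> (\<Oplus>\<^bsub>M\<^esub>s\<in>T. c s \<odot>\<^bsub>M\<^esub> s)"
          using insert sc c by (intro M.finsum_insert) auto
        ultimately show ?case using insert sp(3) by simp
      qed (use sp in simp)
      then show "(\<Oplus>\<^bsub>M\<^esub>s\<in>S. c s \<odot>\<^bsub>M\<^esub> s) \<in> mod_span \<Gamma> M S" by blast
    qed
  qed
  note span = this
  have "(\<forall>x\<in>carrier M. \<exists>c\<in>S \<rightarrow> carrier \<Gamma>. x = (\<Oplus>\<^bsub>M\<^esub>s\<in>S. c s \<odot>\<^bsub>M\<^esub> s)) \<longleftrightarrow>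
      carrier M \<subseteq> mod_span \<Gamma> M S" if "finite S" "S \<subseteq> carrier M" for S
    unfolding span[OF that] subset_iff mem_Collect_eq Ball_def Bex_def
    by (intro iff_allI imp_cong refl ex_cong1) (rule conj_commute)
  then show ?thesis
    unfolding finitely_generated_def fg_sub_def by (intro iff_exI) auto
qed

lemma finitely_generated_restr_iff:
  assumes "left_module \<Gamma> M" "submodule U \<Gamma> M"
  shows "finitely_generated \<Gamma> (M \<restriction> U) \<longleftrightarrow> fg_sub \<Gamma> M U"
  using finitely_generated_iff[OF left_module_restr[OF assms]]
    fg_sub_restr[OF assms order_refl] by simp

subsection \<open>Homomorphisms\<close>

lemma mod_homD:
  assumes "f \<in> mod_hom \<Gamma> M N"
  shows "\<And>x. x \<in> carrier M \<Longrightarrow> f x \<in> carrier N"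
    "\<And>x y. x \<in> carrier M \<Longrightarrow> y \<in> carrier M \<Longrightarrow> f (x \<oplus>\<^bsub>M\<^esub> y) = f x \<oplus>\<^bsub>N\<^esub> f y"
    "\<And>a x. a \<in> carrier \<Gamma> \<Longrightarrow> x \<in> carrier M \<Longrightarrow> f (a \<odot>\<^bsub>M\<^esub> x) = a \<odot>\<^bsub>N\<^esub> f x"
  using assms by (auto simp: mod_hom_def)

lemma mod_homI:
  assumes "\<And>x. x \<in> carrier M \<Longrightarrow> f x \<in> carrier N"
    "\<And>x y. x \<in> carrier M \<Longrightarrow> y \<in> carrier M \<Longrightarrow> f (x \<oplus>\<^bsub>M\<^esub> y) = f x \<oplus>\<^bsub>N\<^esub> f y"
    "\<And>a x. a \<in> carrier \<Gamma> \<Longrightarrow> x \<in> carrier M \<Longrightarrow> f (a \<odot>\<^bsub>M\<^esub> x) = a \<odot>\<^bsub>N\<^esub> f x"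
  shows "f \<in> mod_hom \<Gamma> M N"
  using assms by (auto simp: mod_hom_def)

lemma mod_hom_zero:
  assumes "left_module \<Gamma> M" "left_module \<Gamma> N" "f \<in> mod_hom \<Gamma> M N"
  shows "f \<zero>\<^bsub>M\<^esub> = \<zero>\<^bsub>N\<^esub>"
proof -
  interpret M: left_module \<Gamma> M by fact
  interpret N: left_module \<Gamma> N by fact
  show ?thesis using mod_homD(3)[OF assms(3), of "\<zero>\<^bsub>\<Gamma>\<^esub>" "\<zero>\<^bsub>M\<^esub>"] mod_homD(1)[OF assms(3), of "\<zero>\<^bsub>M\<^esub>"] by simp
qed

lemma mod_hom_minus:
  assumes "left_module \<Gamma> M" "left_module \<Gamma> N" "f \<in> mod_hom \<Gamma> M N" "x \<in> carrier M" "y \<in> carrier M"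
  shows "f (x \<ominus>\<^bsub>M\<^esub> y) = f x \<ominus>\<^bsub>N\<^esub> f y"
proof -
  interpret M: left_module \<Gamma> M by fact
  interpret N: left_module \<Gamma> N by fact
  note f = mod_homD[OF assms(3)]
  have "f (\<ominus>\<^bsub>M\<^esub> y) = \<ominus>\<^bsub>N\<^esub> f y"
    using f(3)[of "\<ominus>\<^bsub>\<Gamma>\<^esub> \<one>\<^bsub>\<Gamma>\<^esub>" y] f(1)[of y] assms(5) by (simp add: M.minus_smult N.minus_smult)
  then show ?thesis using f assms by (simp add: a_minus_def)
qed

lemma mod_hom_compose:
  assumes "f \<in> mod_hom \<Gamma> M N" "g \<in> mod_hom \<Gamma> N L" shows "(\<lambda>x. g (f x)) \<in> mod_hom \<Gamma> M L"
  using assms by (auto simp: mod_hom_def Pi_iff)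

lemma mod_hom_restr_domain:
  "f \<in> mod_hom \<Gamma> M N \<Longrightarrow> U \<subseteq> carrier M \<Longrightarrow> f \<in> mod_hom \<Gamma> (M \<restriction> U) N"
  by (auto simp: mod_hom_def Pi_iff subset_iff)

lemma mod_hom_restr_codomain:
  "f \<in> mod_hom \<Gamma> M N \<Longrightarrow> f ` carrier M \<subseteq> V \<Longrightarrow> f \<in> mod_hom \<Gamma> M (N \<restriction> V)"
  by (auto simp: mod_hom_def Pi_iff subset_iff)

lemma mod_hom_inclusion:
  "U \<subseteq> carrier M \<Longrightarrow> (\<lambda>x. x) \<in> mod_hom \<Gamma> (M \<restriction> U) M"
  by (auto simp: mod_hom_def)

lemma submodule_image:
  assumes M: "left_module \<Gamma> M" and N: "left_module \<Gamma> N" and f: "f \<in> mod_hom \<Gamma> M N"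
    and U: "submodule U \<Gamma> M"
  shows "submodule (f ` U) \<Gamma> N"
proof -
  interpret M: left_module \<Gamma> M by fact
  interpret N: left_module \<Gamma> N by fact
  note u = M.submoduleD[OF U] and f' = mod_homD[OF f]
  have c: "x \<in> U \<Longrightarrow> x \<in> carrier M" for x using u(1) by auto
  show ?thesis
  proof (rule N.left_submoduleI)
    show "f ` U \<subseteq> carrier N" using f' c by auto
    show "\<zero>\<^bsub>N\<^esub> \<in> f ` U" using u(2) mod_hom_zero[OF M N f] by (metis imageI)
  next
    fix x y assume "x \<in> f ` U" "y \<in> f ` U"
    then show "x \<oplus>\<^bsub>N\<^esub> y \<in> f ` U" using u(3) f'(2) c by (auto simp flip: f'(2))
  next
    fix a x assume "a \<in> carrier \<Gamma>" "x \<in> f ` U"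
    then show "a \<odot>\<^bsub>N\<^esub> x \<in> f ` U" using u(5) c by (auto simp flip: f'(3))
  qed
qed

lemma submodule_vimage:
  assumes M: "left_module \<Gamma> M" and N: "left_module \<Gamma> N" and f: "f \<in> mod_hom \<Gamma> M N"
    and V: "submodule V \<Gamma> N"
  shows "submodule {x \<in> carrier M. f x \<in> V} \<Gamma> M"
proof -
  interpret M: left_module \<Gamma> M by fact
  interpret N: left_module \<Gamma> N by fact
  note v = N.submoduleD[OF V] and f' = mod_homD[OF f]
  show ?thesis
    by (rule M.left_submoduleI) (use v f' mod_hom_zero[OF M N f] in auto)
qed

lemma submodule_kernel:
  assumes M: "left_module \<Gamma> M" and N: "left_module \<Gamma> N" and f: "f \<in> mod_hom \<Gamma> M N"
  shows "submodule {x \<in> carrier M. f x = \<zero>\<^bsub>N\<^esub>} \<Gamma> M"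
proof -
  interpret N: left_module \<Gamma> N by fact
  show ?thesis using submodule_vimage[OF M N f N.submodule_zero] by simp
qed

lemma fg_sub_image:
  assumes M: "left_module \<Gamma> M" and N: "left_module \<Gamma> N" and f: "f \<in> mod_hom \<Gamma> M N"
    and U: "U \<subseteq> carrier M" "fg_sub \<Gamma> M U"
  shows "fg_sub \<Gamma> N (f ` U)"
proof -
  obtain S where S: "finite S" "S \<subseteq> U" "U \<subseteq> mod_span \<Gamma> M S" using U by (auto simp: fg_sub_def)
  have fS: "f ` S \<subseteq> carrier N" using S U mod_homD(1)[OF f] by auto
  have "mod_span \<Gamma> M S \<subseteq> {x \<in> carrier M. f x \<in> mod_span \<Gamma> N (f ` S)}"
    using mod_span_superset[of "f ` S" \<Gamma> N] S U
    by (intro mod_span_least submodule_vimage[OF M N f] submodule_mod_span[OF N fS]) auto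
  then show ?thesis using S by (auto simp: fg_sub_def intro!: exI[of _ "f ` S"])
qed

lemma mod_isoE:
  assumes "mod_iso \<Gamma> M N"
  obtains f where "f \<in> mod_hom \<Gamma> M N" "bij_betw f (carrier M) (carrier N)"
  using assms by (auto simp: mod_iso_def)

lemma mod_hom_inverse:
  assumes M: "left_module \<Gamma> M" and f: "f \<in> mod_hom \<Gamma> M N" "bij_betw f (carrier M) (carrier N)"
  shows "inv_into (carrier M) f \<in> mod_hom \<Gamma> N M"
    "bij_betw (inv_into (carrier M) f) (carrier N) (carrier M)"
proof -
  interpret M: left_module \<Gamma> M by fact
  let ?g = "inv_into (carrier M) f"
  show g: "bij_betw ?g (carrier N) (carrier M)" by (rule bij_betw_inv_into[OF f(2)])
  have gc: "y \<in> carrier N \<Longrightarrow> ?g y \<in> carrier M" for y using g by (auto simp: bij_betw_def)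
  have fg: "y \<in> carrier N \<Longrightarrow> f (?g y) = y" for y
    using bij_betw_inv_into_right[OF f(2)] by auto
  have gf: "x \<in> carrier M \<Longrightarrow> ?g (f x) = x" for x using bij_betw_inv_into_left[OF f(2)] by auto
  note f' = mod_homD[OF f(1)]
  show "?g \<in> mod_hom \<Gamma> N M"
  proof (rule mod_homI)
    fix x y assume "x \<in> carrier N" "y \<in> carrier N"
    then show "?g (x \<oplus>\<^bsub>N\<^esub> y) = ?g x \<oplus>\<^bsub>M\<^esub> ?g y"
      using gf[of "?g x \<oplus>\<^bsub>M\<^esub> ?g y"] f'(2)[of "?g x" "?g y"] gc fg by simp
  next
    fix a x assume "a \<in> carrier \<Gamma>" "x \<in> carrier N"
    then show "?g (a \<odot>\<^bsub>N\<^esub> x) = a \<odot>\<^bsub>M\<^esub> ?g x"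
      using gf[of "a \<odot>\<^bsub>M\<^esub> ?g x"] f'(3)[of a "?g x"] gc fg by simp
  qed (use gc in auto)
qed

lemma mod_iso_sym: "left_module \<Gamma> M \<Longrightarrow> mod_iso \<Gamma> M N \<Longrightarrow> mod_iso \<Gamma> N M"
  by (erule mod_isoE) (auto simp: mod_iso_def intro: mod_hom_inverse)

lemma mod_hom_factor:
  assumes M: "left_module \<Gamma> M" and N: "left_module \<Gamma> N" and Y: "left_module \<Gamma> Y"
    and g: "g \<in> mod_hom \<Gamma> M N" "g ` carrier M = carrier N"
    and h: "h \<in> mod_hom \<Gamma> M Y"
    and ker: "\<And>x. x \<in> carrier M \<Longrightarrow> g x = \<zero>\<^bsub>N\<^esub> \<Longrightarrow> h x = \<zero>\<^bsub>Y\<^esub>"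
  obtains k where "k \<in> mod_hom \<Gamma> N Y" "\<And>x. x \<in> carrier M \<Longrightarrow> k (g x) = h x"
proof -
  interpret M: left_module \<Gamma> M by fact
  interpret N: left_module \<Gamma> N by fact
  interpret Y: left_module \<Gamma> Y by fact
  note g' = mod_homD[OF g(1)] and h' = mod_homD[OF h]
  define k where "k = (\<lambda>y. h (inv_into (carrier M) g y))"
  have kg: "k (g x) = h x" if x: "x \<in> carrier M" for x
  proof -
    let ?x = "inv_into (carrier M) g (g x)"
    have c: "?x \<in> carrier M" "g ?x = g x"
      using x by (auto intro: inv_into_into f_inv_into_f)
    have "g (?x \<ominus>\<^bsub>M\<^esub> x) = g x \<ominus>\<^bsub>N\<^esub> g x"
      using x c by (simp add: mod_hom_minus[OF M N g(1)])
    then have "g (?x \<ominus>\<^bsub>M\<^esub> x) = \<zero>\<^bsub>N\<^esub>" using x g' by (simp add: N.M.r_neg a_minus_def)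
    then have "h (?x \<ominus>\<^bsub>M\<^esub> x) = \<zero>\<^bsub>Y\<^esub>" using ker c x by simp
    then have "h ?x = h x" using c x h' by (simp add: mod_hom_minus[OF M Y h] Y.diff_eq_zero_iff)
    then show ?thesis by (simp add: k_def)
  qed
  have "k \<in> mod_hom \<Gamma> N Y"
  proof (rule mod_homI)
    fix y assume "y \<in> carrier N"
    then obtain u where "u \<in> carrier M" "y = g u" using g(2) by (metis imageE)
    then show "k y \<in> carrier Y" using kg h'(1) by simp
  next
    fix x y assume "x \<in> carrier N" "y \<in> carrier N"
    then obtain u v where u: "u \<in> carrier M" "v \<in> carrier M" "x = g u" "y = g v" using g(2) by (metis imageE)
    then have "x \<oplus>\<^bsub>N\<^esub> y = g (u \<oplus>\<^bsub>M\<^esub> v)" using g'(2) by auto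
    then show "k (x \<oplus>\<^bsub>N\<^esub> y) = k x \<oplus>\<^bsub>Y\<^esub> k y" using kg u h'(2) by simp
  next
    fix a x assume "a \<in> carrier \<Gamma>" "x \<in> carrier N"
    moreover then obtain u where u: "u \<in> carrier M" "x = g u" using g(2) by (metis imageE)
    ultimately have "a \<odot>\<^bsub>N\<^esub> x = g (a \<odot>\<^bsub>M\<^esub> u)" "a \<odot>\<^bsub>M\<^esub> u \<in> carrier M" using g'(3) by auto
    then show "k (a \<odot>\<^bsub>N\<^esub> x) = a \<odot>\<^bsub>Y\<^esub> k x" using kg u h'(3) \<open>a \<in> carrier \<Gamma>\<close> by simp
  qed
  then show thesis using kg that by blast
qed

subsection \<open>Noetherian modules\<close>

text \<open>All submodules are finitely generated.\<close>

definition noetherian_mod :: "('g, 'c) ring_scheme \<Rightarrow> ('g, 'a) module \<Rightarrow> bool" where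
  "noetherian_mod \<Gamma> M \<longleftrightarrow> (\<forall>U. submodule U \<Gamma> M \<longrightarrow> fg_sub \<Gamma> M U)"

lemma noetherian_mod_maximal:
  assumes M: "left_module \<Gamma> M" and noeth: "noetherian_mod \<Gamma> M"
    and ne: "\<S> \<noteq> {}" and sub: "\<And>U. U \<in> \<S> \<Longrightarrow> submodule U \<Gamma> M"
  obtains U where "U \<in> \<S>" "\<And>V. V \<in> \<S> \<Longrightarrow> U \<subseteq> V \<Longrightarrow> V = U"
proof -
  interpret left_module \<Gamma> M by fact
  have "\<exists>U\<in>\<S>. \<forall>V\<in>\<S>. U \<subseteq> V \<longrightarrow> V = U"
  proof (rule subset_Zorn_nonempty[OF ne])
    fix \<C> assume ne: "\<C> \<noteq> {}" and ch: "subset.chain \<S> \<C>"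
    then have sub': "submodule U \<Gamma> M" if "U \<in> \<C>" for U
      using that sub by (auto simp: subset.chain_def)
    note s = submoduleD[OF sub']
    have "submodule (\<Union>\<C>) \<Gamma> M"
    proof (rule left_submoduleI)
      show "\<Union>\<C> \<subseteq> carrier M" using s(1) by blast
      show "\<zero>\<^bsub>M\<^esub> \<in> \<Union>\<C>" using s(2) ne by blast
      show "a \<odot>\<^bsub>M\<^esub> x \<in> \<Union>\<C>" if "a \<in> carrier \<Gamma>" "x \<in> \<Union>\<C>" for a x using s(5) that by blast
      fix x y assume "x \<in> \<Union>\<C>" "y \<in> \<Union>\<C>"
      then obtain U where "U \<in> \<C>" "x \<in> U" "y \<in> U"
        using finite_subset_Union_chain[of "{x, y}" \<C> \<S>] ne ch by auto
      then show "x \<oplus>\<^bsub>M\<^esub> y \<in> \<Union>\<C>" using s(3) by blast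
    qed
    then obtain S where S: "finite S" "S \<subseteq> \<Union>\<C>" "\<Union>\<C> \<subseteq> mod_span \<Gamma> M S"
      using noeth by (auto simp: noetherian_mod_def fg_sub_def)
    then obtain U where U: "U \<in> \<C>" "S \<subseteq> U" using finite_subset_Union_chain[of S \<C> \<S>] ne ch by auto
    then have "\<Union>\<C> = U" using S(3) mod_span_least[OF sub'[OF U(1)] U(2)] by blast
    then show "\<Union>\<C> \<in> \<S>" using U(1) ch by (auto simp: subset.chain_def)
  qed
  then show thesis using that by blast
qed

subsection \<open>Quotients\<close>

lemma quotient_exists:
  fixes M :: "('g, 'a) module"
  assumes M: "left_module \<Gamma> M" and U: "submodule U \<Gamma> M"
  obtains N :: "('g, 'a set) module" and q where "left_module \<Gamma> N" "q \<in> mod_hom \<Gamma> M N"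
    "q ` carrier M = carrier N" "\<And>x. x \<in> carrier M \<Longrightarrow> q x = \<zero>\<^bsub>N\<^esub> \<longleftrightarrow> x \<in> U"
proof -
  interpret left_module \<Gamma> M by fact
  note u = submoduleD[OF U] submodule_diff[OF U]
  define q where "q x = {y \<in> carrier M. y \<ominus>\<^bsub>M\<^esub> x \<in> U}" for x
  have q_eq: "q x = q y \<longleftrightarrow> x \<ominus>\<^bsub>M\<^esub> y \<in> U" if "x \<in> carrier M" "y \<in> carrier M" for x y
  proof
    assume "q x = q y"
    moreover have "x \<in> q x" using that u(2) by (simp add: q_def a_minus_def M.r_neg)
    ultimately show "x \<ominus>\<^bsub>M\<^esub> y \<in> U" by (simp add: q_def)
  next
    assume xy: "x \<ominus>\<^bsub>M\<^esub> y \<in> U"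
    have yx: "y \<ominus>\<^bsub>M\<^esub> x \<in> U" using u(4)[OF xy] that by (simp add: minus_diff)
    have "z \<ominus>\<^bsub>M\<^esub> x \<in> U \<longleftrightarrow> z \<ominus>\<^bsub>M\<^esub> y \<in> U" if "z \<in> carrier M" for z
      using u(3)[OF _ xy, of "z \<ominus>\<^bsub>M\<^esub> x"] u(3)[OF _ yx, of "z \<ominus>\<^bsub>M\<^esub> y"] that
        \<open>x \<in> carrier M\<close> \<open>y \<in> carrier M\<close> by (auto simp: diff_trans)
    then show "q x = q y" by (auto simp: q_def)
  qed
  define r where "r = inv_into (carrier M) q"
  have r: "r (q x) \<in> carrier M" "q (r (q x)) = q x" if "x \<in> carrier M" for x
    using that f_inv_into_f[of "q x" q "carrier M"] by (auto simp: r_def intro: inv_into_into)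
  have r_diff: "r (q x) \<ominus>\<^bsub>M\<^esub> x \<in> U" if "x \<in> carrier M" for x
    using q_eq[of "r (q x)" x] r[OF that] that by simp
  define N :: "('g, 'a set) module" where
    "N = \<lparr>carrier = q ` carrier M, monoid.mult = undefined, one = undefined,
     ring.zero = q \<zero>\<^bsub>M\<^esub>, ring.add = (\<lambda>A B. q (r A \<oplus>\<^bsub>M\<^esub> r B)), smult = (\<lambda>a A. q (a \<odot>\<^bsub>M\<^esub> r A))\<rparr>"
  have N [simp]: "carrier N = q ` carrier M" "\<zero>\<^bsub>N\<^esub> = q \<zero>\<^bsub>M\<^esub>" by (auto simp: N_def)
  have add [simp]: "q x \<oplus>\<^bsub>N\<^esub> q y = q (x \<oplus>\<^bsub>M\<^esub> y)" if "x \<in> carrier M" "y \<in> carrier M" for x y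
  proof -
    have "r (q x) \<ominus>\<^bsub>M\<^esub> x \<in> U" "r (q y) \<ominus>\<^bsub>M\<^esub> y \<in> U" using r_diff that by auto
    then have "(r (q x) \<ominus>\<^bsub>M\<^esub> x) \<oplus>\<^bsub>M\<^esub> (r (q y) \<ominus>\<^bsub>M\<^esub> y) \<in> U" by (rule u(3))
    also have "(r (q x) \<ominus>\<^bsub>M\<^esub> x) \<oplus>\<^bsub>M\<^esub> (r (q y) \<ominus>\<^bsub>M\<^esub> y) = (r (q x) \<oplus>\<^bsub>M\<^esub> r (q y)) \<ominus>\<^bsub>M\<^esub> (x \<oplus>\<^bsub>M\<^esub> y)"
      using that r by (simp add: a_minus_def M.minus_add M.a_ac)
    finally show ?thesis using that r by (simp add: N_def q_eq)
  qed
  have smult [simp]: "a \<odot>\<^bsub>N\<^esub> q x = q (a \<odot>\<^bsub>M\<^esub> x)" if "a \<in> carrier \<Gamma>" "x \<in> carrier M" for a x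
  proof -
    have "r (q x) \<ominus>\<^bsub>M\<^esub> x \<in> U" using r_diff that by auto
    then have "a \<odot>\<^bsub>M\<^esub> (r (q x) \<ominus>\<^bsub>M\<^esub> x) \<in> U" using that u(5) by blast
    then show ?thesis using that r by (simp add: N_def q_eq smult_diff)
  qed
  have "abelian_group N"
  proof (rule abelian_groupI)
    fix x assume "x \<in> carrier N"
    then obtain u where u: "u \<in> carrier M" "x = q u" by auto
    show "\<exists>y\<in>carrier N. y \<oplus>\<^bsub>N\<^esub> x = \<zero>\<^bsub>N\<^esub>"
      by (rule bexI [where x = "q (\<ominus>\<^bsub>M\<^esub> u)"]) (use u in \<open>auto simp: M.l_neg\<close>)
  qed (auto simp: M.a_ac)
  moreover have "left_module_axioms \<Gamma> N"
    by unfold_locales (auto simp: smult_l_distr smult_r_distr smult_assoc)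
  ultimately have "left_module \<Gamma> N"
    using \<Gamma>.ring_axioms by (simp add: left_module_def)
  moreover have "q \<in> mod_hom \<Gamma> M N" by (rule mod_homI) auto
  moreover have "q x = \<zero>\<^bsub>N\<^esub> \<longleftrightarrow> x \<in> U" if "x \<in> carrier M" for x
  proof -
    have "\<ominus>\<^bsub>M\<^esub> \<zero>\<^bsub>M\<^esub> = \<zero>\<^bsub>M\<^esub>" by (rule M.minus_equality) simp_all
    then show ?thesis
      unfolding N(2) q_eq[OF that M.zero_closed] a_minus_def by (simp only: M.r_zero[OF that])
  qed
  ultimately show thesis using that[of N q] by simp
qed

lemma finitely_generated_image:
  assumes "left_module \<Gamma> M" "left_module \<Gamma> N" "f \<in> mod_hom \<Gamma> M N" "f ` carrier M = carrier N"
    "finitely_generated \<Gamma> M"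
  shows "finitely_generated \<Gamma> N"
  using fg_sub_image[OF assms(1-3) order_refl] assms finitely_generated_iff by metis

lemma mod_catD: "M \<in> mod_cat \<Gamma> \<Longrightarrow> left_module \<Gamma> M" "M \<in> mod_cat \<Gamma> \<Longrightarrow> finitely_generated \<Gamma> M"
  by (auto simp: mod_cat_def)

lemma quotient_mod_cat:
  fixes M :: "('g, 'a) module"
  assumes M: "left_module \<Gamma> M" and fg: "finitely_generated \<Gamma> M" and U: "submodule U \<Gamma> M"
  obtains N q where "N \<in> mod_cat \<Gamma>" "q \<in> mod_hom \<Gamma> M N" "q ` carrier M = carrier N"
    "\<And>x. x \<in> carrier M \<Longrightarrow> q x = \<zero>\<^bsub>N\<^esub> \<longleftrightarrow> x \<in> U"
proof -
  obtain N :: "('g, 'a set) module" and q where N: "left_module \<Gamma> N" "q \<in> mod_hom \<Gamma> M N"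
    "q ` carrier M = carrier N" "\<And>x. x \<in> carrier M \<Longrightarrow> q x = \<zero>\<^bsub>N\<^esub> \<longleftrightarrow> x \<in> U"
    using quotient_exists[OF M U] by blast
  have fgN: "finitely_generated \<Gamma> N" by (rule finitely_generated_image[OF M N(1-3) fg])
  obtain L where L: "L \<in> mod_cat \<Gamma>" "mod_iso \<Gamma> N L" using fg_module_has_copy[OF N(1) fgN] by blast
  then obtain h where h: "h \<in> mod_hom \<Gamma> N L" "bij_betw h (carrier N) (carrier L)" by (elim mod_isoE)
  have "h (q x) = \<zero>\<^bsub>L\<^esub> \<longleftrightarrow> x \<in> U" if x: "x \<in> carrier M" for x
  proof -
    interpret N: left_module \<Gamma> N by fact
    have "h (q x) = h \<zero>\<^bsub>N\<^esub> \<longleftrightarrow> q x = \<zero>\<^bsub>N\<^esub>"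
      by (rule inj_on_eq_iff) (use h(2) x mod_homD(1)[OF N(2)] in \<open>auto simp: bij_betw_def\<close>)
    then show ?thesis using N(4)[OF x] mod_hom_zero[OF N(1) mod_catD(1)[OF L(1)] h(1)] by simp
  qed
  moreover have "(\<lambda>x. h (q x)) ` carrier M = carrier L"
    using N(3) h(2) unfolding bij_betw_def by (metis image_image)
  ultimately show thesis using that[OF L(1) mod_hom_compose[OF N(2) h(1)]] by blast
qed

section \<open>Torsion pairs\<close>

text \<open>There are no nonzero homomorphisms from \<open>M\<close> to \<open>N\<close>.\<close>

definition hom_vanishes :: "('g, 'c) ring_scheme \<Rightarrow> ('g, 'a) module \<Rightarrow> ('g, 'b) module \<Rightarrow> bool" where
  "hom_vanishes \<Gamma> M N \<longleftrightarrow> (\<forall>f\<in>mod_hom \<Gamma> M N. \<forall>x\<in>carrier M. f x = \<zero>\<^bsub>N\<^esub>)"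

lemma hom_vanishesD: "hom_vanishes \<Gamma> M N \<Longrightarrow> f \<in> mod_hom \<Gamma> M N \<Longrightarrow> x \<in> carrier M \<Longrightarrow> f x = \<zero>\<^bsub>N\<^esub>"
  by (auto simp: hom_vanishes_def)

lemma hom_vanishes_image:
  assumes "hom_vanishes \<Gamma> M Y" "f \<in> mod_hom \<Gamma> M N" "f ` carrier M = carrier N"
  shows "hom_vanishes \<Gamma> N Y"
  unfolding hom_vanishes_def
proof (intro ballI)
  fix g x assume g: "g \<in> mod_hom \<Gamma> N Y" and "x \<in> carrier N"
  then obtain y where "y \<in> carrier M" "x = f y" using assms(3) by (metis imageE)
  then show "g x = \<zero>\<^bsub>Y\<^esub>" using hom_vanishesD[OF assms(1) mod_hom_compose[OF assms(2) g]] by simp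
qed

lemma hom_vanishes_iso: "hom_vanishes \<Gamma> M Y \<Longrightarrow> mod_iso \<Gamma> M N \<Longrightarrow> hom_vanishes \<Gamma> N Y"
  by (elim mod_isoE) (auto simp: bij_betw_def intro: hom_vanishes_image)

lemma hom_vanishes_iso_codomain:
  assumes M: "left_module \<Gamma> M" and N: "left_module \<Gamma> N" and van: "hom_vanishes \<Gamma> X M"
    and iso: "mod_iso \<Gamma> M N"
  shows "hom_vanishes \<Gamma> X N"
  unfolding hom_vanishes_def
proof (intro ballI)
  fix f x assume f: "f \<in> mod_hom \<Gamma> X N" and x: "x \<in> carrier X"
  obtain h where h: "h \<in> mod_hom \<Gamma> M N" "bij_betw h (carrier M) (carrier N)" using iso by (elim mod_isoE)
  let ?h = "inv_into (carrier M) h"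
  have "?h (f x) = \<zero>\<^bsub>M\<^esub>"
    using hom_vanishesD[OF van mod_hom_compose[OF f mod_hom_inverse(1)[OF M h]] x] .
  then have "f x = h \<zero>\<^bsub>M\<^esub>" using bij_betw_inv_into_right[OF h(2) mod_homD(1)[OF f x]] by simp
  then show "f x = \<zero>\<^bsub>N\<^esub>" using mod_hom_zero[OF M N h(1)] by simp
qed

lemma hom_vanishes_submodule:
  assumes "hom_vanishes \<Gamma> M N" "U \<subseteq> carrier N"
  shows "hom_vanishes \<Gamma> M (N \<restriction> U)"
  unfolding hom_vanishes_def
proof (intro ballI)
  fix f x assume "f \<in> mod_hom \<Gamma> M (N \<restriction> U)" "x \<in> carrier M"
  then show "f x = \<zero>\<^bsub>N \<restriction> U\<^esub>"
    using hom_vanishesD[OF assms(1) mod_hom_compose[OF _ mod_hom_inclusion[OF assms(2)]]] by simp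
qed

text \<open>The class of modules without nonzero homomorphisms to \<open>Y\<close> has the closure property used in
  \<open>torsion_classI\<close> below.\<close>

lemma hom_vanishes_ext:
  assumes M: "left_module \<Gamma> M" and N: "left_module \<Gamma> N" and X: "left_module \<Gamma> X"
    and Y: "left_module \<Gamma> Y"
    and f: "f \<in> mod_hom \<Gamma> X N" and g: "g \<in> mod_hom \<Gamma> M N" "g ` carrier M = carrier N"
    and van: "hom_vanishes \<Gamma> X Y" "hom_vanishes \<Gamma> (M \<restriction> {x \<in> carrier M. g x = \<zero>\<^bsub>N\<^esub>}) Y"
  shows "hom_vanishes \<Gamma> (M \<restriction> {x \<in> carrier M. g x \<in> f ` carrier X}) Y"
  unfolding hom_vanishes_def
proof (intro ballI)
  let ?V = "{x \<in> carrier M. g x \<in> f ` carrier X}"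
  interpret X: left_module \<Gamma> X by fact
  have I: "submodule (f ` carrier X) \<Gamma> N" by (rule submodule_image[OF X N f X.submodule_carrier])
  have V: "submodule ?V \<Gamma> M" by (rule submodule_vimage[OF M N g(1) I])
  have z: "\<zero>\<^bsub>N\<^esub> \<in> f ` carrier X" using left_module.submoduleD(2)[OF N I] .
  fix h x assume h: "h \<in> mod_hom \<Gamma> (M \<restriction> ?V) Y" and x: "x \<in> carrier (M \<restriction> ?V)"
  have "{x \<in> carrier M. g x = \<zero>\<^bsub>N\<^esub>} \<subseteq> carrier (M \<restriction> ?V)" using z by auto
  then have "h \<in> mod_hom \<Gamma> (M \<restriction> {x \<in> carrier M. g x = \<zero>\<^bsub>N\<^esub>}) Y"
    using mod_hom_restr_domain[OF h, of "{x \<in> carrier M. g x = \<zero>\<^bsub>N\<^esub>}"] by simp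
  then have h0: "h y = \<zero>\<^bsub>Y\<^esub>" if "y \<in> carrier M" "g y = \<zero>\<^bsub>N\<^esub>" for y
    using hom_vanishesD[OF van(2), of h y] that by simp
  have g': "g \<in> mod_hom \<Gamma> (M \<restriction> ?V) (N \<restriction> f ` carrier X)"
    by (intro mod_hom_restr_codomain mod_hom_restr_domain[OF g(1)]) auto
  have surj: "g ` carrier (M \<restriction> ?V) = carrier (N \<restriction> f ` carrier X)"
  proof
    show "carrier (N \<restriction> f ` carrier X) \<subseteq> g ` carrier (M \<restriction> ?V)"
    proof
      fix y assume y: "y \<in> carrier (N \<restriction> f ` carrier X)"
      then have "y \<in> g ` carrier M" using g(2) mod_homD(1)[OF f] by auto
      then show "y \<in> g ` carrier (M \<restriction> ?V)" using y by auto
    qed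
  qed auto
  obtain k where k: "k \<in> mod_hom \<Gamma> (N \<restriction> f ` carrier X) Y"
    "\<And>x. x \<in> carrier (M \<restriction> ?V) \<Longrightarrow> k (g x) = h x"
    by (rule mod_hom_factor[OF left_module_restr[OF M V] left_module_restr[OF N I] Y g' surj h])
       (auto simp: h0)
  have f': "f \<in> mod_hom \<Gamma> X (N \<restriction> f ` carrier X)" by (rule mod_hom_restr_codomain[OF f]) simp
  obtain w where "w \<in> carrier X" "g x = f w" using x by auto
  then show "h x = \<zero>\<^bsub>Y\<^esub>"
    using k(2)[OF x] hom_vanishesD[OF van(1) mod_hom_compose[OF f' k(1)]] by simp
qed

lemma hom_vanishes_zero_module:
  assumes "left_module \<Gamma> M" "left_module \<Gamma> Y" "carrier M = {\<zero>\<^bsub>M\<^esub>}" shows "hom_vanishes \<Gamma> M Y"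
  using assms mod_hom_zero[of \<Gamma> M Y] by (auto simp: hom_vanishes_def)

text \<open>A torsion class consists of all objects without nonzero homomorphisms to torsion-free
  objects.\<close>

lemma torsion_pair_perp:
  assumes tp: "torsion_pair \<Gamma> \<A> \<T> \<F>" and \<A>: "\<And>M. M \<in> \<A> \<Longrightarrow> left_module \<Gamma> M"
  shows "\<T> = {M \<in> \<A>. \<forall>N\<in>\<F>. hom_vanishes \<Gamma> M N}"
proof (intro equalityI subsetI)
  fix M assume "M \<in> \<T>"
  moreover have "\<T> \<subseteq> \<A>" "\<forall>L\<in>\<T>. \<forall>N\<in>\<F>. hom_vanishes \<Gamma> L N"
    using tp by (simp_all add: torsion_pair_def is_subcategory_def hom_vanishes_def)
  ultimately show "M \<in> {M \<in> \<A>. \<forall>N\<in>\<F>. hom_vanishes \<Gamma> M N}" by auto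
next
  fix M assume "M \<in> {M \<in> \<A>. \<forall>N\<in>\<F>. hom_vanishes \<Gamma> M N}"
  then have M: "M \<in> \<A>" "\<And>N. N \<in> \<F> \<Longrightarrow> hom_vanishes \<Gamma> M N" by auto
  obtain L N f g where L: "L \<in> \<T>" and N: "N \<in> \<F>" and se: "short_exact \<Gamma> L f M g N"
    using tp M(1) unfolding torsion_pair_def by meson
  have "f \<in> mod_hom \<Gamma> L M" "inj_on f (carrier L)" "g \<in> mod_hom \<Gamma> M N"
    "f ` carrier L = {x \<in> carrier M. g x = \<zero>\<^bsub>N\<^esub>}"
    using se by (auto simp: short_exact_def a_kernel_def')
  then have "bij_betw f (carrier L) (carrier M)" "f \<in> mod_hom \<Gamma> L M"
    using hom_vanishesD[OF M(2)[OF N]] by (auto simp: bij_betw_def)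
  then have "mod_iso \<Gamma> L M" by (auto simp: mod_iso_def)
  moreover have "\<forall>M\<in>\<T>. \<forall>N\<in>\<A>. mod_iso \<Gamma> M N \<longrightarrow> N \<in> \<T>"
    using tp by (simp add: torsion_pair_def is_subcategory_def)
  ultimately show "M \<in> \<T>" using L M(1) by simp
qed

text \<open>Assumption \<open>ext\<close>: if the kernel of a surjection \<open>g : M \<rightarrow> N\<close> lies in the class, then so does the
  preimage of the image of every \<open>f : X \<rightarrow> N\<close> with \<open>X\<close> in the class. Hence, for a maximal submodule
  \<open>U\<close> of \<open>M\<close> in the class, all homomorphisms from members of the class to \<open>M/U\<close> vanish.\<close>

lemma torsion_classI:
  fixes Q :: "('g, 'g list set) module \<Rightarrow> bool"
  assumes noeth: "\<And>M. M \<in> mod_cat \<Gamma> \<Longrightarrow> noetherian_mod \<Gamma> M"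
    and iso: "\<And>M N. \<lbrakk>M \<in> mod_cat \<Gamma>; N \<in> mod_cat \<Gamma>; mod_iso \<Gamma> M N; Q M\<rbrakk> \<Longrightarrow> Q N"
    and zero: "\<And>M. \<lbrakk>M \<in> mod_cat \<Gamma>; carrier M = {\<zero>\<^bsub>M\<^esub>}\<rbrakk> \<Longrightarrow> Q M"
    and ext: "\<And>X M N f g. \<lbrakk>X \<in> mod_cat \<Gamma>; M \<in> mod_cat \<Gamma>; N \<in> mod_cat \<Gamma>; f \<in> mod_hom \<Gamma> X N;
      g \<in> mod_hom \<Gamma> M N; g ` carrier M = carrier N; Q X; Q (M \<restriction> {x \<in> carrier M. g x = \<zero>\<^bsub>N\<^esub>})\<rbrakk> \<Longrightarrow>
      Q (M \<restriction> {x \<in> carrier M. g x \<in> f ` carrier X})"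
  shows "{M \<in> mod_cat \<Gamma>. Q M} \<in> tors \<Gamma>"
proof -
  let ?T = "{M \<in> mod_cat \<Gamma>. Q M}"
  let ?F = "{N \<in> mod_cat \<Gamma>. \<forall>M\<in>?T. hom_vanishes \<Gamma> M N}"
  have "torsion_pair \<Gamma> (mod_cat \<Gamma>) ?T ?F"
    unfolding torsion_pair_def
  proof (intro conjI ballI)
    show "is_subcategory \<Gamma> (mod_cat \<Gamma>) ?T" using iso by (auto simp: is_subcategory_def)
    show "is_subcategory \<Gamma> (mod_cat \<Gamma>) ?F"
      unfolding is_subcategory_def
    proof (intro conjI ballI impI)
      fix M N assume M: "M \<in> ?F" and N: "N \<in> mod_cat \<Gamma>" and iso: "mod_iso \<Gamma> M N"
      have "left_module \<Gamma> M" "left_module \<Gamma> N" using M N mod_catD by auto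
      then have "hom_vanishes \<Gamma> X N" if "X \<in> ?T" for X
        using hom_vanishes_iso_codomain[of \<Gamma> M N X] M iso that by simp
      then show "N \<in> ?F" using N by simp
    qed auto
  next
    fix L N f x assume "L \<in> ?T" "N \<in> ?F" "f \<in> mod_hom \<Gamma> L N" "x \<in> carrier L"
    then show "f x = \<zero>\<^bsub>N\<^esub>" by (simp add: hom_vanishes_def)
  next
    fix M assume M: "M \<in> mod_cat \<Gamma>"
    then interpret M: left_module \<Gamma> M by (rule mod_catD)
    note Ml = mod_catD(1)[OF M] and Mn = noeth[OF M]
    have rmod: "M \<restriction> U \<in> mod_cat \<Gamma>" if "submodule U \<Gamma> M" for U
      using left_module_restr[OF Ml that] finitely_generated_restr_iff[OF Ml that] Mn that
      by (auto simp: mod_cat_def noetherian_mod_def)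
    let ?\<S> = "{U. submodule U \<Gamma> M \<and> Q (M \<restriction> U)}"
    have "{\<zero>\<^bsub>M\<^esub>} \<in> ?\<S>" using M.submodule_zero zero[OF rmod[OF M.submodule_zero]] by simp
    then obtain U where U: "U \<in> ?\<S>" "\<And>V. V \<in> ?\<S> \<Longrightarrow> U \<subseteq> V \<Longrightarrow> V = U"
      using noetherian_mod_maximal[OF Ml Mn, of ?\<S>] by blast
    then have Us: "submodule U \<Gamma> M" and UQ: "Q (M \<restriction> U)" by auto
    note u = M.submoduleD[OF Us]
    obtain N q where N: "N \<in> mod_cat \<Gamma>" "q \<in> mod_hom \<Gamma> M N" "q ` carrier M = carrier N"
      "\<And>x. x \<in> carrier M \<Longrightarrow> q x = \<zero>\<^bsub>N\<^esub> \<longleftrightarrow> x \<in> U"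
      using quotient_mod_cat[OF Ml mod_catD(2)[OF M] Us] by blast
    have ker: "{x \<in> carrier M. q x = \<zero>\<^bsub>N\<^esub>} = U" using N(4) u(1) by auto
    have "f x = \<zero>\<^bsub>N\<^esub>" if X: "X \<in> ?T" and f: "f \<in> mod_hom \<Gamma> X N" and x: "x \<in> carrier X" for X f x
    proof -
      let ?V = "{x \<in> carrier M. q x \<in> f ` carrier X}"
      have Xl: "left_module \<Gamma> X" and Nl: "left_module \<Gamma> N" using X N mod_catD by auto
      interpret X: left_module \<Gamma> X by fact
      have z: "\<zero>\<^bsub>N\<^esub> \<in> f ` carrier X" using mod_hom_zero[OF Xl Nl f] X.M.zero_closed by (metis imageI)
      have "submodule ?V \<Gamma> M"
        by (rule submodule_vimage[OF Ml Nl N(2) submodule_image[OF Xl Nl f X.submodule_carrier]])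
      moreover have "Q (M \<restriction> ?V)" using ext[OF _ M N(1) f N(2,3)] X UQ ker by simp
      moreover have "U \<subseteq> ?V" using ker z by auto
      ultimately have "?V = U" using U(2) by auto
      moreover obtain y where "y \<in> carrier M" "q y = f x"
        using N(3) mod_homD(1)[OF f x] by (metis imageE)
      ultimately show ?thesis using N(4)[of y] x by auto
    qed
    then have "N \<in> ?F" using N(1) by (auto simp: hom_vanishes_def)
    moreover have "short_exact \<Gamma> (M \<restriction> U) (\<lambda>x. x) M q N"
      using N u(1) ker by (auto simp: short_exact_def a_kernel_def' intro: mod_hom_inclusion)
    moreover have "M \<restriction> U \<in> ?T" using rmod[OF Us] UQ by simp
    ultimately show "\<exists>L\<in>?T. \<exists>N\<in>?F. \<exists>f g. short_exact \<Gamma> L f M g N" by blast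
  qed
  then show ?thesis by (auto simp: tors_def torsion_classes_def)
qed

subsection \<open>Factor modules of finite direct sums\<close>

text \<open>A homomorphism from the direct sum vanishes because it vanishes on each summand, and a direct
  summand \<open>U i\<close> is the image of \<open>M\<close> under the projection \<open>p\<close> along a complement.\<close>

lemma Fac_hom_vanishes:
  assumes M: "left_module \<Gamma> M" and Y: "left_module \<Gamma> Y" and X: "X \<in> Fac \<Gamma> M"
    and van: "hom_vanishes \<Gamma> M Y"
  shows "hom_vanishes \<Gamma> X Y"
proof -
  interpret M: left_module \<Gamma> M by fact
  interpret Y: left_module \<Gamma> Y by fact
  obtain n U f where U: "\<And>i. i < n \<Longrightarrow> direct_summand \<Gamma> M (U i)"
    and f: "f \<in> mod_hom \<Gamma> (direct_sum n (\<lambda>i. M \<restriction> U i)) X"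
    "f ` carrier (direct_sum n (\<lambda>i. M \<restriction> U i)) = carrier X"
    using X by (auto simp: Fac_def Let_def)
  let ?D = "direct_sum n (\<lambda>i. M \<restriction> U i)"
  have Us: "submodule (U i) \<Gamma> M" if "i < n" for i using U[OF that] by (simp add: direct_summand_def)
  note us = M.submoduleD[OF Us]
  have "hom_vanishes \<Gamma> ?D Y"
    unfolding hom_vanishes_def
  proof (intro ballI)
    fix h x assume h: "h \<in> mod_hom \<Gamma> ?D Y" and x: "x \<in> carrier ?D"
    note h' = mod_homD[OF h]
    have x': "x i \<in> U i" if "i < n" for i using x that by (auto simp: direct_sum_def)
    define e where "e j u = (\<lambda>i\<in>{..<n}. if i = j then u else \<zero>\<^bsub>M\<^esub>)" for j :: nat and u
    have ec: "e j u \<in> carrier ?D" if "u \<in> U j" for j u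
      using that us(2) by (auto simp: e_def direct_sum_def)
    have e0: "h (e j u) = \<zero>\<^bsub>Y\<^esub>" if j: "j < n" and u: "u \<in> U j" for j u
    proof -
      obtain W where W: "submodule W \<Gamma> M" "U j \<inter> W = {\<zero>\<^bsub>M\<^esub>}" "U j <+>\<^bsub>M\<^esub> W = carrier M"
        using U[OF j] by (auto simp: direct_summand_def)
      note w = M.submoduleD[OF W(1)] M.submodule_diff[OF W(1)] and uj = us[OF j] M.submodule_diff[OF Us[OF j]]
      define p where "p m = (THE v. v \<in> U j \<and> (\<exists>w\<in>W. m = v \<oplus>\<^bsub>M\<^esub> w))" for m
      have p_eq: "p (v \<oplus>\<^bsub>M\<^esub> w) = v" if v: "v \<in> U j" and w': "w \<in> W" for v w
        unfolding p_def
      proof (rule the_equality)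
        show "v \<in> U j \<and> (\<exists>w'\<in>W. v \<oplus>\<^bsub>M\<^esub> w = v \<oplus>\<^bsub>M\<^esub> w')" using v w' by blast
      next
        fix v' assume "v' \<in> U j \<and> (\<exists>w'\<in>W. v \<oplus>\<^bsub>M\<^esub> w = v' \<oplus>\<^bsub>M\<^esub> w')"
        then obtain w1 where v': "v' \<in> U j" "w1 \<in> W" "v \<oplus>\<^bsub>M\<^esub> w = v' \<oplus>\<^bsub>M\<^esub> w1" by blast
        have c: "v \<in> carrier M" "w \<in> carrier M" "v' \<in> carrier M" "w1 \<in> carrier M"
          using v w' v' uj(1) w(1) by auto
        have "(v' \<ominus>\<^bsub>M\<^esub> v) \<oplus>\<^bsub>M\<^esub> (w1 \<ominus>\<^bsub>M\<^esub> w) = \<zero>\<^bsub>M\<^esub>"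
          using c v'(3) by (simp add: M.diff_add_diff M.diff_eq_zero_iff)
        then have "\<ominus>\<^bsub>M\<^esub> (w1 \<ominus>\<^bsub>M\<^esub> w) = v' \<ominus>\<^bsub>M\<^esub> v" using c by (intro M.M.minus_equality) auto
        then have "v' \<ominus>\<^bsub>M\<^esub> v = w \<ominus>\<^bsub>M\<^esub> w1" using c by (simp add: M.minus_diff)
        then have "v' \<ominus>\<^bsub>M\<^esub> v \<in> U j \<inter> W" using uj(6)[OF v'(1) v] w(6)[OF w' v'(2)] by simp
        then have "v' \<ominus>\<^bsub>M\<^esub> v = \<zero>\<^bsub>M\<^esub>" using W(2) by simp
        then show "v' = v" using M.diff_eq_zero_iff[OF c(3,1)] by simp
      qed
      have dec: "\<exists>v\<in>U j. \<exists>w\<in>W. m = v \<oplus>\<^bsub>M\<^esub> w" if "m \<in> carrier M" for m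
      proof -
        have "m \<in> U j <+>\<^bsub>M\<^esub> W" using that W(3) by simp
        then show ?thesis by (auto simp: set_add_def set_mult_def)
      qed
      have p: "p \<in> mod_hom \<Gamma> M (M \<restriction> U j)"
      proof (rule mod_homI)
        fix m assume "m \<in> carrier M"
        then obtain v w where "v \<in> U j" "w \<in> W" "m = v \<oplus>\<^bsub>M\<^esub> w" using dec by meson
        then show "p m \<in> carrier (M \<restriction> U j)" using p_eq by simp
      next
        fix m m' assume "m \<in> carrier M" "m' \<in> carrier M"
        then obtain v w v' w' where *: "v \<in> U j" "w \<in> W" "v' \<in> U j" "w' \<in> W" "m = v \<oplus>\<^bsub>M\<^esub> w" "m' = v' \<oplus>\<^bsub>M\<^esub> w'"
          using dec by meson
        then have "m \<oplus>\<^bsub>M\<^esub> m' = (v \<oplus>\<^bsub>M\<^esub> v') \<oplus>\<^bsub>M\<^esub> (w \<oplus>\<^bsub>M\<^esub> w')"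
          using uj(1) w(1) by (simp add: subset_iff M.M.a_ac)
        then have "p (m \<oplus>\<^bsub>M\<^esub> m') = v \<oplus>\<^bsub>M\<^esub> v'" using p_eq[OF uj(3) w(3)] * by simp
        then show "p (m \<oplus>\<^bsub>M\<^esub> m') = p m \<oplus>\<^bsub>M \<restriction> U j\<^esub> p m'" using p_eq * by simp
      next
        fix a m assume a: "a \<in> carrier \<Gamma>" and "m \<in> carrier M"
        then obtain v w where *: "v \<in> U j" "w \<in> W" "m = v \<oplus>\<^bsub>M\<^esub> w" using dec by meson
        then have "a \<odot>\<^bsub>M\<^esub> m = a \<odot>\<^bsub>M\<^esub> v \<oplus>\<^bsub>M\<^esub> a \<odot>\<^bsub>M\<^esub> w"
          using uj(1) w(1) a by (simp add: subset_iff M.smult_r_distr)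
        then have "p (a \<odot>\<^bsub>M\<^esub> m) = a \<odot>\<^bsub>M\<^esub> v" using p_eq[OF uj(5) w(5)] * a by simp
        then show "p (a \<odot>\<^bsub>M\<^esub> m) = a \<odot>\<^bsub>M \<restriction> U j\<^esub> p m" using p_eq * by simp
      qed
      have e: "e j \<in> mod_hom \<Gamma> (M \<restriction> U j) ?D"
        by (rule mod_homI) (use ec in \<open>auto simp: e_def direct_sum_def fun_eq_iff\<close>)
      have "h (e j (p u)) = \<zero>\<^bsub>Y\<^esub>"
        using hom_vanishesD[OF van mod_hom_compose[OF mod_hom_compose[OF p e] h]] u uj(1) by auto
      moreover have "p u = u" using p_eq[OF u w(2)] u uj(1) by auto
      ultimately show ?thesis by simp
    qed
    \<comment> \<open>the truncations of \<open>x\<close> add up its components one at a time\<close>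
    define xk where "xk k = (\<lambda>i\<in>{..<n}. if i < k then x i else \<zero>\<^bsub>M\<^esub>)" for k :: nat
    have xkc: "xk k \<in> carrier ?D" for k
      using x' us(2) by (auto simp: xk_def direct_sum_def)
    have "h (xk k) = \<zero>\<^bsub>Y\<^esub>" if "k \<le> n" for k
      using that
    proof (induction k)
      case 0
      have "xk 0 = \<zero>\<^bsub>\<Gamma>\<^esub> \<odot>\<^bsub>?D\<^esub> xk 0" by (auto simp: xk_def direct_sum_def fun_eq_iff)
      then show ?case using h'(3)[of "\<zero>\<^bsub>\<Gamma>\<^esub>" "xk 0"] xkc[of 0] h'(1)[OF xkc[of 0]] by simp
    next
      case (Suc k)
      have "xk (Suc k) = xk k \<oplus>\<^bsub>?D\<^esub> e k (x k)"
        using x' us(1) by (auto simp: xk_def e_def direct_sum_def fun_eq_iff less_Suc_eq subset_iff)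
      then show ?case using Suc h'(2)[OF xkc ec, of "x k" k k] x'[of k] e0[of k "x k"] by simp
    qed
    then have "h (xk n) = \<zero>\<^bsub>Y\<^esub>" by simp
    moreover have "xk n = x" using x by (auto simp: xk_def direct_sum_def fun_eq_iff PiE_def extensional_def)
    ultimately show "h x = \<zero>\<^bsub>Y\<^esub>" by simp
  qed
  then show ?thesis by (rule hom_vanishes_image[OF _ f])
qed

lemma image_in_Fac:
  assumes M: "left_module \<Gamma> M" and N: "N \<in> mod_cat \<Gamma>"
    and f: "f \<in> mod_hom \<Gamma> M N" "f ` carrier M = carrier N"
  shows "N \<in> Fac \<Gamma> M"
proof -
  interpret M: left_module \<Gamma> M by fact
  have ds: "direct_summand \<Gamma> M (carrier M)"
    unfolding direct_summand_def set_add_def set_mult_def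
    by (intro conjI exI[of _ "{\<zero>\<^bsub>M\<^esub>}"] M.submodule_zero M.submodule_carrier) auto
  let ?D = "direct_sum 1 (\<lambda>i. M \<restriction> carrier M)"
  have "(\<lambda>x. f (x 0)) \<in> mod_hom \<Gamma> ?D N"
    by (rule mod_homI) (auto simp: direct_sum_def PiE_iff intro!: mod_homD[OF f(1)])
  moreover have "(\<lambda>x. f (x 0)) ` carrier ?D = carrier N"
  proof -
    have "f y \<in> (\<lambda>x. f (x 0)) ` carrier ?D" if "y \<in> carrier M" for y
      using that by (intro image_eqI[of _ _ "\<lambda>i\<in>{..<1}. y"]) (auto simp: direct_sum_def)
    then have "f ` carrier M \<subseteq> (\<lambda>x. f (x 0)) ` carrier ?D" by blast
    moreover have "(\<lambda>x. f (x 0)) ` carrier ?D \<subseteq> f ` carrier M"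
      by (auto simp: direct_sum_def PiE_iff)
    ultimately show ?thesis using f(2) by simp
  qed
  ultimately show ?thesis
    using N ds unfolding Fac_def Let_def by (intro CollectI conjI exI[of _ 1] exI[of _ "\<lambda>_. carrier M"]) auto
qed

section \<open>Noetherian rings and restriction of scalars\<close>

lemma restrict_scalars_simps [simp]:
  "carrier (restrict_scalars \<phi> M) = carrier M" "ring.zero (restrict_scalars \<phi> M) = ring.zero M"
  "ring.add (restrict_scalars \<phi> M) = ring.add M" "smult (restrict_scalars \<phi> M) a x = smult M (\<phi> a) x"
  by (auto simp: restrict_scalars_def)

lemma regular_module_simps [simp]:
  "carrier (regular_module \<Gamma>) = carrier \<Gamma>" "ring.zero (regular_module \<Gamma>) = ring.zero \<Gamma>"
  "ring.add (regular_module \<Gamma>) = ring.add \<Gamma>" "smult (regular_module \<Gamma>) = monoid.mult \<Gamma>"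
  by (auto simp: regular_module_def)

lemma left_module_regular:
  assumes "ring \<Gamma>" shows "left_module \<Gamma> (regular_module \<Gamma>)"
proof -
  interpret ring \<Gamma> by fact
  have "abelian_group (regular_module \<Gamma>)"
  proof (rule abelian_groupI)
    fix x assume "x \<in> carrier (regular_module \<Gamma>)"
    then show "\<exists>y\<in>carrier (regular_module \<Gamma>). y \<oplus>\<^bsub>regular_module \<Gamma>\<^esub> x = \<zero>\<^bsub>regular_module \<Gamma>\<^esub>"
      by (intro bexI[of _ "\<ominus>\<^bsub>\<Gamma>\<^esub> x"]) (auto simp: l_neg)
  qed (auto simp: a_ac)
  moreover have "left_module_axioms \<Gamma> (regular_module \<Gamma>)"
    by unfold_locales (auto simp: l_distr r_distr m_assoc)
  ultimately show ?thesis using ring_axioms by (simp add: left_module_def)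
qed

lemma left_module_restrict_scalars:
  assumes S: "ring S" and M: "left_module \<Gamma> M" and \<phi>: "\<phi> \<in> ring_hom S \<Gamma>"
  shows "left_module S (restrict_scalars \<phi> M)"
proof -
  interpret left_module \<Gamma> M by fact
  note h = ring_hom_memE[OF \<phi>]
  have "abelian_group (restrict_scalars \<phi> M)"
  proof (rule abelian_groupI)
    fix x assume "x \<in> carrier (restrict_scalars \<phi> M)"
    then show "\<exists>y\<in>carrier (restrict_scalars \<phi> M).
        y \<oplus>\<^bsub>restrict_scalars \<phi> M\<^esub> x = \<zero>\<^bsub>restrict_scalars \<phi> M\<^esub>"
      by (intro bexI[of _ "\<ominus>\<^bsub>M\<^esub> x"]) (auto simp: M.l_neg)
  qed (auto simp: M.a_ac)
  moreover have "left_module_axioms S (restrict_scalars \<phi> M)"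
    by unfold_locales (use h in \<open>auto simp: smult_l_distr smult_r_distr smult_assoc\<close>)
  ultimately show ?thesis using S by (simp add: left_module_def)
qed

lemma submodule_restrict_scalars:
  assumes S: "ring S" and M: "left_module \<Gamma> M" and \<phi>: "\<phi> \<in> ring_hom S \<Gamma>" and U: "submodule U \<Gamma> M"
  shows "submodule U S (restrict_scalars \<phi> M)"
proof -
  interpret left_module \<Gamma> M by fact
  interpret r: left_module S "restrict_scalars \<phi> M" by (rule left_module_restrict_scalars[OF S M \<phi>])
  show ?thesis
    by (rule r.left_submoduleI) (use submoduleD[OF U] ring_hom_memE(1)[OF \<phi>] in auto)
qed

lemma mod_hom_restrict_scalars:
  "f \<in> mod_hom \<Gamma> M N \<Longrightarrow> \<phi> \<in> ring_hom S \<Gamma> \<Longrightarrow> f \<in> mod_hom S (restrict_scalars \<phi> M) (restrict_scalars \<phi> N)"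
  by (auto simp: mod_hom_def dest: ring_hom_memE(1))

lemma cring_idealI:
  fixes R (structure)
  assumes "cring R" "I \<subseteq> carrier R" "\<zero> \<in> I" "\<And>a b. a \<in> I \<Longrightarrow> b \<in> I \<Longrightarrow> a \<oplus> b \<in> I"
    "\<And>r a. r \<in> carrier R \<Longrightarrow> a \<in> I \<Longrightarrow> r \<otimes> a \<in> I"
  shows "ideal I R"
proof -
  interpret cring R by fact
  have m: "\<ominus> a \<in> I" if "a \<in> I" for a
    using assms(5)[of "\<ominus> \<one>" a] that assms(2) by (auto simp: l_minus)
  have "subgroup I (add_monoid R)"
    by (rule subgroup.intro) (use assms m in \<open>auto simp: a_inv_def[symmetric]\<close>)
  then show ?thesis
  proof (rule idealI[OF ring_axioms])
    fix a x assume ax: "a \<in> I" "x \<in> carrier R"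
    then show "x \<otimes> a \<in> I" by (rule assms(5)[rotated])
    then show "a \<otimes> x \<in> I" using ax assms(2) m_comm[of a x] by auto
  qed
qed

text \<open>By induction on the generators of \<open>M\<close>: a submodule \<open>H\<close> is generated by one
  element for each generator of the ideal of the coefficients of the last generator of \<open>M\<close>, and by
  generators of the part of \<open>H\<close> in the span of the other generators.\<close>

lemma noetherian_mod_of_ring:
  fixes R (structure)
  assumes R: "cring R" "noetherian_ring R" and M: "left_module R M" and fg: "finitely_generated R M"
  shows "noetherian_mod R M"
proof -
  interpret R: cring R by fact
  interpret NR: noetherian_ring R by fact
  interpret M: left_module R M by fact
  have main: "fg_sub R M H"
    if "finite S" "S \<subseteq> carrier M" "submodule H R M" "H \<subseteq> mod_span R M S" for S H
    using that
  proof (induction S arbitrary: H)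
    case empty
    have "mod_span R M {} \<subseteq> {\<zero>\<^bsub>M\<^esub>}" by (rule mod_span_least[OF M.submodule_zero]) simp
    then have "H \<subseteq> mod_span R M {}" using empty by blast
    then show ?case unfolding fg_sub_def by (intro exI[of _ "{}"]) auto
  next
    case (insert x S)
    then have x: "x \<in> carrier M" and S: "S \<subseteq> carrier M" by auto
    have sp: "submodule (mod_span R M S) R M" by (rule submodule_mod_span[OF M S])
    note h = M.submoduleD[OF insert.prems(2)] M.submodule_diff[OF insert.prems(2)]
    note s = M.submoduleD[OF sp] M.submodule_diff[OF sp]
    have sc: "y \<in> carrier M" if "y \<in> mod_span R M S" for y using s(1) that by auto
    have hc: "y \<in> carrier M" if "y \<in> H" for y using h(1) that by auto
    \<comment> \<open>the ideal of the coefficients of \<open>x\<close> in elements of \<open>H\<close>\<close>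
    define I where "I = {a \<in> carrier R. \<exists>y\<in>mod_span R M S. a \<odot>\<^bsub>M\<^esub> x \<oplus>\<^bsub>M\<^esub> y \<in> H}"
    have "ideal I R"
    proof (rule cring_idealI[OF R(1)])
      show "\<zero> \<in> I" using s(2) h(2) x by (auto simp: I_def intro!: bexI[of _ "\<zero>\<^bsub>M\<^esub>"])
    next
      fix a b assume "a \<in> I" "b \<in> I"
      then obtain y z where *: "a \<in> carrier R" "b \<in> carrier R" "y \<in> mod_span R M S" "z \<in> mod_span R M S"
        "a \<odot>\<^bsub>M\<^esub> x \<oplus>\<^bsub>M\<^esub> y \<in> H" "b \<odot>\<^bsub>M\<^esub> x \<oplus>\<^bsub>M\<^esub> z \<in> H" by (auto simp: I_def)
      have "(a \<odot>\<^bsub>M\<^esub> x \<oplus>\<^bsub>M\<^esub> y) \<oplus>\<^bsub>M\<^esub> (b \<odot>\<^bsub>M\<^esub> x \<oplus>\<^bsub>M\<^esub> z) = (a \<oplus> b) \<odot>\<^bsub>M\<^esub> x \<oplus>\<^bsub>M\<^esub> (y \<oplus>\<^bsub>M\<^esub> z)"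
        using * sc x by (simp add: M.smult_l_distr M.M.a_ac)
      then show "a \<oplus> b \<in> I" using h(3)[OF *(5,6)] s(3)[OF *(3,4)] *(1,2) by (auto simp: I_def)
    next
      fix r a assume r: "r \<in> carrier R" and "a \<in> I"
      then obtain y where *: "a \<in> carrier R" "y \<in> mod_span R M S" "a \<odot>\<^bsub>M\<^esub> x \<oplus>\<^bsub>M\<^esub> y \<in> H"
        by (auto simp: I_def)
      have "r \<odot>\<^bsub>M\<^esub> (a \<odot>\<^bsub>M\<^esub> x \<oplus>\<^bsub>M\<^esub> y) = (r \<otimes> a) \<odot>\<^bsub>M\<^esub> x \<oplus>\<^bsub>M\<^esub> r \<odot>\<^bsub>M\<^esub> y"
        using * sc x r by (simp add: M.smult_r_distr M.smult_assoc)
      then show "r \<otimes> a \<in> I" using h(5)[OF r *(3)] s(5)[OF r *(2)] *(1) r by (auto simp: I_def)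
    qed (auto simp: I_def)
    then obtain A where A: "A \<subseteq> carrier R" "finite A" "I = Idl A" using NR.finetely_gen by blast
    have "A \<subseteq> I" unfolding A(3) by (rule R.genideal_self[OF A(1)])
    then have "\<forall>a\<in>A. \<exists>y. y \<in> mod_span R M S \<and> a \<odot>\<^bsub>M\<^esub> x \<oplus>\<^bsub>M\<^esub> y \<in> H" by (auto simp: I_def)
    then obtain y where y: "\<And>a. a \<in> A \<Longrightarrow> y a \<in> mod_span R M S" "\<And>a. a \<in> A \<Longrightarrow> a \<odot>\<^bsub>M\<^esub> x \<oplus>\<^bsub>M\<^esub> y a \<in> H"
      by metis
    define G where "G = (\<lambda>a. a \<odot>\<^bsub>M\<^esub> x \<oplus>\<^bsub>M\<^esub> y a) ` A"
    have G: "finite G" "G \<subseteq> H" using A(2) y(2) by (auto simp: G_def)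
    have GM: "G \<subseteq> carrier M" using G(2) h(1) by blast
    note gs = submodule_mod_span[OF M GM]
    note g = M.submoduleD[OF gs]
    have gc: "w \<in> carrier M" if "w \<in> mod_span R M G" for w using g(1) that by auto
    \<comment> \<open>the coefficients of \<open>x\<close> that occur in the span of \<open>G\<close>\<close>
    define J where "J = {a \<in> carrier R. \<exists>w\<in>mod_span R M G. w \<ominus>\<^bsub>M\<^esub> a \<odot>\<^bsub>M\<^esub> x \<in> mod_span R M S}"
    have "ideal J R"
    proof (rule cring_idealI[OF R(1)])
      have "\<zero>\<^bsub>M\<^esub> \<ominus>\<^bsub>M\<^esub> \<zero> \<odot>\<^bsub>M\<^esub> x = \<zero>\<^bsub>M\<^esub>" using x by (simp add: M.diff_eq_zero_iff)
      then show "\<zero> \<in> J" using s(2) g(2) by (auto simp: J_def intro!: bexI[of _ "\<zero>\<^bsub>M\<^esub>"])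
    next
      fix a b assume "a \<in> J" "b \<in> J"
      then obtain v w where *: "a \<in> carrier R" "b \<in> carrier R" "v \<in> mod_span R M G" "w \<in> mod_span R M G"
        "v \<ominus>\<^bsub>M\<^esub> a \<odot>\<^bsub>M\<^esub> x \<in> mod_span R M S" "w \<ominus>\<^bsub>M\<^esub> b \<odot>\<^bsub>M\<^esub> x \<in> mod_span R M S" by (auto simp: J_def)
      have "(v \<ominus>\<^bsub>M\<^esub> a \<odot>\<^bsub>M\<^esub> x) \<oplus>\<^bsub>M\<^esub> (w \<ominus>\<^bsub>M\<^esub> b \<odot>\<^bsub>M\<^esub> x) = (v \<oplus>\<^bsub>M\<^esub> w) \<ominus>\<^bsub>M\<^esub> (a \<oplus> b) \<odot>\<^bsub>M\<^esub> x"
        using * gc x by (simp add: M.smult_l_distr M.diff_add_diff)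
      then show "a \<oplus> b \<in> J" using s(3)[OF *(5,6)] g(3)[OF *(3,4)] *(1,2) by (auto simp: J_def)
    next
      fix r a assume r: "r \<in> carrier R" and "a \<in> J"
      then obtain v where *: "a \<in> carrier R" "v \<in> mod_span R M G" "v \<ominus>\<^bsub>M\<^esub> a \<odot>\<^bsub>M\<^esub> x \<in> mod_span R M S"
        by (auto simp: J_def)
      have "r \<odot>\<^bsub>M\<^esub> (v \<ominus>\<^bsub>M\<^esub> a \<odot>\<^bsub>M\<^esub> x) = r \<odot>\<^bsub>M\<^esub> v \<ominus>\<^bsub>M\<^esub> (r \<otimes> a) \<odot>\<^bsub>M\<^esub> x"
        using * gc x r by (simp add: M.smult_diff M.smult_assoc)
      then show "r \<otimes> a \<in> J" using s(5)[OF r *(3)] g(5)[OF r *(2)] *(1) r by (auto simp: J_def)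
    qed (auto simp: J_def)
    moreover have "A \<subseteq> J"
    proof
      fix a assume a: "a \<in> A"
      then have c: "a \<in> carrier R" "y a \<in> carrier M" using A(1) y(1) sc by auto
      then have "(a \<odot>\<^bsub>M\<^esub> x \<oplus>\<^bsub>M\<^esub> y a) \<ominus>\<^bsub>M\<^esub> a \<odot>\<^bsub>M\<^esub> x = y a"
        using x by (simp add: a_minus_def M.M.a_ac M.M.r_neg M.M.r_neg2 M.M.r_neg1)
      moreover have "a \<odot>\<^bsub>M\<^esub> x \<oplus>\<^bsub>M\<^esub> y a \<in> mod_span R M G"
        using a mod_span_superset[of G R M] by (auto simp: G_def)
      ultimately show "a \<in> J" using y(1)[OF a] c(1) unfolding J_def by (intro CollectI conjI bexI) simp_all
    qed
    ultimately have IJ: "I \<subseteq> J" unfolding A(3) by (rule R.genideal_minimal)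
    have "submodule (H \<inter> mod_span R M S) R M" by (rule M.submodule_Int[OF insert.prems(2) sp])
    then have "fg_sub R M (H \<inter> mod_span R M S)" using insert.IH[OF S] by blast
    then obtain T where T: "finite T" "T \<subseteq> H \<inter> mod_span R M S" "H \<inter> mod_span R M S \<subseteq> mod_span R M T"
      by (auto simp: fg_sub_def)
    have GT: "G \<union> T \<subseteq> carrier M" using GM T(2) h(1) by blast
    note gt = M.submoduleD(3)[OF submodule_mod_span[OF M GT]]
    have "H \<subseteq> mod_span R M (G \<union> T)"
    proof
      fix v assume v: "v \<in> H"
      then obtain a z where az: "a \<in> carrier R" "z \<in> mod_span R M S" "v = a \<odot>\<^bsub>M\<^esub> x \<oplus>\<^bsub>M\<^esub> z"
        using mod_span_insert[OF M insert.prems(1), of v] insert.prems(3) by blast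
      then have "a \<in> I" using v by (auto simp: I_def)
      then obtain w where w: "w \<in> mod_span R M G" "w \<ominus>\<^bsub>M\<^esub> a \<odot>\<^bsub>M\<^esub> x \<in> mod_span R M S"
        using IJ by (auto simp: J_def)
      have wH: "w \<in> H" using w(1) mod_span_least[OF insert.prems(2) G(2)] by blast
      have c: "a \<odot>\<^bsub>M\<^esub> x \<in> carrier M" "z \<in> carrier M" "w \<in> carrier M" "v \<in> carrier M"
        using az x sc gc w v hc by auto
      have "v \<ominus>\<^bsub>M\<^esub> w = (a \<odot>\<^bsub>M\<^esub> x \<ominus>\<^bsub>M\<^esub> w) \<oplus>\<^bsub>M\<^esub> z"
        unfolding az(3) using c by (simp add: a_minus_def M.M.a_ac)
      also have "\<dots> = z \<ominus>\<^bsub>M\<^esub> (w \<ominus>\<^bsub>M\<^esub> a \<odot>\<^bsub>M\<^esub> x)"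
        using c by (simp add: a_minus_def M.M.a_ac M.M.minus_add)
      finally have "v \<ominus>\<^bsub>M\<^esub> w \<in> H \<inter> mod_span R M S" using s(6)[OF az(2) w(2)] h(6)[OF v wH] by simp
      then have "v \<ominus>\<^bsub>M\<^esub> w \<in> mod_span R M (G \<union> T)" "w \<in> mod_span R M (G \<union> T)"
        using T(3) w(1) mod_span_mono[of T "G \<union> T" R M] mod_span_mono[of G "G \<union> T" R M] by blast+
      then have "w \<oplus>\<^bsub>M\<^esub> (v \<ominus>\<^bsub>M\<^esub> w) \<in> mod_span R M (G \<union> T)" using gt by blast
      moreover have "w \<oplus>\<^bsub>M\<^esub> (v \<ominus>\<^bsub>M\<^esub> w) = v" using c by (simp add: a_minus_def M.M.a_ac M.M.r_neg M.M.r_neg2 M.M.r_neg1)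
      ultimately show "v \<in> mod_span R M (G \<union> T)" by simp
    qed
    moreover have "finite (G \<union> T)" "G \<union> T \<subseteq> H" using G T by auto
    ultimately show ?case unfolding fg_sub_def by blast
  qed
  obtain S where "finite S" "S \<subseteq> carrier M" "carrier M \<subseteq> mod_span R M S"
    using fg finitely_generated_iff[OF M] by (auto simp: fg_sub_def)
  then show ?thesis
    unfolding noetherian_mod_def using main M.submoduleD(1) by (meson subset_trans)
qed

text \<open>A composition series yields generators: one element of each member outside the previous.\<close>

lemma finite_length_imp_finitely_generated:
  assumes M: "left_module \<Gamma> M" and fl: "finite_length \<Gamma> M"
  shows "finitely_generated \<Gamma> M"
proof -
  interpret M: left_module \<Gamma> M by fact
  obtain n N where N: "N 0 = {\<zero>\<^bsub>M\<^esub>}" "N n = carrier M" "\<And>i. i \<le> n \<Longrightarrow> submodule (N i) \<Gamma> M"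
    "\<And>i. i < n \<Longrightarrow> N i \<subset> N (Suc i)"
    "\<And>i L. i < n \<Longrightarrow> submodule L \<Gamma> M \<Longrightarrow> N i \<subset> L \<Longrightarrow> L \<subset> N (Suc i) \<Longrightarrow> False"
    using fl unfolding finite_length_def by metis
  have "fg_sub \<Gamma> M (N i)" if "i \<le> n" for i
    using that
  proof (induction i)
    case 0
    have "{\<zero>\<^bsub>M\<^esub>} \<subseteq> mod_span \<Gamma> M {}"
      using M.submoduleD(2)[OF submodule_mod_span[OF M, of "{}"]] by simp
    then show ?case unfolding fg_sub_def N(1) by (intro exI[of _ "{}"]) auto
  next
    case (Suc i)
    then obtain S where S: "finite S" "S \<subseteq> N i" "N i \<subseteq> mod_span \<Gamma> M S" by (auto simp: fg_sub_def)
    obtain x where x: "x \<in> N (Suc i)" "x \<notin> N i" using N(4)[of i] Suc.prems by auto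
    let ?L = "mod_span \<Gamma> M (insert x S)"
    have S': "insert x S \<subseteq> N (Suc i)" using S x N(4)[of i] Suc.prems by auto
    then have L: "submodule ?L \<Gamma> M"
      using M.submoduleD(1)[OF N(3)[OF Suc.prems]] by (intro submodule_mod_span[OF M]) auto
    have "N i \<subseteq> ?L" using S(3) mod_span_mono[of S "insert x S" \<Gamma> M] by blast
    moreover have "x \<in> ?L" using mod_span_superset[of "insert x S" \<Gamma> M] by blast
    ultimately have "N i \<subset> ?L" using x by blast
    moreover have "?L \<subseteq> N (Suc i)" by (rule mod_span_least[OF N(3)[OF Suc.prems] S'])
    ultimately have "?L = N (Suc i)" using N(5)[of i ?L, OF _ L] Suc.prems by (metis Suc_le_eq psubsetI)
    then show ?case using S(1) S' unfolding fg_sub_def by (intro exI[of _ "insert x S"]) auto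
  qed
  from this[of n] show ?thesis using finitely_generated_iff[OF M] N(2) by simp
qed

lemma (in noetherian_ring) maximal_among_ideals:
  assumes "\<S> \<noteq> {}" "\<And>I. I \<in> \<S> \<Longrightarrow> ideal I R"
  obtains I where "I \<in> \<S>" "\<And>J. J \<in> \<S> \<Longrightarrow> I \<subseteq> J \<Longrightarrow> J = I"
proof -
  have "\<exists>I\<in>\<S>. \<forall>J\<in>\<S>. I \<subseteq> J \<longrightarrow> J = I"
  proof (rule subset_Zorn_nonempty[OF assms(1)])
    fix \<C> assume ne: "\<C> \<noteq> {}" and ch: "subset.chain \<S> \<C>"
    then have "subset.chain {I. ideal I R} \<C>" using assms(2) by (auto simp: subset.chain_def)
    then show "\<Union>\<C> \<in> \<S>" using ideal_chain_is_trivial[OF ne] ch by (auto simp: subset.chain_def)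
  qed
  then show thesis using that by blast
qed

section \<open>Finite length modules over an order of dimension one\<close>

text \<open>A module-finite algebra over a local noetherian domain of Krull dimension one. The structure map
  \<open>\<eta>\<close> need not be injective.\<close>

locale dim_one_order = module_finite_algebra R \<Lambda> \<eta>
  for R :: "('r, 'c) ring_scheme" (structure) and \<Lambda> :: "('l, 'e) ring_scheme" (structure) and \<eta> +
  assumes domain_R: "domain R" and noetherian_R: "noetherian_ring R"
    and local_R: "local_ring R" and dim_R: "krull_dim R = 1"
begin

abbreviation nonzero :: "'r set" where "nonzero \<equiv> carrier R - {\<zero>\<^bsub>R\<^esub>}"

text \<open>\<open>M\<close> is a torsion module over \<open>R\<close>.\<close>

definition R_torsion :: "('l, 'a) module \<Rightarrow> bool" where
  "R_torsion M \<longleftrightarrow> (\<forall>x\<in>carrier M. \<exists>s\<in>nonzero. \<eta> s \<odot>\<^bsub>M\<^esub> x = \<zero>\<^bsub>M\<^esub>)"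

lemma nonzero_mult: "s \<in> nonzero \<Longrightarrow> t \<in> nonzero \<Longrightarrow> s \<otimes>\<^bsub>R\<^esub> t \<in> nonzero"
  using domain.integral_iff[OF domain_R] by auto

lemma one_nonzero: "\<one>\<^bsub>R\<^esub> \<in> nonzero"
  using domain.one_not_zero[OF domain_R] by auto

lemmas eta_closed = ring_hom_memE(1)[OF structure_hom]
  and eta_mult = ring_hom_memE(2)[OF structure_hom]
  and eta_add = ring_hom_memE(3)[OF structure_hom]
  and eta_one = ring_hom_memE(4)[OF structure_hom]

lemma left_module_res: "left_module \<Lambda> M \<Longrightarrow> left_module R (restrict_scalars \<eta> M)"
  by (rule left_module_restrict_scalars[OF R.ring_axioms _ structure_hom])

lemma submodule_res: "left_module \<Lambda> M \<Longrightarrow> submodule U \<Lambda> M \<Longrightarrow> submodule U R (restrict_scalars \<eta> M)"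
  by (rule submodule_restrict_scalars[OF R.ring_axioms _ structure_hom])

lemma eta_commute:
  assumes "left_module \<Lambda> M" "s \<in> carrier R" "a \<in> carrier \<Lambda>" "x \<in> carrier M"
  shows "\<eta> s \<odot>\<^bsub>M\<^esub> (a \<odot>\<^bsub>M\<^esub> x) = a \<odot>\<^bsub>M\<^esub> (\<eta> s \<odot>\<^bsub>M\<^esub> x)"
proof -
  interpret M: left_module \<Lambda> M by fact
  show ?thesis using assms central[of s a] eta_closed by (simp flip: M.smult_assoc)
qed

lemma eta_mult_smult:
  assumes "left_module \<Lambda> M" "s \<in> carrier R" "t \<in> carrier R" "x \<in> carrier M"
  shows "\<eta> (s \<otimes>\<^bsub>R\<^esub> t) \<odot>\<^bsub>M\<^esub> x = \<eta> s \<odot>\<^bsub>M\<^esub> (\<eta> t \<odot>\<^bsub>M\<^esub> x)"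
    "\<eta> (s \<otimes>\<^bsub>R\<^esub> t) \<odot>\<^bsub>M\<^esub> x = \<eta> t \<odot>\<^bsub>M\<^esub> (\<eta> s \<odot>\<^bsub>M\<^esub> x)"
proof -
  interpret M: left_module \<Lambda> M by fact
  show "\<eta> (s \<otimes>\<^bsub>R\<^esub> t) \<odot>\<^bsub>M\<^esub> x = \<eta> s \<odot>\<^bsub>M\<^esub> (\<eta> t \<odot>\<^bsub>M\<^esub> x)"
    using assms eta_closed by (simp add: eta_mult M.smult_assoc)
  then show "\<eta> (s \<otimes>\<^bsub>R\<^esub> t) \<odot>\<^bsub>M\<^esub> x = \<eta> t \<odot>\<^bsub>M\<^esub> (\<eta> s \<odot>\<^bsub>M\<^esub> x)"
    using assms eta_closed eta_commute[OF assms(1,2), of "\<eta> t" x] by simp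
qed

lemma scaling_hom:
  assumes "left_module \<Lambda> M" "s \<in> carrier R"
  shows "(\<lambda>x. \<eta> s \<odot>\<^bsub>M\<^esub> x) \<in> mod_hom \<Lambda> M M"
proof -
  interpret M: left_module \<Lambda> M by fact
  show ?thesis
    by (rule mod_homI) (use assms eta_closed eta_commute in \<open>simp_all add: M.smult_r_distr\<close>)
qed

text \<open>The products of generators of \<open>\<Lambda>\<close> over \<open>R\<close> and of \<open>M\<close> over \<open>\<Lambda>\<close> generate \<open>M\<close> over \<open>R\<close>.\<close>

lemma finitely_generated_res:
  assumes M: "left_module \<Lambda> M" and fg: "finitely_generated \<Lambda> M"
  shows "finitely_generated R (restrict_scalars \<eta> M)"
proof -
  interpret M: left_module \<Lambda> M by fact
  let ?M = "restrict_scalars \<eta> M" and ?L = "restrict_scalars \<eta> (regular_module \<Lambda>)"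
  interpret RM: left_module R ?M by (rule left_module_res[OF M])
  interpret L: left_module R ?L by (rule left_module_res[OF left_module_regular[OF \<Lambda>.ring_axioms]])
  obtain B where B: "finite B" "B \<subseteq> carrier \<Lambda>" "carrier \<Lambda> \<subseteq> mod_span R ?L B"
    using module_finite finitely_generated_iff[OF L.left_module_axioms] by (auto simp: fg_sub_def)
  obtain S where S: "finite S" "S \<subseteq> carrier M" "carrier M \<subseteq> mod_span \<Lambda> M S"
    using fg finitely_generated_iff[OF M] by (auto simp: fg_sub_def)
  define G where "G = (\<lambda>(b, x). b \<odot>\<^bsub>M\<^esub> x) ` (B \<times> S)"
  have G: "finite G" "G \<subseteq> carrier M" using B S by (auto simp: G_def)
  let ?H = "mod_span R ?M G"
  have H: "submodule ?H R ?M" using submodule_mod_span[OF RM.left_module_axioms] G by simp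
  note h = RM.submoduleD[OF H, simplified]
  have 1: "a \<odot>\<^bsub>M\<^esub> x \<in> ?H" if a: "a \<in> carrier \<Lambda>" and x: "x \<in> S" for a x
  proof -
    have xc: "x \<in> carrier M" using x S by auto
    have "submodule {a \<in> carrier \<Lambda>. a \<odot>\<^bsub>M\<^esub> x \<in> ?H} R ?L"
    proof (rule L.left_submoduleI)
      show "\<zero>\<^bsub>?L\<^esub> \<in> {a \<in> carrier \<Lambda>. a \<odot>\<^bsub>M\<^esub> x \<in> ?H}" using xc h(2) by simp
    next
      fix a b assume "a \<in> {a \<in> carrier \<Lambda>. a \<odot>\<^bsub>M\<^esub> x \<in> ?H}" "b \<in> {a \<in> carrier \<Lambda>. a \<odot>\<^bsub>M\<^esub> x \<in> ?H}"
      then show "a \<oplus>\<^bsub>?L\<^esub> b \<in> {a \<in> carrier \<Lambda>. a \<odot>\<^bsub>M\<^esub> x \<in> ?H}"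
        using xc h(3) by (simp add: M.smult_l_distr)
    next
      fix r a assume "r \<in> carrier R" "a \<in> {a \<in> carrier \<Lambda>. a \<odot>\<^bsub>M\<^esub> x \<in> ?H}"
      then show "r \<odot>\<^bsub>?L\<^esub> a \<in> {a \<in> carrier \<Lambda>. a \<odot>\<^bsub>M\<^esub> x \<in> ?H}"
        using xc h(5) eta_closed by (simp add: M.smult_assoc)
    qed auto
    moreover have "B \<subseteq> {a \<in> carrier \<Lambda>. a \<odot>\<^bsub>M\<^esub> x \<in> ?H}"
      using B(2) x mod_span_superset[of G R ?M] by (auto simp: G_def)
    ultimately have "mod_span R ?L B \<subseteq> {a \<in> carrier \<Lambda>. a \<odot>\<^bsub>M\<^esub> x \<in> ?H}" by (rule mod_span_least)
    then show ?thesis using B(3) a by auto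
  qed
  have "submodule {y \<in> carrier M. \<forall>a\<in>carrier \<Lambda>. a \<odot>\<^bsub>M\<^esub> y \<in> ?H} \<Lambda> M"
    by (rule M.left_submoduleI) (use h in \<open>auto simp: M.smult_r_distr simp flip: M.smult_assoc\<close>)
  moreover have "S \<subseteq> {y \<in> carrier M. \<forall>a\<in>carrier \<Lambda>. a \<odot>\<^bsub>M\<^esub> y \<in> ?H}" using 1 S by auto
  ultimately have "mod_span \<Lambda> M S \<subseteq> {y \<in> carrier M. \<forall>a\<in>carrier \<Lambda>. a \<odot>\<^bsub>M\<^esub> y \<in> ?H}"
    by (rule mod_span_least)
  then have "y \<in> ?H" if "y \<in> carrier M" for y
    using S(3) that M.smult_one[OF that] \<Lambda>.one_closed by fastforce
  then have "carrier ?M \<subseteq> ?H" by auto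
  then have "fg_sub R ?M (carrier ?M)" using G unfolding fg_sub_def by (intro exI[of _ G]) auto
  then show ?thesis using finitely_generated_iff[OF RM.left_module_axioms] by simp
qed

lemma noetherian_res:
  "left_module \<Lambda> M \<Longrightarrow> finitely_generated \<Lambda> M \<Longrightarrow> noetherian_mod R (restrict_scalars \<eta> M)"
  by (rule noetherian_mod_of_ring[OF R.is_cring noetherian_R left_module_res finitely_generated_res])

lemma noetherian_over_algebra:
  assumes M: "left_module \<Lambda> M" and fg: "finitely_generated \<Lambda> M"
  shows "noetherian_mod \<Lambda> M"
  unfolding noetherian_mod_def
proof (intro allI impI)
  interpret M: left_module \<Lambda> M by fact
  fix U assume U: "submodule U \<Lambda> M"
  then obtain S where S: "finite S" "S \<subseteq> U" "U \<subseteq> mod_span R (restrict_scalars \<eta> M) S"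
    using noetherian_res[OF M fg] submodule_res[OF M U] by (auto simp: noetherian_mod_def fg_sub_def)
  have "S \<subseteq> carrier M" using S M.submoduleD(1)[OF U] by auto
  then have "mod_span R (restrict_scalars \<eta> M) S \<subseteq> mod_span \<Lambda> M S"
    by (intro mod_span_least submodule_res[OF M] submodule_mod_span[OF M] mod_span_superset)
  then show "fg_sub \<Lambda> M U" using S unfolding fg_sub_def by (intro exI[of _ S]) auto
qed

subsection \<open>The maximal ideal of the base ring\<close>

text \<open>The unique maximal ideal of \<open>R\<close>.\<close>

definition max_ideal :: "'r set" where "max_ideal = (THE I. maximalideal I R)"

lemma maximalideal_max_ideal: "maximalideal max_ideal R"
  unfolding max_ideal_def by (rule theI') (use local_R in \<open>simp add: local_ring_def\<close>)

lemma max_ideal_subset: "max_ideal \<subseteq> carrier R"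
proof -
  interpret m: maximalideal max_ideal R by (rule maximalideal_max_ideal)
  show ?thesis using m.a_subset by simp
qed

lemma proper_ideal_le_max_ideal:
  assumes I: "ideal I R" and "\<one>\<^bsub>R\<^esub> \<notin> I"
  shows "I \<subseteq> max_ideal"
proof -
  interpret NR: noetherian_ring R by (rule noetherian_R)
  let ?\<S> = "{J. ideal J R \<and> \<one>\<^bsub>R\<^esub> \<notin> J \<and> I \<subseteq> J}"
  have "I \<in> ?\<S>" using assms by simp
  then obtain J where J: "J \<in> ?\<S>" "\<And>J'. J' \<in> ?\<S> \<Longrightarrow> J \<subseteq> J' \<Longrightarrow> J' = J"
    using NR.maximal_among_ideals[of ?\<S>] by blast
  have "maximalideal J R"
  proof (rule maximalidealI)
    show "ideal J R" using J(1) by simp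
    show "carrier R \<noteq> J" using J(1) by auto
  next
    fix J' assume J': "ideal J' R" "J \<subseteq> J'" "J' \<subseteq> carrier R"
    show "J' = J \<or> J' = carrier R"
    proof (cases "\<one>\<^bsub>R\<^esub> \<in> J'")
      case True
      then show ?thesis using ideal.one_imp_carrier[OF J'(1)] by simp
    next
      case False
      then have "J' \<in> ?\<S>" using J(1) J' by auto
      then show ?thesis using J(2) J'(2) by simp
    qed
  qed
  then have "J = max_ideal"
    using local_R maximalideal_max_ideal by (auto simp: local_ring_def)
  then show ?thesis using J(1) by auto
qed

lemma unit_outside_max_ideal:
  assumes "a \<in> carrier R" "a \<notin> max_ideal"
  obtains b where "b \<in> carrier R" "b \<otimes>\<^bsub>R\<^esub> a = \<one>\<^bsub>R\<^esub>"
proof -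
  have "\<one>\<^bsub>R\<^esub> \<in> PIdl\<^bsub>R\<^esub> a"
    using proper_ideal_le_max_ideal[OF R.cgenideal_ideal[OF assms(1)]]
      R.cgenideal_self[OF assms(1)] assms(2) by auto
  then show thesis using that by (auto simp: cgenideal_def)
qed

lemma one_minus_unit:
  assumes s: "s \<in> max_ideal" and a: "a \<in> carrier R"
  obtains b where "b \<in> carrier R" "b \<otimes>\<^bsub>R\<^esub> (\<one>\<^bsub>R\<^esub> \<ominus>\<^bsub>R\<^esub> s \<otimes>\<^bsub>R\<^esub> a) = \<one>\<^bsub>R\<^esub>"
proof -
  interpret m: maximalideal max_ideal R by (rule maximalideal_max_ideal)
  have sa: "s \<otimes>\<^bsub>R\<^esub> a \<in> max_ideal" using m.I_r_closed[OF s a] .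
  have c: "s \<in> carrier R" using s max_ideal_subset by auto
  have "\<one>\<^bsub>R\<^esub> \<notin> max_ideal" using m.one_imp_carrier m.I_notcarr by auto
  moreover have "(\<one>\<^bsub>R\<^esub> \<ominus>\<^bsub>R\<^esub> s \<otimes>\<^bsub>R\<^esub> a) \<oplus>\<^bsub>R\<^esub> s \<otimes>\<^bsub>R\<^esub> a = \<one>\<^bsub>R\<^esub>"
    using a c by (simp add: a_minus_def R.a_assoc R.l_neg)
  ultimately have "\<one>\<^bsub>R\<^esub> \<ominus>\<^bsub>R\<^esub> s \<otimes>\<^bsub>R\<^esub> a \<notin> max_ideal" using m.a_closed sa by metis
  then show thesis using unit_outside_max_ideal[of "\<one>\<^bsub>R\<^esub> \<ominus>\<^bsub>R\<^esub> s \<otimes>\<^bsub>R\<^esub> a"] a c that by auto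
qed

lemma primeideal_le_max_ideal:
  assumes "primeideal P R" shows "P \<subseteq> max_ideal"
proof -
  interpret P: primeideal P R by fact
  show ?thesis using proper_ideal_le_max_ideal[OF P.is_ideal] P.one_imp_carrier P.I_notcarr by auto
qed

lemma max_ideal_nonzero: obtains s where "s \<in> max_ideal" "s \<in> nonzero"
proof -
  let ?X = "{enat n | n. \<exists>P. (\<forall>i\<le>n. primeideal (P i) R) \<and> (\<forall>i<n. P i \<subset> P (Suc i))}"
  have "\<not> (\<forall>d\<in>?X. d \<le> 0)"
  proof
    assume "\<forall>d\<in>?X. d \<le> 0"
    then have "Sup ?X \<le> 0" by (intro Sup_least) auto
    then show False using dim_R by (simp add: krull_dim_def)
  qed
  then obtain n P where n: "n > 0" and P: "\<forall>i\<le>n. primeideal (P i) R" "\<forall>i<n. P i \<subset> P (Suc i)"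
    by (auto simp: zero_enat_def)
  have "P 0 \<subset> P 1" "primeideal (P 1) R" "primeideal (P 0) R" using P n by auto
  then obtain s where "s \<in> P 1" "s \<notin> P 0" "\<zero>\<^bsub>R\<^esub> \<in> P 0" "P 1 \<subseteq> max_ideal"
    using primeideal_le_max_ideal additive_subgroup.zero_closed[OF ideal.axioms(1)[OF primeideal.axioms(1)]]
    by blast
  moreover then have "s \<in> nonzero" using max_ideal_subset by auto
  ultimately show thesis using that by auto
qed

lemma nonzero_prime_eq_max_ideal:
  assumes P: "primeideal P R" and s: "s \<in> P" "s \<noteq> \<zero>\<^bsub>R\<^esub>"
  shows "P = max_ideal"
proof (rule ccontr)
  assume "P \<noteq> max_ideal"
  then have 1: "P \<subset> max_ideal" using primeideal_le_max_ideal[OF P] by auto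
  interpret P: primeideal P R by fact
  have 0: "{\<zero>\<^bsub>R\<^esub>} \<subset> P" using s P.zero_closed by auto
  let ?P = "\<lambda>i::nat. if i = 0 then {\<zero>\<^bsub>R\<^esub>} else if i = 1 then P else max_ideal"
  have "primeideal max_ideal R" by (rule R.maximalideal_prime[OF maximalideal_max_ideal])
  then have "\<forall>i\<le>2. primeideal (?P i) R" using P domain.zeroprimeideal[OF domain_R] by auto
  moreover have "\<forall>i<2. ?P i \<subset> ?P (Suc i)"
  proof (intro allI impI)
    fix i :: nat assume "i < 2"
    then have "i = 0 \<or> i = 1" by auto
    then show "?P i \<subset> ?P (Suc i)" using 0 1 by auto
  qed
  ultimately have "enat 2 \<le> krull_dim R"
    unfolding krull_dim_def by (intro Sup_upper CollectI exI[of _ 2] exI[of _ ?P] conjI refl)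
  then show False using dim_R by (simp add: one_enat_def)
qed

text \<open>Nakayama's lemma, for a multiple \<open>s V\<close> of a finitely generated module \<open>V\<close> modulo \<open>U\<close>.\<close>

lemma nakayama:
  assumes M: "left_module R M" and U: "submodule U R M" and V: "submodule V R M" "fg_sub R M V"
    and s: "s \<in> max_ideal"
    and div: "\<And>v. v \<in> V \<Longrightarrow> \<exists>u\<in>U. \<exists>w\<in>V. v = u \<oplus>\<^bsub>M\<^esub> s \<odot>\<^bsub>M\<^esub> w"
  shows "V \<subseteq> U"
proof -
  interpret M: left_module R M by fact
  note u = M.submoduleD[OF U] and v = M.submoduleD[OF V(1)]
  have sc: "s \<in> carrier R" using s max_ideal_subset by auto
  have "V \<subseteq> U" if "finite S" "S \<subseteq> V" "V \<subseteq> mod_span R M (S \<union> U)" for S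
    using that
  proof (induction S)
    case empty
    then show ?case using mod_span_least[OF U, of U] by auto
  next
    case (insert x S)
    let ?W = "mod_span R M (S \<union> U)"
    have SU: "S \<union> U \<subseteq> carrier M" "insert x (S \<union> U) \<subseteq> carrier M" using insert.prems v(1) u(1) by auto
    have W: "submodule ?W R M" by (rule submodule_mod_span[OF M SU(1)])
    note w = M.submoduleD[OF W]
    have x: "x \<in> V" "x \<in> carrier M" using insert.prems v(1) by auto
    obtain p y where py: "p \<in> U" "y \<in> V" "x = p \<oplus>\<^bsub>M\<^esub> s \<odot>\<^bsub>M\<^esub> y" using div[OF x(1)] by blast
    have "y \<in> mod_span R M (insert x (S \<union> U))" using py(2) insert.prems by auto
    then obtain a z where az: "a \<in> carrier R" "z \<in> ?W" "y = a \<odot>\<^bsub>M\<^esub> x \<oplus>\<^bsub>M\<^esub> z"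
      using mod_span_insert[OF M SU(2)] by blast
    have zc: "z \<in> carrier M" "p \<in> carrier M" using az w(1) py u(1) by auto
    obtain b where b: "b \<in> carrier R" "b \<otimes>\<^bsub>R\<^esub> (\<one>\<^bsub>R\<^esub> \<ominus>\<^bsub>R\<^esub> s \<otimes>\<^bsub>R\<^esub> a) = \<one>\<^bsub>R\<^esub>"
      using one_minus_unit[OF s az(1)] by blast
    \<comment> \<open>solve for \<open>x\<close>: the coefficient \<open>1 - s a\<close> is a unit\<close>
    have *: "x = (s \<otimes>\<^bsub>R\<^esub> a) \<odot>\<^bsub>M\<^esub> x \<oplus>\<^bsub>M\<^esub> (p \<oplus>\<^bsub>M\<^esub> s \<odot>\<^bsub>M\<^esub> z)"
      using py(3) az zc sc x(2) by (simp add: M.smult_r_distr M.smult_assoc M.M.a_ac)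
    have "(\<one>\<^bsub>R\<^esub> \<ominus>\<^bsub>R\<^esub> s \<otimes>\<^bsub>R\<^esub> a) \<odot>\<^bsub>M\<^esub> x = x \<ominus>\<^bsub>M\<^esub> (s \<otimes>\<^bsub>R\<^esub> a) \<odot>\<^bsub>M\<^esub> x"
      using az sc x(2) by (simp add: a_minus_def M.smult_l_distr M.minus_smult)
    also have "\<dots> = p \<oplus>\<^bsub>M\<^esub> s \<odot>\<^bsub>M\<^esub> z"
    proof -
      have "(s \<otimes>\<^bsub>R\<^esub> a) \<odot>\<^bsub>M\<^esub> x \<oplus>\<^bsub>M\<^esub> (p \<oplus>\<^bsub>M\<^esub> s \<odot>\<^bsub>M\<^esub> z) \<ominus>\<^bsub>M\<^esub> (s \<otimes>\<^bsub>R\<^esub> a) \<odot>\<^bsub>M\<^esub> x = p \<oplus>\<^bsub>M\<^esub> s \<odot>\<^bsub>M\<^esub> z"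
        using az sc x(2) zc
        by (simp add: a_minus_def M.M.a_ac M.M.r_neg M.M.r_neg1 M.M.r_neg2)
      then show ?thesis using * by simp
    qed
    finally have "(\<one>\<^bsub>R\<^esub> \<ominus>\<^bsub>R\<^esub> s \<otimes>\<^bsub>R\<^esub> a) \<odot>\<^bsub>M\<^esub> x = p \<oplus>\<^bsub>M\<^esub> s \<odot>\<^bsub>M\<^esub> z" .
    then have "(b \<otimes>\<^bsub>R\<^esub> (\<one>\<^bsub>R\<^esub> \<ominus>\<^bsub>R\<^esub> s \<otimes>\<^bsub>R\<^esub> a)) \<odot>\<^bsub>M\<^esub> x = b \<odot>\<^bsub>M\<^esub> (p \<oplus>\<^bsub>M\<^esub> s \<odot>\<^bsub>M\<^esub> z)"
      using b(1) az(1) sc x(2) by (simp add: M.smult_assoc)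
    then have "x = b \<odot>\<^bsub>M\<^esub> (p \<oplus>\<^bsub>M\<^esub> s \<odot>\<^bsub>M\<^esub> z)" using b(2) x(2) by simp
    moreover have "p \<in> ?W" using py(1) mod_span_superset[of "S \<union> U" R M] by auto
    ultimately have "x \<in> ?W" using w(3,5) az(2) b(1) sc by simp
    then have "mod_span R M (insert x S \<union> U) \<subseteq> ?W"
      using mod_span_superset[of "S \<union> U" R M] by (intro mod_span_least[OF W]) auto
    then show ?case using insert.IH insert.prems by auto
  qed
  moreover obtain S where "finite S" "S \<subseteq> V" "V \<subseteq> mod_span R M S" using V(2) by (auto simp: fg_sub_def)
  moreover then have "V \<subseteq> mod_span R M (S \<union> U)" using mod_span_mono[of S "S \<union> U" R M] by auto
  ultimately show ?thesis by blast
qed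

text \<open>By Nakayama's lemma, a nonzero element of the maximal ideal annihilates each composition
  factor.\<close>

lemma finite_length_imp_torsion:
  assumes M: "left_module \<Lambda> M" and fl: "finite_length \<Lambda> M"
  shows "R_torsion M"
proof -
  interpret M: left_module \<Lambda> M by fact
  let ?M = "restrict_scalars \<eta> M"
  interpret RM: left_module R ?M by (rule left_module_res[OF M])
  have noeth: "noetherian_mod R ?M"
    by (rule noetherian_res[OF M finite_length_imp_finitely_generated[OF M fl]])
  obtain s where s: "s \<in> max_ideal" "s \<in> nonzero" by (rule max_ideal_nonzero)
  obtain n N where N: "N 0 = {\<zero>\<^bsub>M\<^esub>}" "N n = carrier M" "\<And>i. i \<le> n \<Longrightarrow> submodule (N i) \<Lambda> M"
    "\<And>i. i < n \<Longrightarrow> N i \<subset> N (Suc i)"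
    "\<And>i L. i < n \<Longrightarrow> submodule L \<Lambda> M \<Longrightarrow> N i \<subset> L \<Longrightarrow> L \<subset> N (Suc i) \<Longrightarrow> False"
    using fl unfolding finite_length_def by metis
  have "\<forall>x\<in>N i. \<exists>t\<in>nonzero. \<eta> t \<odot>\<^bsub>M\<^esub> x = \<zero>\<^bsub>M\<^esub>" if "i \<le> n" for i
    using that
  proof (induction i)
    case 0
    have "\<eta> \<one>\<^bsub>R\<^esub> \<odot>\<^bsub>M\<^esub> \<zero>\<^bsub>M\<^esub> = \<zero>\<^bsub>M\<^esub>" using eta_closed[OF R.one_closed] by simp
    then show ?case using one_nonzero by (intro ballI bexI[of _ "\<one>\<^bsub>R\<^esub>"]) (simp_all add: N(1))
  next
    case (Suc i)
    then have i: "i < n" by simp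
    have Ni: "submodule (N i) \<Lambda> M" "submodule (N (Suc i)) \<Lambda> M" using N(3) i by auto
    let ?sV = "(\<lambda>x. \<eta> s \<odot>\<^bsub>M\<^esub> x) ` N (Suc i)"
    have sV: "submodule ?sV \<Lambda> M" using submodule_image[OF M M scaling_hom[OF M] Ni(2)] s by auto
    let ?L = "{x \<oplus>\<^bsub>M\<^esub> y | x y. x \<in> N i \<and> y \<in> ?sV}"
    note L = M.submodule_sum[OF Ni(1) sV]
    note n2 = M.submoduleD[OF Ni(2)]
    have "?L \<subseteq> N (Suc i)"
    proof
      fix z assume "z \<in> ?L"
      then obtain x y where "x \<in> N i" "y \<in> N (Suc i)" "z = x \<oplus>\<^bsub>M\<^esub> \<eta> s \<odot>\<^bsub>M\<^esub> y" by blast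
      moreover have "\<eta> s \<in> carrier \<Lambda>" using s(2) eta_closed by simp
      ultimately show "z \<in> N (Suc i)" using n2(3)[OF _ n2(5)] N(4)[OF i] by blast
    qed
    moreover have "?L \<noteq> N (Suc i)"
    proof
      assume eq: "?L = N (Suc i)"
      have "\<exists>u\<in>N i. \<exists>w\<in>N (Suc i). v = u \<oplus>\<^bsub>?M\<^esub> s \<odot>\<^bsub>?M\<^esub> w" if "v \<in> N (Suc i)" for v
      proof -
        have "v \<in> ?L" using that eq by simp
        then show ?thesis unfolding restrict_scalars_simps by blast
      qed
      then have "N (Suc i) \<subseteq> N i"
        using noeth submodule_res[OF M Ni(2)] unfolding noetherian_mod_def
        by (intro nakayama[OF RM.left_module_axioms submodule_res[OF M Ni(1)] submodule_res[OF M Ni(2)] _ s(1)])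
          blast+
      then show False using N(4)[OF i] by auto
    qed
    ultimately have "?L = N i" using N(5)[OF i L(1)] L(2) by blast
    then have sx: "\<eta> s \<odot>\<^bsub>M\<^esub> x \<in> N i" if "x \<in> N (Suc i)" for x using L(3) that by blast
    show ?case
    proof
      fix x assume x: "x \<in> N (Suc i)"
      have "\<forall>x\<in>N i. \<exists>t\<in>nonzero. \<eta> t \<odot>\<^bsub>M\<^esub> x = \<zero>\<^bsub>M\<^esub>" using Suc.IH i by simp
      then obtain t where t: "t \<in> nonzero" "\<eta> t \<odot>\<^bsub>M\<^esub> (\<eta> s \<odot>\<^bsub>M\<^esub> x) = \<zero>\<^bsub>M\<^esub>"
        using sx[OF x] by blast
      moreover have "x \<in> carrier M" using x n2(1) by auto
      ultimately show "\<exists>t\<in>nonzero. \<eta> t \<odot>\<^bsub>M\<^esub> x = \<zero>\<^bsub>M\<^esub>"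
        using nonzero_mult[OF t(1) s(2)] s(2) eta_mult_smult(1)[OF M, of t s x]
        by (intro bexI[of _ "t \<otimes>\<^bsub>R\<^esub> s"]) auto
    qed
  qed
  then show ?thesis using N(2) by (auto simp: R_torsion_def)
qed

text \<open>An annihilator, modulo \<open>U\<close>, of an element outside \<open>U\<close> is prime if it is maximal among such
  annihilators. It is nonzero because \<open>M\<close> is torsion, so it is the maximal ideal.\<close>

lemma associated_max_ideal:
  assumes M: "left_module \<Lambda> M" and U: "submodule U \<Lambda> M" "U \<noteq> carrier M" and tors: "R_torsion M"
  obtains x where "x \<in> carrier M" "x \<notin> U" "\<And>a. a \<in> max_ideal \<Longrightarrow> \<eta> a \<odot>\<^bsub>M\<^esub> x \<in> U"
proof -
  interpret M: left_module \<Lambda> M by fact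
  interpret NR: noetherian_ring R by (rule noetherian_R)
  note u = M.submoduleD[OF U(1)]
  define ann where "ann x = {a \<in> carrier R. \<eta> a \<odot>\<^bsub>M\<^esub> x \<in> U}" for x
  have eta0: "\<eta> \<zero>\<^bsub>R\<^esub> = \<zero>\<^bsub>\<Lambda>\<^esub>"
    using ring_hom_zero[OF structure_hom R.ring_axioms \<Lambda>.ring_axioms] .
  have ann: "ideal (ann x) R" if x: "x \<in> carrier M" for x
  proof (rule cring_idealI[OF R.is_cring])
    show "\<zero>\<^bsub>R\<^esub> \<in> ann x" using x u(2) eta0 by (simp add: ann_def)
    show "a \<oplus>\<^bsub>R\<^esub> b \<in> ann x" if "a \<in> ann x" "b \<in> ann x" for a b
      using that x u(3) eta_closed by (simp add: ann_def eta_add M.smult_l_distr)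
    show "r \<otimes>\<^bsub>R\<^esub> a \<in> ann x" if "r \<in> carrier R" "a \<in> ann x" for r a
      using that x u(5) eta_closed by (simp add: ann_def eta_mult_smult(1)[OF M])
  qed (auto simp: ann_def)
  obtain x0 where x0: "x0 \<in> carrier M" "x0 \<notin> U" using U(2) u(1) by auto
  then have "ann ` (carrier M - U) \<noteq> {}" by auto
  then obtain I where I: "I \<in> ann ` (carrier M - U)" "\<And>J. J \<in> ann ` (carrier M - U) \<Longrightarrow> I \<subseteq> J \<Longrightarrow> J = I"
    using NR.maximal_among_ideals[of "ann ` (carrier M - U)"] ann by blast
  then obtain x where x: "x \<in> carrier M" "x \<notin> U" "I = ann x" by auto
  have "primeideal (ann x) R"
  proof (rule primeidealI[OF ann[OF x(1)] R.is_cring])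
    have "\<one>\<^bsub>R\<^esub> \<notin> ann x" using x(1,2) eta_one by (simp add: ann_def)
    then show "carrier R \<noteq> ann x" by auto
  next
    fix a b assume ab: "a \<in> carrier R" "b \<in> carrier R" "a \<otimes>\<^bsub>R\<^esub> b \<in> ann x"
    show "a \<in> ann x \<or> b \<in> ann x"
    proof (cases "a \<in> ann x")
      case False
      let ?y = "\<eta> a \<odot>\<^bsub>M\<^esub> x"
      have y: "?y \<in> carrier M" "?y \<notin> U" using False ab x eta_closed by (auto simp: ann_def)
      have "ann x \<subseteq> ann ?y"
      proof
        fix c assume "c \<in> ann x"
        then have c: "c \<in> carrier R" "\<eta> c \<odot>\<^bsub>M\<^esub> x \<in> U" by (simp_all add: ann_def)
        have "\<eta> c \<odot>\<^bsub>M\<^esub> ?y = \<eta> a \<odot>\<^bsub>M\<^esub> (\<eta> c \<odot>\<^bsub>M\<^esub> x)"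
          by (rule eta_commute[OF M c(1) eta_closed[OF ab(1)] x(1)])
        then show "c \<in> ann ?y" using u(5)[OF eta_closed[OF ab(1)] c(2)] c(1) by (simp add: ann_def)
      qed
      then have "ann ?y = ann x" using I(2)[of "ann ?y"] y x(3) by auto
      moreover have "b \<in> ann ?y" using ab x(1) eta_mult_smult(2)[OF M ab(1,2) x(1)] by (simp add: ann_def)
      ultimately show ?thesis by simp
    qed simp
  qed
  moreover obtain s where "s \<in> nonzero" "\<eta> s \<odot>\<^bsub>M\<^esub> x = \<zero>\<^bsub>M\<^esub>" using tors x(1) by (auto simp: R_torsion_def)
  moreover then have "s \<in> ann x" using u(2) by (simp add: ann_def)
  ultimately have "ann x = max_ideal" using nonzero_prime_eq_max_ideal by auto
  then have "\<eta> a \<odot>\<^bsub>M\<^esub> x \<in> U" if "a \<in> max_ideal" for a using that by (auto simp: ann_def)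
  then show thesis using that x by blast
qed

text \<open>There is a submodule \<open>V\<close> minimal over \<open>U\<close>. Let \<open>W\<close> consist of the elements that the maximal
  ideal maps to \<open>U\<close>; it is larger than \<open>U\<close>, and modulo \<open>U\<close> it is a finite dimensional vector space
  over the residue field. Instead of a \<open>V\<close> of least dimension, take an \<open>R\<close>-submodule \<open>H\<close> that is
  maximal subject to \<open>V \<inter> H = U\<close> for some \<open>\<Lambda>\<close>-submodule \<open>V\<close> of \<open>W\<close> larger than \<open>U\<close>. If \<open>L\<close> were a
  \<open>\<Lambda>\<close>-submodule strictly between \<open>U\<close> and \<open>V\<close>, then \<open>H\<close> could be enlarged by an element of \<open>V\<close>
  outside \<open>L\<close>, with \<open>L\<close> in place of \<open>V\<close>.\<close>

lemma minimal_submodule_over: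
  assumes M: "left_module \<Lambda> M" and fg: "finitely_generated \<Lambda> M" and tors: "R_torsion M"
    and U: "submodule U \<Lambda> M" "U \<noteq> carrier M"
  obtains V where "submodule V \<Lambda> M" "U \<subset> V" "\<And>L. submodule L \<Lambda> M \<Longrightarrow> U \<subset> L \<Longrightarrow> L \<subset> V \<Longrightarrow> False"
proof -
  interpret M: left_module \<Lambda> M by fact
  let ?M = "restrict_scalars \<eta> M"
  interpret RM: left_module R ?M by (rule left_module_res[OF M])
  note u = M.submoduleD[OF U(1)]
  define W where "W = {y \<in> carrier M. \<forall>a\<in>max_ideal. \<eta> a \<odot>\<^bsub>M\<^esub> y \<in> U}"
  have ec: "\<eta> a \<in> carrier \<Lambda>" if "a \<in> max_ideal" for a using that max_ideal_subset eta_closed by auto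
  have W: "submodule W \<Lambda> M"
  proof (rule M.left_submoduleI)
    show "b \<odot>\<^bsub>M\<^esub> y \<in> W" if "b \<in> carrier \<Lambda>" "y \<in> W" for b y
    proof -
      have "\<eta> a \<odot>\<^bsub>M\<^esub> (b \<odot>\<^bsub>M\<^esub> y) \<in> U" if "a \<in> max_ideal" for a
      proof -
        have "\<eta> a \<odot>\<^bsub>M\<^esub> (b \<odot>\<^bsub>M\<^esub> y) = b \<odot>\<^bsub>M\<^esub> (\<eta> a \<odot>\<^bsub>M\<^esub> y)"
          using \<open>b \<in> carrier \<Lambda>\<close> \<open>y \<in> W\<close> that max_ideal_subset by (intro eta_commute[OF M]) (auto simp: W_def)
        then show ?thesis using u(5)[OF \<open>b \<in> carrier \<Lambda>\<close>] \<open>y \<in> W\<close> that by (simp add: W_def)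
      qed
      then show ?thesis using that by (simp add: W_def)
    qed
  qed (use u ec in \<open>auto simp: W_def M.smult_r_distr\<close>)
  obtain x where x: "x \<in> carrier M" "x \<notin> U" "\<And>a. a \<in> max_ideal \<Longrightarrow> \<eta> a \<odot>\<^bsub>M\<^esub> x \<in> U"
    using associated_max_ideal[OF M U tors] by blast
  have "U \<subseteq> W" using u ec by (auto simp: W_def)
  moreover have "x \<in> W" using x by (simp add: W_def)
  ultimately have UW: "U \<subset> W" using x(2) by auto
  let ?\<H> = "{H. submodule H R ?M \<and> (\<exists>V. submodule V \<Lambda> M \<and> U \<subset> V \<and> V \<subseteq> W \<and> V \<inter> H = U)}"
  have "U \<in> ?\<H>" using submodule_res[OF M U(1)] W UW by blast
  then obtain H where H: "H \<in> ?\<H>" "\<And>H'. H' \<in> ?\<H> \<Longrightarrow> H \<subseteq> H' \<Longrightarrow> H' = H"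
    using noetherian_mod_maximal[OF RM.left_module_axioms noetherian_res[OF M fg], of ?\<H>] by blast
  then obtain V where V: "submodule V \<Lambda> M" "U \<subset> V" "V \<subseteq> W" "V \<inter> H = U" by blast
  have Hs: "submodule H R ?M" using H(1) by simp
  note h = RM.submoduleD[OF Hs, simplified] and v = M.submoduleD[OF V(1)]
  have False if L: "submodule L \<Lambda> M" "U \<subset> L" "L \<subset> V" for L
  proof -
    note l = M.submoduleD[OF L(1)] M.submodule_diff[OF L(1)]
    obtain y where y: "y \<in> V" "y \<notin> L" using L(3) by auto
    have yc: "y \<in> carrier M" using y v by auto
    note C = RM.submodule_cyclic[of y, simplified, OF yc]
    let ?H = "{p \<oplus>\<^bsub>M\<^esub> q | p q. p \<in> H \<and> q \<in> {\<eta> a \<odot>\<^bsub>M\<^esub> y | a. a \<in> carrier R}}"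
    have H': "submodule ?H R ?M" "H \<subseteq> ?H" "{\<eta> a \<odot>\<^bsub>M\<^esub> y | a. a \<in> carrier R} \<subseteq> ?H"
      using RM.submodule_sum[OF Hs C(1)] by simp_all
    have "z \<in> U" if z: "z \<in> L" "z \<in> ?H" for z
    proof -
      obtain p a where pa: "p \<in> H" "a \<in> carrier R" "z = p \<oplus>\<^bsub>M\<^esub> \<eta> a \<odot>\<^bsub>M\<^esub> y" using z(2) by blast
      have ac: "\<eta> a \<odot>\<^bsub>M\<^esub> y \<in> carrier M" "p \<in> carrier M" using eta_closed[OF pa(2)] yc pa(1) h(1) by auto
      have "a \<in> max_ideal"
      proof (rule ccontr)
        assume "a \<notin> max_ideal"
        then obtain b where b: "b \<in> carrier R" "b \<otimes>\<^bsub>R\<^esub> a = \<one>\<^bsub>R\<^esub>" using unit_outside_max_ideal[OF pa(2)] by blast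
        have "p = z \<ominus>\<^bsub>M\<^esub> \<eta> a \<odot>\<^bsub>M\<^esub> y"
          unfolding pa(3) using ac by (simp add: a_minus_def M.M.a_assoc M.M.r_neg)
        moreover have "z \<ominus>\<^bsub>M\<^esub> \<eta> a \<odot>\<^bsub>M\<^esub> y \<in> V"
          using M.submodule_diff[OF V(1)] z(1) L(3) v(5)[OF eta_closed[OF pa(2)] y(1)] by blast
        ultimately have "p \<in> L" using V(4) pa(1) L(2) by blast
        have "\<eta> a \<odot>\<^bsub>M\<^esub> y = z \<ominus>\<^bsub>M\<^esub> p"
          unfolding pa(3) using ac by (simp add: a_minus_def M.M.a_ac M.M.r_neg M.M.r_neg1 M.M.r_neg2)
        then have "\<eta> a \<odot>\<^bsub>M\<^esub> y \<in> L" using l(6)[OF z(1) \<open>p \<in> L\<close>] by simp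
        then have "\<eta> (b \<otimes>\<^bsub>R\<^esub> a) \<odot>\<^bsub>M\<^esub> y \<in> L"
          using l(5)[OF eta_closed[OF b(1)]] eta_mult_smult(1)[OF M b(1) pa(2) yc] by simp
        then show False using b(2) eta_one y(2) yc by simp
      qed
      then have ay: "\<eta> a \<odot>\<^bsub>M\<^esub> y \<in> U" using y(1) V(3) by (auto simp: W_def)
      then have "\<eta> a \<odot>\<^bsub>M\<^esub> y \<in> H" using V(4) by blast
      then have "z \<in> H" unfolding pa(3) using h(3) pa(1) by blast
      then show ?thesis using z(1) L(3) V(4) by blast
    qed
    moreover have "U \<subseteq> ?H" using V(4) H'(2) by blast
    ultimately have "L \<inter> ?H = U" using L(2) by blast
    then have "?H \<in> ?\<H>" using H'(1) L V(3) by blast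
    then have "?H = H" using H(2) H'(2) by blast
    then have "y \<in> H" using C(2) H'(3) by blast
    then have "y \<in> U" using V(4) y(1) by blast
    then show False using y(2) L(2) by blast
  qed
  then show thesis using that V by blast
qed

text \<open>Among the submodules that have a composition series, a maximal one is the whole module: otherwise
  the series could be continued by a submodule minimal over it.\<close>

lemma torsion_imp_finite_length:
  assumes M: "left_module \<Lambda> M" and fg: "finitely_generated \<Lambda> M" and tors: "R_torsion M"
  shows "finite_length \<Lambda> M"
proof -
  interpret M: left_module \<Lambda> M by fact
  define series where "series n N U \<longleftrightarrow> N 0 = {\<zero>\<^bsub>M\<^esub>} \<and> N n = U \<and>
        (\<forall>i\<le>n. submodule (N i) \<Lambda> M) \<and> (\<forall>i<n. N i \<subset> N (Suc i) \<and>
           \<not> (\<exists>L. submodule L \<Lambda> M \<and> N i \<subset> L \<and> L \<subset> N (Suc i)))" for n :: nat and N U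
  let ?\<S> = "{U. \<exists>n N. series n N U}"
  have "series 0 (\<lambda>_. {\<zero>\<^bsub>M\<^esub>}) {\<zero>\<^bsub>M\<^esub>}" using M.submodule_zero by (simp add: series_def)
  then have "?\<S> \<noteq> {}" by blast
  moreover have sub: "submodule U \<Lambda> M" if "series n N U" for n N U
    using that unfolding series_def by (metis order_refl)
  then have "submodule U \<Lambda> M" if "U \<in> ?\<S>" for U using that by blast
  ultimately obtain U where U: "U \<in> ?\<S>" "\<And>V. V \<in> ?\<S> \<Longrightarrow> U \<subseteq> V \<Longrightarrow> V = U"
    using noetherian_mod_maximal[OF M noetherian_over_algebra[OF M fg], of ?\<S>] by blast
  obtain n N where N: "series n N U" using U(1) by blast
  have Us: "submodule U \<Lambda> M" by (rule sub[OF N])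
  have "U = carrier M"
  proof (rule ccontr)
    assume "U \<noteq> carrier M"
    then obtain V where V: "submodule V \<Lambda> M" "U \<subset> V"
      "\<And>L. submodule L \<Lambda> M \<Longrightarrow> U \<subset> L \<Longrightarrow> L \<subset> V \<Longrightarrow> False"
      using minimal_submodule_over[OF M fg tors Us] by blast
    have "series (Suc n) (N(Suc n := V)) V"
      using N V(1,2) V(3) unfolding series_def by (auto simp: less_Suc_eq le_Suc_eq)
    then have "V = U" using U(2) V(2) by blast
    then show False using V(2) by blast
  qed
  then show ?thesis using N unfolding finite_length_def series_def by blast
qed

lemma fl_cat_eq: "fl_cat \<Lambda> = {M \<in> mod_cat \<Lambda>. R_torsion M}"
  using finite_length_imp_torsion finite_length_imp_finitely_generated torsion_imp_finite_length
  by (auto simp: fl_cat_def mod_cat_def)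

end

section \<open>Localization at the nonzero elements of the base ring\<close>

text \<open>\<open>A\<close> is the localization of \<open>\<Lambda>\<close> at the nonzero elements of \<open>R\<close>, as far as it is needed; nothing
  is said about the kernel of \<open>\<epsilon> : \<Lambda> \<rightarrow> A\<close>, so \<open>A\<close> may even be the zero ring.\<close>

locale order_localization = dim_one_order R \<Lambda> \<eta> + A: ring A
  for R :: "('r, 'c) ring_scheme" (structure) and \<Lambda> :: "('l, 'e) ring_scheme" (structure) and \<eta>
    and A :: "('b, 'd) ring_scheme" and \<epsilon> :: "'l \<Rightarrow> 'b" +
  assumes eps_hom: "\<epsilon> \<in> ring_hom \<Lambda> A"
    and eps_unit: "s \<in> nonzero \<Longrightarrow> \<exists>t\<in>carrier A. t \<otimes>\<^bsub>A\<^esub> \<epsilon> (\<eta> s) = \<one>\<^bsub>A\<^esub>"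
    and eps_dense: "a \<in> carrier A \<Longrightarrow> \<exists>s\<in>nonzero. \<exists>b\<in>carrier \<Lambda>. \<epsilon> (\<eta> s) \<otimes>\<^bsub>A\<^esub> a = \<epsilon> b"
    and eps_central: "s \<in> carrier R \<Longrightarrow> a \<in> carrier A \<Longrightarrow> \<epsilon> (\<eta> s) \<otimes>\<^bsub>A\<^esub> a = a \<otimes>\<^bsub>A\<^esub> \<epsilon> (\<eta> s)"
begin

abbreviation res :: "('b, 'n) module \<Rightarrow> ('l, 'n) module" where "res \<equiv> restrict_scalars \<epsilon>"

abbreviation scale :: "('b, 'n) module \<Rightarrow> 'r \<Rightarrow> 'n \<Rightarrow> 'n" where "scale N s x \<equiv> \<epsilon> (\<eta> s) \<odot>\<^bsub>N\<^esub> x"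

lemmas eps_closed = ring_hom_memE(1)[OF eps_hom]

lemma left_module_eps: "left_module A N \<Longrightarrow> left_module \<Lambda> (res N)"
  by (rule left_module_restrict_scalars[OF \<Lambda>.ring_axioms _ eps_hom])

lemma submodule_eps: "left_module A N \<Longrightarrow> submodule U A N \<Longrightarrow> submodule U \<Lambda> (res N)"
  by (rule submodule_restrict_scalars[OF \<Lambda>.ring_axioms _ eps_hom])

lemma mod_hom_eps: "f \<in> mod_hom A N Y \<Longrightarrow> f \<in> mod_hom \<Lambda> (res N) (res Y)"
  by (rule mod_hom_restrict_scalars[OF _ eps_hom])

lemma scale_mult:
  assumes "left_module A N" "s \<in> carrier R" "t \<in> carrier R" "x \<in> carrier N"
  shows "scale N (s \<otimes>\<^bsub>R\<^esub> t) x = scale N s (scale N t x)" "scale N (s \<otimes>\<^bsub>R\<^esub> t) x = scale N t (scale N s x)"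
  using eta_mult_smult[OF left_module_eps[OF assms(1)] assms(2,3), of x] assms(4) by simp_all

lemma scale_smult:
  assumes "left_module A N" "s \<in> carrier R" "a \<in> carrier A" "x \<in> carrier N"
  shows "scale N s (a \<odot>\<^bsub>N\<^esub> x) = a \<odot>\<^bsub>N\<^esub> scale N s x"
proof -
  interpret N: left_module A N by fact
  show ?thesis using assms eps_central[of s a] eps_closed eta_closed by (simp flip: N.smult_assoc)
qed

lemma scale_hom:
  assumes "left_module A N" "left_module A Y" "f \<in> mod_hom A N Y" "s \<in> carrier R" "x \<in> carrier N"
  shows "f (scale N s x) = scale Y s (f x)"
  using mod_homD(3)[OF assms(3)] assms eps_closed eta_closed by simp

lemma scale_cancel:
  assumes N: "left_module A N" and s: "s \<in> nonzero" and "x \<in> carrier N" "y \<in> carrier N"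
    and "scale N s x = scale N s y"
  shows "x = y"
proof -
  interpret N: left_module A N by fact
  obtain t where t: "t \<in> carrier A" "t \<otimes>\<^bsub>A\<^esub> \<epsilon> (\<eta> s) = \<one>\<^bsub>A\<^esub>" using eps_unit[OF s] by blast
  have c: "\<epsilon> (\<eta> s) \<in> carrier A" using eps_closed eta_closed s by simp
  have "z = t \<odot>\<^bsub>N\<^esub> scale N s z" if "z \<in> carrier N" for z
    using t c that N.smult_assoc[of t "\<epsilon> (\<eta> s)" z] by simp
  then show ?thesis using assms(3-5) by metis
qed

lemma scale_zero: "left_module A N \<Longrightarrow> s \<in> carrier R \<Longrightarrow> scale N s \<zero>\<^bsub>N\<^esub> = \<zero>\<^bsub>N\<^esub>"
  using left_module.smult_zero[of A N] eps_closed eta_closed by simp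

lemma scale_eq_zero:
  assumes N: "left_module A N" and s: "s \<in> nonzero" "x \<in> carrier N" "scale N s x = \<zero>\<^bsub>N\<^esub>"
  shows "x = \<zero>\<^bsub>N\<^esub>"
proof -
  interpret N: left_module A N by fact
  show ?thesis using scale_cancel[OF N s(1,2), of "\<zero>\<^bsub>N\<^esub>"] s scale_zero[OF N, of s] by simp
qed

lemma scale_divide:
  assumes N: "left_module A N" and s: "s \<in> nonzero" and x: "x \<in> carrier N"
  obtains y where "y \<in> carrier N" "scale N s y = x"
proof -
  interpret N: left_module A N by fact
  obtain t where t: "t \<in> carrier A" "t \<otimes>\<^bsub>A\<^esub> \<epsilon> (\<eta> s) = \<one>\<^bsub>A\<^esub>" using eps_unit[OF s] by blast
  have c: "\<epsilon> (\<eta> s) \<in> carrier A" using eps_closed eta_closed s by simp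
  have "scale N s (t \<odot>\<^bsub>N\<^esub> x) = x"
    using scale_smult[OF N _ t(1) x, of s] s t c x N.smult_assoc[of t "\<epsilon> (\<eta> s)" x] by simp
  then show thesis using that[of "t \<odot>\<^bsub>N\<^esub> x"] t(1) x by simp
qed

text \<open>Between \<open>A\<close>-modules, \<open>\<Lambda>\<close>-linear maps are \<open>A\<close>-linear.\<close>

lemma mod_hom_of_res:
  assumes N: "left_module A N" and Y: "left_module A Y" and f: "f \<in> mod_hom \<Lambda> (res N) (res Y)"
  shows "f \<in> mod_hom A N Y"
proof -
  interpret N: left_module A N by fact
  interpret Y: left_module A Y by fact
  note f' = mod_homD[OF f, simplified]
  show ?thesis
  proof (rule mod_homI)
    fix a x assume a: "a \<in> carrier A" and x: "x \<in> carrier N"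
    obtain s b where s: "s \<in> nonzero" "b \<in> carrier \<Lambda>" "\<epsilon> (\<eta> s) \<otimes>\<^bsub>A\<^esub> a = \<epsilon> b" using eps_dense[OF a] by blast
    have c: "\<eta> s \<in> carrier \<Lambda>" "\<epsilon> (\<eta> s) \<in> carrier A" using s eps_closed eta_closed by auto
    have "scale Y s (f (a \<odot>\<^bsub>N\<^esub> x)) = f (scale N s (a \<odot>\<^bsub>N\<^esub> x))" using f'(3) c a x by simp
    also have "scale N s (a \<odot>\<^bsub>N\<^esub> x) = \<epsilon> b \<odot>\<^bsub>N\<^esub> x" using N.smult_assoc[OF c(2) a x] s(3) by simp
    also have "f (\<epsilon> b \<odot>\<^bsub>N\<^esub> x) = \<epsilon> b \<odot>\<^bsub>Y\<^esub> f x" using f'(3)[OF s(2) x] .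
    also have "\<dots> = scale Y s (a \<odot>\<^bsub>Y\<^esub> f x)" using Y.smult_assoc[OF c(2) a f'(1)[OF x]] s(3) by simp
    finally show "f (a \<odot>\<^bsub>N\<^esub> x) = a \<odot>\<^bsub>Y\<^esub> f x"
      using scale_cancel[OF Y s(1)] f'(1) a x by simp
  qed (use f' in auto)
qed

lemma submodule_of_res:
  assumes N: "left_module A N" and U: "submodule U \<Lambda> (res N)"
    and div: "\<And>s x. s \<in> nonzero \<Longrightarrow> x \<in> carrier N \<Longrightarrow> scale N s x \<in> U \<Longrightarrow> x \<in> U"
  shows "submodule U A N"
proof -
  interpret N: left_module A N by fact
  note u = left_module.submoduleD[OF left_module_eps[OF N] U, simplified]
  show ?thesis
  proof (rule N.left_submoduleI)
    fix a x assume a: "a \<in> carrier A" and x: "x \<in> U"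
    have xc: "x \<in> carrier N" using x u(1) by auto
    obtain s b where s: "s \<in> nonzero" "b \<in> carrier \<Lambda>" "\<epsilon> (\<eta> s) \<otimes>\<^bsub>A\<^esub> a = \<epsilon> b" using eps_dense[OF a] by blast
    have c: "\<epsilon> (\<eta> s) \<in> carrier A" using s eps_closed eta_closed by auto
    have "scale N s (a \<odot>\<^bsub>N\<^esub> x) = \<epsilon> b \<odot>\<^bsub>N\<^esub> x" using N.smult_assoc[OF c a xc] s(3) by simp
    then show "a \<odot>\<^bsub>N\<^esub> x \<in> U" using div[OF s(1)] u(5)[OF s(2) x] a xc by simp
  qed (use u in auto)
qed

text \<open>The \<open>A\<close>-module \<open>N\<close>, together with \<open>j\<close>, is the localization of the \<open>\<Lambda>\<close>-module \<open>M\<close>. That nonzero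
  elements of \<open>R\<close> act bijectively on \<open>N\<close> holds for every \<open>A\<close>-module.\<close>

definition is_loc :: "('l, 'm) module \<Rightarrow> ('m \<Rightarrow> 'n) \<Rightarrow> ('b, 'n) module \<Rightarrow> bool" where
  "is_loc M j N \<longleftrightarrow> j \<in> mod_hom \<Lambda> M (res N) \<and>
     (\<forall>n\<in>carrier N. \<exists>s\<in>nonzero. \<exists>m\<in>carrier M. scale N s n = j m) \<and>
     (\<forall>m\<in>carrier M. j m = \<zero>\<^bsub>N\<^esub> \<longrightarrow> (\<exists>s\<in>nonzero. \<eta> s \<odot>\<^bsub>M\<^esub> m = \<zero>\<^bsub>M\<^esub>))"

lemma is_locD:
  assumes "is_loc M j N"
  shows "j \<in> mod_hom \<Lambda> M (res N)"
    "\<And>n. n \<in> carrier N \<Longrightarrow> \<exists>s\<in>nonzero. \<exists>m\<in>carrier M. scale N s n = j m"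
    "\<And>m. m \<in> carrier M \<Longrightarrow> j m = \<zero>\<^bsub>N\<^esub> \<Longrightarrow> \<exists>s\<in>nonzero. \<eta> s \<odot>\<^bsub>M\<^esub> m = \<zero>\<^bsub>M\<^esub>"
  using assms by (simp_all add: is_loc_def)

lemma is_loc_hom:
  assumes "is_loc M j N"
  shows "\<And>x. x \<in> carrier M \<Longrightarrow> j x \<in> carrier N"
    "\<And>x y. x \<in> carrier M \<Longrightarrow> y \<in> carrier M \<Longrightarrow> j (x \<oplus>\<^bsub>M\<^esub> y) = j x \<oplus>\<^bsub>N\<^esub> j y"
    "\<And>a x. a \<in> carrier \<Lambda> \<Longrightarrow> x \<in> carrier M \<Longrightarrow> j (a \<odot>\<^bsub>M\<^esub> x) = \<epsilon> a \<odot>\<^bsub>N\<^esub> j x"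
    "\<And>s x. s \<in> carrier R \<Longrightarrow> x \<in> carrier M \<Longrightarrow> j (\<eta> s \<odot>\<^bsub>M\<^esub> x) = scale N s (j x)"
  using mod_homD[OF is_locD(1)[OF assms]] eta_closed by simp_all

text \<open>The universal property.\<close>

lemma is_loc_extend:
  assumes M: "left_module \<Lambda> M" and N: "left_module A N" and Y: "left_module A Y"
    and loc: "is_loc M j N" and f: "f \<in> mod_hom \<Lambda> M (res Y)"
  obtains F where "F \<in> mod_hom A N Y" "\<And>m. m \<in> carrier M \<Longrightarrow> F (j m) = f m"
proof -
  interpret M: left_module \<Lambda> M by fact
  interpret N: left_module A N by fact
  interpret Y: left_module A Y by fact
  note j = is_loc_hom[OF loc] and f' = mod_homD[OF f, simplified]
  have fs: "f (\<eta> s \<odot>\<^bsub>M\<^esub> m) = scale Y s (f m)" if "s \<in> carrier R" "m \<in> carrier M" for s m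
    using f'(3)[of "\<eta> s" m] eta_closed that by simp
  \<comment> \<open>\<open>y\<close> is the value at \<open>n\<close> of the extension of \<open>f\<close>\<close>
  define P where "P n y \<longleftrightarrow> y \<in> carrier Y \<and> (\<exists>s\<in>nonzero. \<exists>m\<in>carrier M. scale N s n = j m \<and> scale Y s y = f m)" for n y
  have P_ex: "\<exists>y. P n y" if n: "n \<in> carrier N" for n
  proof -
    obtain s m where s: "s \<in> nonzero" "m \<in> carrier M" "scale N s n = j m" using is_locD(2)[OF loc n] by blast
    obtain y where "y \<in> carrier Y" "scale Y s y = f m" using scale_divide[OF Y s(1) f'(1)[OF s(2)]] by blast
    then show ?thesis using s unfolding P_def by blast
  qed
  have P_uniq: "y = y'" if n: "n \<in> carrier N" and y: "P n y" "P n y'" for n y y'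
  proof -
    obtain s m where 1: "y \<in> carrier Y" "s \<in> nonzero" "m \<in> carrier M" "scale N s n = j m" "scale Y s y = f m"
      using y(1) unfolding P_def by blast
    obtain s' m' where 2: "y' \<in> carrier Y" "s' \<in> nonzero" "m' \<in> carrier M" "scale N s' n = j m'" "scale Y s' y' = f m'"
      using y(2) unfolding P_def by blast
    have sc: "s \<in> carrier R" "s' \<in> carrier R" using 1 2 by auto
    have es: "\<eta> s \<in> carrier \<Lambda>" "\<eta> s' \<in> carrier \<Lambda>" using sc eta_closed by auto
    let ?d = "\<eta> s' \<odot>\<^bsub>M\<^esub> m \<ominus>\<^bsub>M\<^esub> \<eta> s \<odot>\<^bsub>M\<^esub> m'"
    have dc: "?d \<in> carrier M" using es 1 2 by simp
    have "j (\<eta> s' \<odot>\<^bsub>M\<^esub> m) = scale N s' (scale N s n)" using j(4)[OF sc(2) 1(3)] 1(4) by simp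
    also have "\<dots> = scale N s (scale N s' n)"
      using scale_mult[OF N sc n] by simp
    also have "\<dots> = j (\<eta> s \<odot>\<^bsub>M\<^esub> m')" using j(4)[OF sc(1) 2(3)] 2(4) by simp
    finally have "j ?d = \<zero>\<^bsub>N\<^esub>"
      using mod_hom_minus[OF M left_module_eps[OF N] is_locD(1)[OF loc], of "\<eta> s' \<odot>\<^bsub>M\<^esub> m" "\<eta> s \<odot>\<^bsub>M\<^esub> m'"]
        left_module.diff_eq_zero_iff[OF left_module_eps[OF N]] es 1 2 j(1) by simp
    then obtain t where t: "t \<in> nonzero" "\<eta> t \<odot>\<^bsub>M\<^esub> ?d = \<zero>\<^bsub>M\<^esub>" using is_locD(3)[OF loc dc] by blast
    then have "f (\<eta> t \<odot>\<^bsub>M\<^esub> ?d) = \<zero>\<^bsub>Y\<^esub>" using mod_hom_zero[OF M left_module_eps[OF Y] f] by simp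
    moreover have "f (\<eta> t \<odot>\<^bsub>M\<^esub> ?d) = scale Y t (f ?d)" by (rule fs[OF _ dc]) (use t in simp)
    ultimately have "scale Y t (f ?d) = \<zero>\<^bsub>Y\<^esub>" by simp
    then have "f ?d = \<zero>\<^bsub>Y\<^esub>" using scale_eq_zero[OF Y t(1) f'(1)[OF dc]] by simp
    then have "f (\<eta> s' \<odot>\<^bsub>M\<^esub> m) = f (\<eta> s \<odot>\<^bsub>M\<^esub> m')"
      using mod_hom_minus[OF M left_module_eps[OF Y] f, of "\<eta> s' \<odot>\<^bsub>M\<^esub> m" "\<eta> s \<odot>\<^bsub>M\<^esub> m'"]
        left_module.diff_eq_zero_iff[OF left_module_eps[OF Y]] es 1 2 f'(1) by simp
    then have "scale Y s' (scale Y s y) = scale Y s (scale Y s' y')" using fs sc 1 2 by simp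
    then have "scale Y (s \<otimes>\<^bsub>R\<^esub> s') y = scale Y (s \<otimes>\<^bsub>R\<^esub> s') y'"
      using scale_mult(2)[OF Y sc 1(1)] scale_mult(1)[OF Y sc 2(1)] by simp
    then show ?thesis using scale_cancel[OF Y nonzero_mult[OF 1(2) 2(2)] 1(1) 2(1)] by simp
  qed
  define F where "F n = (SOME y. P n y)" for n
  have PF: "P n (F n)" if "n \<in> carrier N" for n
    unfolding F_def using P_ex[OF that] by (rule someI_ex)
  have F_eq: "F n = y" if "n \<in> carrier N" "P n y" for n y
    using P_uniq[OF that(1) PF[OF that(1)] that(2)] .
  have "F \<in> mod_hom \<Lambda> (res N) (res Y)"
  proof (rule mod_homI)
    fix n assume "n \<in> carrier (res N)"
    then show "F n \<in> carrier (res Y)" using PF by (simp add: P_def)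
  next
    fix n n' assume "n \<in> carrier (res N)" "n' \<in> carrier (res N)"
    then have n: "n \<in> carrier N" "n' \<in> carrier N" by simp_all
    obtain s m where 1: "F n \<in> carrier Y" "s \<in> nonzero" "m \<in> carrier M" "scale N s n = j m" "scale Y s (F n) = f m"
      using PF[OF n(1)] unfolding P_def by blast
    obtain s' m' where 2: "F n' \<in> carrier Y" "s' \<in> nonzero" "m' \<in> carrier M" "scale N s' n' = j m'" "scale Y s' (F n') = f m'"
      using PF[OF n(2)] unfolding P_def by blast
    have sc: "s \<in> carrier R" "s' \<in> carrier R" using 1 2 by auto
    have es: "\<eta> s \<in> carrier \<Lambda>" "\<eta> s' \<in> carrier \<Lambda>" using sc eta_closed by auto
    have ec: "\<epsilon> (\<eta> (s \<otimes>\<^bsub>R\<^esub> s')) \<in> carrier A" using sc eta_closed eps_closed by simp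
    have "scale N (s \<otimes>\<^bsub>R\<^esub> s') (n \<oplus>\<^bsub>N\<^esub> n') = j (\<eta> s' \<odot>\<^bsub>M\<^esub> m \<oplus>\<^bsub>M\<^esub> \<eta> s \<odot>\<^bsub>M\<^esub> m')"
      using n es sc 1 2 ec j scale_mult(2)[OF N sc n(1)] scale_mult(1)[OF N sc n(2)] by (simp add: N.smult_r_distr)
    moreover have "scale Y (s \<otimes>\<^bsub>R\<^esub> s') (F n \<oplus>\<^bsub>Y\<^esub> F n') = f (\<eta> s' \<odot>\<^bsub>M\<^esub> m \<oplus>\<^bsub>M\<^esub> \<eta> s \<odot>\<^bsub>M\<^esub> m')"
      using es sc 1 2 ec f'(2) fs scale_mult(2)[OF Y sc 1(1)] scale_mult(1)[OF Y sc 2(1)] by (simp add: Y.smult_r_distr)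
    moreover have "\<eta> s' \<odot>\<^bsub>M\<^esub> m \<oplus>\<^bsub>M\<^esub> \<eta> s \<odot>\<^bsub>M\<^esub> m' \<in> carrier M" using es 1 2 by simp
    ultimately have "P (n \<oplus>\<^bsub>N\<^esub> n') (F n \<oplus>\<^bsub>Y\<^esub> F n')"
      using nonzero_mult[OF 1(2) 2(2)] 1(1) 2(1) unfolding P_def by blast
    then show "F (n \<oplus>\<^bsub>res N\<^esub> n') = F n \<oplus>\<^bsub>res Y\<^esub> F n'" using F_eq n by simp
  next
    fix a n assume a: "a \<in> carrier \<Lambda>" and "n \<in> carrier (res N)"
    then have n: "n \<in> carrier N" by simp
    obtain s m where 1: "F n \<in> carrier Y" "s \<in> nonzero" "m \<in> carrier M" "scale N s n = j m" "scale Y s (F n) = f m"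
      using PF[OF n] unfolding P_def by blast
    have sc: "s \<in> carrier R" using 1 by auto
    have "scale N s (\<epsilon> a \<odot>\<^bsub>N\<^esub> n) = j (a \<odot>\<^bsub>M\<^esub> m)"
      using scale_smult[OF N sc eps_closed[OF a] n] j(3)[OF a 1(3)] 1(4) by simp
    moreover have "scale Y s (\<epsilon> a \<odot>\<^bsub>Y\<^esub> F n) = f (a \<odot>\<^bsub>M\<^esub> m)"
      using scale_smult[OF Y sc eps_closed[OF a] 1(1)] f'(3)[OF a 1(3)] 1(5) by simp
    moreover have "a \<odot>\<^bsub>M\<^esub> m \<in> carrier M" "\<epsilon> a \<odot>\<^bsub>Y\<^esub> F n \<in> carrier Y" using a 1 eps_closed by simp_all
    ultimately have "P (\<epsilon> a \<odot>\<^bsub>N\<^esub> n) (\<epsilon> a \<odot>\<^bsub>Y\<^esub> F n)" using 1(2) unfolding P_def by blast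
    then show "F (a \<odot>\<^bsub>res N\<^esub> n) = a \<odot>\<^bsub>res Y\<^esub> F n" using F_eq n a eps_closed by simp
  qed
  then have "F \<in> mod_hom A N Y" by (rule mod_hom_of_res[OF N Y])
  moreover have "F (j m) = f m" if m: "m \<in> carrier M" for m
  proof (rule F_eq)
    have "scale N \<one>\<^bsub>R\<^esub> (j m) = j m" "scale Y \<one>\<^bsub>R\<^esub> (f m) = f m"
      using m j(1) f'(1) eta_one ring_hom_memE(4)[OF eps_hom] by simp_all
    then show "P (j m) (f m)" using m f'(1) one_nonzero unfolding P_def by blast
  qed (use j m in simp)
  ultimately show thesis using that by blast
qed

lemma is_loc_hom_eq:
  assumes N: "left_module A N" and Y: "left_module A Y" and loc: "is_loc M j N"
    and F: "F \<in> mod_hom A N Y" and G: "G \<in> mod_hom A N Y"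
    and eq: "\<And>m. m \<in> carrier M \<Longrightarrow> F (j m) = G (j m)" and n: "n \<in> carrier N"
  shows "F n = G n"
proof -
  obtain s m where s: "s \<in> nonzero" "m \<in> carrier M" "scale N s n = j m" using is_locD(2)[OF loc n] by blast
  then have "scale Y s (F n) = scale Y s (G n)"
    using scale_hom[OF N Y F _ n, of s] scale_hom[OF N Y G _ n, of s] eq[of m] by simp
  then show ?thesis using scale_cancel[OF Y s(1) mod_homD(1)[OF F n] mod_homD(1)[OF G n]] by simp
qed

lemma is_loc_unique:
  assumes M: "left_module \<Lambda> M" and N: "left_module A N" and N': "left_module A N'"
    and loc: "is_loc M j N" and loc': "is_loc M j' N'"
  shows "mod_iso A N N'"
proof -
  obtain F where F: "F \<in> mod_hom A N N'" "\<And>m. m \<in> carrier M \<Longrightarrow> F (j m) = j' m"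
    using is_loc_extend[OF M N N' loc is_locD(1)[OF loc']] by blast
  obtain G where G: "G \<in> mod_hom A N' N" "\<And>m. m \<in> carrier M \<Longrightarrow> G (j' m) = j m"
    using is_loc_extend[OF M N' N loc' is_locD(1)[OF loc]] by blast
  have i: "(\<lambda>x. x) \<in> mod_hom A N N" "(\<lambda>x. x) \<in> mod_hom A N' N'" by (simp_all add: mod_hom_def)
  have "G (F n) = n" if "n \<in> carrier N" for n
    by (rule is_loc_hom_eq[OF N N loc mod_hom_compose[OF F(1) G(1)] i(1) _ that]) (simp add: F G)
  moreover have "F (G n) = n" if "n \<in> carrier N'" for n
    by (rule is_loc_hom_eq[OF N' N' loc' mod_hom_compose[OF G(1) F(1)] i(2) _ that]) (simp add: F G)
  ultimately have "bij_betw F (carrier N) (carrier N')"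
    using mod_homD(1)[OF F(1)] mod_homD(1)[OF G(1)] by (intro bij_betw_byWitness[of _ G]) auto
  then show ?thesis using F(1) by (auto simp: mod_iso_def)
qed

lemma is_loc_iso_codomain:
  assumes N: "left_module A N" and N': "left_module A N'" and loc: "is_loc M j N"
    and h: "h \<in> mod_hom A N N'" "bij_betw h (carrier N) (carrier N')"
  shows "is_loc M (\<lambda>x. h (j x)) N'"
  unfolding is_loc_def
proof (intro conjI ballI impI)
  show "(\<lambda>x. h (j x)) \<in> mod_hom \<Lambda> M (res N')"
    by (rule mod_hom_compose[OF is_locD(1)[OF loc] mod_hom_eps[OF h(1)]])
next
  fix n assume "n \<in> carrier N'"
  then obtain x where x: "x \<in> carrier N" "n = h x" using h(2) by (auto simp: bij_betw_def)
  obtain s m where s: "s \<in> nonzero" "m \<in> carrier M" "scale N s x = j m" using is_locD(2)[OF loc x(1)] by blast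
  then have "scale N' s n = h (j m)" using scale_hom[OF N N' h(1) _ x(1), of s] x(2) by simp
  then show "\<exists>s\<in>nonzero. \<exists>m\<in>carrier M. scale N' s n = h (j m)" using s by blast
next
  fix m assume m: "m \<in> carrier M" "h (j m) = \<zero>\<^bsub>N'\<^esub>"
  interpret N: left_module A N by fact
  have "h (j m) = h \<zero>\<^bsub>N\<^esub>" using m mod_hom_zero[OF N N' h(1)] by simp
  then have "j m = \<zero>\<^bsub>N\<^esub>"
    using h(2) is_loc_hom(1)[OF loc m(1)] unfolding bij_betw_def by (meson N.M.zero_closed inj_onD)
  then show "\<exists>s\<in>nonzero. \<eta> s \<odot>\<^bsub>M\<^esub> m = \<zero>\<^bsub>M\<^esub>" using is_locD(3)[OF loc m(1)] by blast
qed

lemma is_loc_iso_domain: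
  assumes M: "left_module \<Lambda> M" and M': "left_module \<Lambda> M'" and loc: "is_loc M j N"
    and h: "h \<in> mod_hom \<Lambda> M' M" "bij_betw h (carrier M') (carrier M)"
  shows "is_loc M' (\<lambda>x. j (h x)) N"
  unfolding is_loc_def
proof (intro conjI ballI impI)
  show "(\<lambda>x. j (h x)) \<in> mod_hom \<Lambda> M' (res N)"
    by (rule mod_hom_compose[OF h(1) is_locD(1)[OF loc]])
next
  fix n assume "n \<in> carrier N"
  then obtain s m where s: "s \<in> nonzero" "m \<in> carrier M" "scale N s n = j m" using is_locD(2)[OF loc] by blast
  then obtain x where "x \<in> carrier M'" "m = h x" using h(2) by (auto simp: bij_betw_def)
  then show "\<exists>s\<in>nonzero. \<exists>m\<in>carrier M'. scale N s n = j (h m)" using s by blast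
next
  fix m assume m: "m \<in> carrier M'" "j (h m) = \<zero>\<^bsub>N\<^esub>"
  interpret M': left_module \<Lambda> M' by fact
  obtain s where s: "s \<in> nonzero" "\<eta> s \<odot>\<^bsub>M\<^esub> h m = \<zero>\<^bsub>M\<^esub>"
    using is_locD(3)[OF loc mod_homD(1)[OF h(1) m(1)] m(2)] by blast
  then have es: "\<eta> s \<in> carrier \<Lambda>" using eta_closed by simp
  then have "h (\<eta> s \<odot>\<^bsub>M'\<^esub> m) = h \<zero>\<^bsub>M'\<^esub>"
    using mod_homD(3)[OF h(1) es m(1)] s mod_hom_zero[OF M' M h(1)] by simp
  then have "\<eta> s \<odot>\<^bsub>M'\<^esub> m = \<zero>\<^bsub>M'\<^esub>"
    using h(2) es m(1) unfolding bij_betw_def by (meson M'.M.zero_closed M'.smult_closed inj_onD)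
  then show "\<exists>s\<in>nonzero. \<eta> s \<odot>\<^bsub>M'\<^esub> m = \<zero>\<^bsub>M'\<^esub>" using s(1) by blast
qed

lemma is_loc_finitely_generated:
  assumes M: "left_module \<Lambda> M" and N: "left_module A N" and loc: "is_loc M j N"
    and fg: "finitely_generated \<Lambda> M"
  shows "finitely_generated A N"
proof -
  interpret N: left_module A N by fact
  note j = is_loc_hom[OF loc]
  obtain S where S: "finite S" "S \<subseteq> carrier M" "carrier M \<subseteq> mod_span \<Lambda> M S"
    using fg finitely_generated_iff[OF M] by (auto simp: fg_sub_def)
  have jS: "j ` S \<subseteq> carrier N" using S(2) j(1) by auto
  let ?U = "mod_span A N (j ` S)"
  have U: "submodule ?U A N" by (rule submodule_mod_span[OF N jS])
  have "mod_span \<Lambda> M S \<subseteq> {m \<in> carrier M. j m \<in> ?U}"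
    using S(2) mod_span_superset[of "j ` S" A N]
    by (intro mod_span_least submodule_vimage[OF M left_module_eps[OF N] is_locD(1)[OF loc] submodule_eps[OF N U]]) auto
  then have jU: "j m \<in> ?U" if "m \<in> carrier M" for m using S(3) that by auto
  have "n \<in> ?U" if n: "n \<in> carrier N" for n
  proof -
    obtain s m where s: "s \<in> nonzero" "m \<in> carrier M" "scale N s n = j m" using is_locD(2)[OF loc n] by blast
    obtain t where t: "t \<in> carrier A" "t \<otimes>\<^bsub>A\<^esub> \<epsilon> (\<eta> s) = \<one>\<^bsub>A\<^esub>" using eps_unit[OF s(1)] by blast
    have c: "\<epsilon> (\<eta> s) \<in> carrier A" using eps_closed eta_closed s by simp
    have "n = t \<odot>\<^bsub>N\<^esub> j m" using N.smult_assoc[OF t(1) c n] t(2) n s(3) by simp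
    then show ?thesis using N.submoduleD(5)[OF U t(1) jU[OF s(2)]] by simp
  qed
  then have "fg_sub A N (carrier N)" unfolding fg_sub_def using S(1) jS by blast
  then show ?thesis using finitely_generated_iff[OF N] by simp
qed

text \<open>The saturation of a \<open>\<Lambda>\<close>-submodule.\<close>

lemma submodule_saturation:
  assumes N: "left_module A N" and U: "submodule U \<Lambda> (res N)"
  shows "submodule {n \<in> carrier N. \<exists>s\<in>nonzero. scale N s n \<in> U} A N" (is "submodule ?X A N")
    and "U \<subseteq> {n \<in> carrier N. \<exists>s\<in>nonzero. scale N s n \<in> U}"
proof -
  interpret N: left_module A N by fact
  have resN: "left_module \<Lambda> (res N)" by (rule left_module_eps[OF N])
  note u = left_module.submoduleD[OF resN U, simplified]
  have su: "scale N s x \<in> U" if "s \<in> carrier R" "x \<in> U" for s x using u(5)[OF eta_closed[OF that(1)] that(2)] .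
  show UX: "U \<subseteq> ?X"
  proof
    fix x assume "x \<in> U"
    then have "x \<in> carrier N" "scale N \<one>\<^bsub>R\<^esub> x \<in> U" using u(1) su by auto
    then show "x \<in> ?X" using one_nonzero by blast
  qed
  show "submodule ?X A N"
  proof (rule submodule_of_res[OF N left_module.left_submoduleI[OF resN]])
    show "?X \<subseteq> carrier (res N)" by auto
    show "\<zero>\<^bsub>res N\<^esub> \<in> ?X" using UX u(2) by auto
  next
    fix x y assume "x \<in> ?X" "y \<in> ?X"
    then obtain s t where x: "x \<in> carrier N" "s \<in> nonzero" "scale N s x \<in> U"
      and y: "y \<in> carrier N" "t \<in> nonzero" "scale N t y \<in> U" by blast
    have sc: "s \<in> carrier R" "t \<in> carrier R" using x y by auto
    have ec: "\<epsilon> (\<eta> (s \<otimes>\<^bsub>R\<^esub> t)) \<in> carrier A" using sc eta_closed eps_closed by simp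
    have "scale N (s \<otimes>\<^bsub>R\<^esub> t) (x \<oplus>\<^bsub>N\<^esub> y) = scale N t (scale N s x) \<oplus>\<^bsub>N\<^esub> scale N s (scale N t y)"
      using N.smult_r_distr[OF ec x(1) y(1)] scale_mult(2)[OF N sc x(1)] scale_mult(1)[OF N sc y(1)] by simp
    then have "scale N (s \<otimes>\<^bsub>R\<^esub> t) (x \<oplus>\<^bsub>N\<^esub> y) \<in> U" using u(3) su sc x y by simp
    then show "x \<oplus>\<^bsub>res N\<^esub> y \<in> ?X" using nonzero_mult[OF x(2) y(2)] x(1) y(1) by auto
  next
    fix a x assume a: "a \<in> carrier \<Lambda>" and "x \<in> ?X"
    then obtain s where x: "x \<in> carrier N" "s \<in> nonzero" "scale N s x \<in> U" by blast
    have "scale N s (\<epsilon> a \<odot>\<^bsub>N\<^esub> x) = \<epsilon> a \<odot>\<^bsub>N\<^esub> scale N s x" using scale_smult[OF N _ eps_closed[OF a] x(1)] x(2) by simp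
    then have "scale N s (\<epsilon> a \<odot>\<^bsub>N\<^esub> x) \<in> U" using u(5)[OF a x(3)] by simp
    then show "a \<odot>\<^bsub>res N\<^esub> x \<in> ?X" using x(1,2) eps_closed[OF a] by auto
  next
    fix s x assume s: "s \<in> nonzero" and x: "x \<in> carrier N" "scale N s x \<in> ?X"
    then obtain t where t: "t \<in> nonzero" "scale N t (scale N s x) \<in> U" by blast
    then have "scale N (t \<otimes>\<^bsub>R\<^esub> s) x \<in> U" using scale_mult(1)[OF N _ _ x(1), of t s] s by simp
    then show "x \<in> ?X" using nonzero_mult[OF t(1) s] x(1) by blast
  qed
qed

text \<open>A finitely generated \<open>A\<close>-module is the localization of the lattice spanned by its generators.\<close>

lemma lattice_exists:
  assumes N: "left_module A N" and fg: "finitely_generated A N"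
  obtains M j where "M \<in> mod_cat \<Lambda>" "is_loc M j N"
proof -
  interpret N: left_module A N by fact
  let ?N = "res N"
  have resN: "left_module \<Lambda> ?N" by (rule left_module_eps[OF N])
  obtain S where S: "finite S" "S \<subseteq> carrier N" "carrier N \<subseteq> mod_span A N S"
    using fg finitely_generated_iff[OF N] by (auto simp: fg_sub_def)
  let ?U = "mod_span \<Lambda> ?N S"
  have U: "submodule ?U \<Lambda> ?N" using submodule_mod_span[OF resN] S(2) by simp
  let ?X = "{n \<in> carrier N. \<exists>s\<in>nonzero. scale N s n \<in> ?U}"
  note X = submodule_saturation[OF N U]
  have "S \<subseteq> ?X" using X(2) mod_span_superset[of S \<Lambda> ?N] by blast
  then have XN: "carrier N \<subseteq> ?X" using S(3) mod_span_least[OF X(1)] by blast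
  let ?M = "?N \<restriction> ?U"
  have M: "left_module \<Lambda> ?M" by (rule left_module_restr[OF resN U])
  have inc: "(\<lambda>x. x) \<in> mod_hom \<Lambda> ?M ?N" by (rule mod_hom_inclusion[OF left_module.submoduleD(1)[OF resN U]])
  have loc: "is_loc ?M (\<lambda>x. x) N"
    unfolding is_loc_def
  proof (intro conjI ballI impI)
    show "(\<lambda>x. x) \<in> mod_hom \<Lambda> ?M ?N" by (rule inc)
    show "\<exists>s\<in>nonzero. \<exists>m\<in>carrier ?M. scale N s n = m" if "n \<in> carrier N" for n
      using XN that by auto
    show "\<exists>s\<in>nonzero. \<eta> s \<odot>\<^bsub>?M\<^esub> m = \<zero>\<^bsub>?M\<^esub>" if "m \<in> carrier ?M" "m = \<zero>\<^bsub>N\<^esub>" for m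
      using one_nonzero that scale_zero[OF N, of "\<one>\<^bsub>R\<^esub>"] by (intro bexI[of _ "\<one>\<^bsub>R\<^esub>"]) simp_all
  qed
  have "fg_sub \<Lambda> ?N ?U" unfolding fg_sub_def using S(1) mod_span_superset[of S \<Lambda> ?N] by blast
  then have "finitely_generated \<Lambda> ?M" using finitely_generated_restr_iff[OF resN U] by simp
  then obtain M' where M': "M' \<in> mod_cat \<Lambda>" "mod_iso \<Lambda> ?M M'" using fg_module_has_copy[OF M] by blast
  obtain h where "h \<in> mod_hom \<Lambda> M' ?M" "bij_betw h (carrier M') (carrier ?M)"
    using mod_iso_sym[OF M M'(2)] by (elim mod_isoE)
  then show thesis using that[OF M'(1) is_loc_iso_domain[OF M mod_catD(1)[OF M'(1)] loc]] by blast
qed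

text \<open>Clearing denominators: a homomorphism into the localization of a finitely generated module
  becomes a homomorphism into the module itself after multiplication by a nonzero element \<open>s\<close>, which
  moves the image into the image of \<open>j\<close>, and by a nonzero element \<open>r\<close>, which kills the kernel of \<open>j\<close>.\<close>

lemma hom_vanishes_localization:
  assumes L: "left_module \<Lambda> L" "finitely_generated \<Lambda> L"
    and M: "left_module \<Lambda> M" "finitely_generated \<Lambda> M" and N: "left_module A N" and loc: "is_loc M j N"
    and van: "hom_vanishes \<Lambda> L M"
  shows "hom_vanishes \<Lambda> L (res N)"
  unfolding hom_vanishes_def
proof (intro ballI)
  fix f x assume f: "f \<in> mod_hom \<Lambda> L (res N)" and x: "x \<in> carrier L"
  interpret L: left_module \<Lambda> L by fact
  interpret M: left_module \<Lambda> M by fact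
  interpret N: left_module A N by fact
  note f' = mod_homD[OF f, simplified] and j = is_loc_hom[OF loc]
  have resN: "left_module \<Lambda> (res N)" by (rule left_module_eps[OF N])
  have jM: "submodule (j ` carrier M) \<Lambda> (res N)"
    by (rule submodule_image[OF M(1) resN is_locD(1)[OF loc] M.submodule_carrier])
  note jm = left_module.submoduleD[OF resN jM, simplified]
  obtain S where S: "finite S" "S \<subseteq> carrier L" "carrier L \<subseteq> mod_span \<Lambda> L S"
    using L(2) finitely_generated_iff[OF L(1)] by (auto simp: fg_sub_def)
  have "\<exists>s\<in>nonzero. \<forall>y\<in>T. scale N s (f y) \<in> j ` carrier M" if "T \<subseteq> S" for T
    using finite_subset[OF that S(1)] that
  proof (induction T)
    case empty
    then show ?case using one_nonzero by blast
  next
    case (insert y T)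
    then obtain s where s: "s \<in> nonzero" "\<forall>y\<in>T. scale N s (f y) \<in> j ` carrier M" by auto
    have yc: "y \<in> carrier L" using insert.prems S(2) by auto
    obtain t where t: "t \<in> nonzero" "scale N t (f y) \<in> j ` carrier M" using is_locD(2)[OF loc f'(1)[OF yc]] by blast
    have sc: "s \<in> carrier R" "t \<in> carrier R" using s t by auto
    have "scale N (s \<otimes>\<^bsub>R\<^esub> t) (f z) \<in> j ` carrier M" if z: "z \<in> insert y T" for z
    proof (cases "z = y")
      case True
      then show ?thesis using scale_mult(1)[OF N sc f'(1)[OF yc]] jm(5)[OF eta_closed[OF sc(1)] t(2)] by simp
    next
      case False
      then have "z \<in> T" "z \<in> carrier L" using z insert.prems S(2) by auto
      then show ?thesis
        using scale_mult(2)[OF N sc f'(1), of z] jm(5)[OF eta_closed[OF sc(2)], of "scale N s (f z)"] s(2) by simp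
    qed
    then show ?case using nonzero_mult[OF s(1) t(1)] by blast
  qed
  then obtain s where s: "s \<in> nonzero" "\<forall>y\<in>S. scale N s (f y) \<in> j ` carrier M" by blast
  have sc: "s \<in> carrier R" using s by simp
  define sf where "sf y = scale N s (f y)" for y
  have sf: "sf \<in> mod_hom \<Lambda> L (res N)"
    using mod_hom_compose[OF f scaling_hom[OF resN sc]] by (simp add: sf_def[abs_def])
  note sf' = mod_homD[OF sf, simplified]
  have "mod_span \<Lambda> L S \<subseteq> {y \<in> carrier L. sf y \<in> j ` carrier M}"
    using s(2) S(2) by (intro mod_span_least submodule_vimage[OF L(1) resN sf jM]) (auto simp: sf_def)
  then have sfj: "sf y \<in> j ` carrier M" if "y \<in> carrier L" for y using that S(3) by auto
  let ?T = "{m \<in> carrier M. j m = \<zero>\<^bsub>N\<^esub>}"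
  have T: "submodule ?T \<Lambda> M" using submodule_kernel[OF M(1) resN is_locD(1)[OF loc]] by simp
  have "fg_sub \<Lambda> M ?T" using noetherian_over_algebra[OF M] T by (simp add: noetherian_mod_def)
  then obtain B where B: "finite B" "B \<subseteq> ?T" "?T \<subseteq> mod_span \<Lambda> M B" unfolding fg_sub_def by blast
  have "\<exists>r\<in>nonzero. \<forall>y\<in>C. \<eta> r \<odot>\<^bsub>M\<^esub> y = \<zero>\<^bsub>M\<^esub>" if "C \<subseteq> B" for C
    using finite_subset[OF that B(1)] that
  proof (induction C)
    case empty
    then show ?case using one_nonzero by blast
  next
    case (insert y C)
    then obtain r where r: "r \<in> nonzero" "\<forall>y\<in>C. \<eta> r \<odot>\<^bsub>M\<^esub> y = \<zero>\<^bsub>M\<^esub>" by auto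
    have y: "y \<in> carrier M" "j y = \<zero>\<^bsub>N\<^esub>" using insert.prems B(2) by auto
    obtain t where t: "t \<in> nonzero" "\<eta> t \<odot>\<^bsub>M\<^esub> y = \<zero>\<^bsub>M\<^esub>" using is_locD(3)[OF loc y] by blast
    have rc: "r \<in> carrier R" "t \<in> carrier R" using r t by auto
    have "\<eta> (r \<otimes>\<^bsub>R\<^esub> t) \<odot>\<^bsub>M\<^esub> z = \<zero>\<^bsub>M\<^esub>" if z: "z \<in> insert y C" for z
    proof (cases "z = y")
      case True
      then show ?thesis using eta_mult_smult(1)[OF M(1) rc y(1)] t(2) eta_closed[OF rc(1)] by simp
    next
      case False
      then have "z \<in> C" "z \<in> carrier M" using z insert.prems B(2) by auto
      then show ?thesis using eta_mult_smult(2)[OF M(1) rc, of z] r(2) eta_closed[OF rc(2)] by simp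
    qed
    then show ?case using nonzero_mult[OF r(1) t(1)] by blast
  qed
  then obtain r where r: "r \<in> nonzero" "\<forall>y\<in>B. \<eta> r \<odot>\<^bsub>M\<^esub> y = \<zero>\<^bsub>M\<^esub>" by blast
  have rc: "r \<in> carrier R" "\<eta> r \<in> carrier \<Lambda>" using r eta_closed by auto
  have "mod_span \<Lambda> M B \<subseteq> {y \<in> carrier M. \<eta> r \<odot>\<^bsub>M\<^esub> y = \<zero>\<^bsub>M\<^esub>}"
    using r(2) B(2) by (intro mod_span_least submodule_kernel[OF M(1) M(1) scaling_hom[OF M(1) rc(1)]]) auto
  then have rT: "\<eta> r \<odot>\<^bsub>M\<^esub> y = \<zero>\<^bsub>M\<^esub>" if "y \<in> carrier M" "j y = \<zero>\<^bsub>N\<^esub>" for y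
    using that B(3) by auto
  have r_eq: "\<eta> r \<odot>\<^bsub>M\<^esub> y = \<eta> r \<odot>\<^bsub>M\<^esub> z" if y: "y \<in> carrier M" "z \<in> carrier M" "j y = j z" for y z
  proof -
    have "j (y \<ominus>\<^bsub>M\<^esub> z) = \<zero>\<^bsub>N\<^esub>"
      using mod_hom_minus[OF M(1) resN is_locD(1)[OF loc] y(1,2)]
        left_module.diff_eq_zero_iff[OF resN] y j(1) by simp
    then have "\<eta> r \<odot>\<^bsub>M\<^esub> (y \<ominus>\<^bsub>M\<^esub> z) = \<zero>\<^bsub>M\<^esub>" using rT y by simp
    then show ?thesis using M.smult_diff[OF rc(2) y(1,2)] M.diff_eq_zero_iff rc y by simp
  qed
  \<comment> \<open>a lift of \<open>s f\<close> through \<open>j\<close>, additive only after multiplication by \<open>r\<close>\<close>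
  define l where "l y = (SOME m. m \<in> carrier M \<and> j m = sf y)" for y
  have l: "l y \<in> carrier M \<and> j (l y) = sf y" if "y \<in> carrier L" for y
    unfolding l_def by (rule someI_ex) (use sfj[OF that] in \<open>metis imageE\<close>)
  have "(\<lambda>y. \<eta> r \<odot>\<^bsub>M\<^esub> l y) \<in> mod_hom \<Lambda> L M"
  proof (rule mod_homI)
    show "\<eta> r \<odot>\<^bsub>M\<^esub> l y \<in> carrier M" if "y \<in> carrier L" for y using l[OF that] rc by simp
  next
    fix y z assume yz: "y \<in> carrier L" "z \<in> carrier L"
    have "\<eta> r \<odot>\<^bsub>M\<^esub> l (y \<oplus>\<^bsub>L\<^esub> z) = \<eta> r \<odot>\<^bsub>M\<^esub> (l y \<oplus>\<^bsub>M\<^esub> l z)"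
      using l[of "y \<oplus>\<^bsub>L\<^esub> z"] l[OF yz(1)] l[OF yz(2)] yz j(2) sf'(2) by (intro r_eq) simp_all
    then show "\<eta> r \<odot>\<^bsub>M\<^esub> l (y \<oplus>\<^bsub>L\<^esub> z) = \<eta> r \<odot>\<^bsub>M\<^esub> l y \<oplus>\<^bsub>M\<^esub> \<eta> r \<odot>\<^bsub>M\<^esub> l z"
      using M.smult_r_distr rc l yz by simp
  next
    fix a y assume a: "a \<in> carrier \<Lambda>" and y: "y \<in> carrier L"
    have "\<eta> r \<odot>\<^bsub>M\<^esub> l (a \<odot>\<^bsub>L\<^esub> y) = \<eta> r \<odot>\<^bsub>M\<^esub> (a \<odot>\<^bsub>M\<^esub> l y)"
      using l[of "a \<odot>\<^bsub>L\<^esub> y"] l[OF y] a y j(3) sf'(3) by (intro r_eq) simp_all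
    then show "\<eta> r \<odot>\<^bsub>M\<^esub> l (a \<odot>\<^bsub>L\<^esub> y) = a \<odot>\<^bsub>M\<^esub> (\<eta> r \<odot>\<^bsub>M\<^esub> l y)"
      using eta_commute[OF M(1) rc(1) a] l[OF y] by simp
  qed
  then have "\<eta> r \<odot>\<^bsub>M\<^esub> l x = \<zero>\<^bsub>M\<^esub>" using hom_vanishesD[OF van] x by blast
  then have "scale N r (sf x) = \<zero>\<^bsub>N\<^esub>"
    using j(4)[OF rc(1), of "l x"] l[OF x] mod_hom_zero[OF M(1) resN is_locD(1)[OF loc]] by simp
  then have "sf x = \<zero>\<^bsub>N\<^esub>" using scale_eq_zero[OF N r(1)] sf'(1)[OF x] by simp
  then show "f x = \<zero>\<^bsub>res N\<^esub>" using scale_eq_zero[OF N s(1)] f'(1)[OF x] by (simp add: sf_def)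
qed

end

section \<open>Torsion classes and localization\<close>

context dim_one_order
begin

lemma fl_catD:
  assumes "M \<in> fl_cat \<Lambda>"
  shows "M \<in> mod_cat \<Lambda>" "R_torsion M" "left_module \<Lambda> M"
proof -
  show "M \<in> mod_cat \<Lambda>" "R_torsion M" using assms unfolding fl_cat_eq by simp_all
  show "left_module \<Lambda> M" using assms by (simp add: fl_cat_def)
qed

lemma image_in_mod_cat:
  assumes M: "M \<in> mod_cat \<Lambda>" and N: "N \<in> mod_cat \<Lambda>" and f: "f \<in> mod_hom \<Lambda> M N"
  shows "N \<restriction> f ` carrier M \<in> mod_cat \<Lambda>" "f \<in> mod_hom \<Lambda> M (N \<restriction> f ` carrier M)"
    "N \<restriction> f ` carrier M \<in> Fac \<Lambda> M"
proof -
  interpret M: left_module \<Lambda> M by (rule mod_catD(1)[OF M])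
  note Ml = mod_catD(1)[OF M] and Nl = mod_catD(1)[OF N]
  have I: "submodule (f ` carrier M) \<Lambda> N" by (rule submodule_image[OF Ml Nl f M.submodule_carrier])
  have "fg_sub \<Lambda> N (f ` carrier M)"
    using fg_sub_image[OF Ml Nl f order_refl] mod_catD(2)[OF M] finitely_generated_iff[OF Ml] by simp
  then show 1: "N \<restriction> f ` carrier M \<in> mod_cat \<Lambda>"
    using left_module_restr[OF Nl I] finitely_generated_restr_iff[OF Nl I] by (simp add: mod_cat_def)
  show 2: "f \<in> mod_hom \<Lambda> M (N \<restriction> f ` carrier M)" by (rule mod_hom_restr_codomain[OF f order_refl])
  show "N \<restriction> f ` carrier M \<in> Fac \<Lambda> M" by (rule image_in_Fac[OF Ml 1 2]) simp
qed

text \<open>A homomorphism from a member of the closure to \<open>N \<in> \<F>\<close> has an image of finite length, which lies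
  in \<open>\<T>\<close> and therefore has only the zero homomorphism to \<open>N\<close>.\<close>

lemma fl_closure_perp:
  assumes tp: "torsion_pair \<Lambda> (fl_cat \<Lambda>) \<T> \<F>"
  shows "fl_closure \<Lambda> \<T> = {M \<in> mod_cat \<Lambda>. \<forall>N\<in>\<F>. hom_vanishes \<Lambda> M N}"
proof (intro equalityI subsetI)
  note perp = torsion_pair_perp[OF tp fl_catD(3)]
  have F: "\<F> \<subseteq> fl_cat \<Lambda>" using tp by (simp add: torsion_pair_def is_subcategory_def)
  { fix M assume "M \<in> fl_closure \<Lambda> \<T>"
    then have M: "M \<in> mod_cat \<Lambda>" and Fac: "Fac \<Lambda> M \<inter> fl_cat \<Lambda> \<subseteq> \<T>" by (simp_all add: fl_closure_def)
    have "f x = \<zero>\<^bsub>N\<^esub>" if N: "N \<in> \<F>" and f: "f \<in> mod_hom \<Lambda> M N" and x: "x \<in> carrier M" for N f x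
    proof -
      have Nfl: "N \<in> fl_cat \<Lambda>" using N F by auto
      let ?I = "N \<restriction> f ` carrier M"
      note I = image_in_mod_cat[OF M fl_catD(1)[OF Nfl] f]
      have sub: "f ` carrier M \<subseteq> carrier N" using mod_homD(1)[OF f] by auto
      then have "R_torsion ?I" using fl_catD(2)[OF Nfl] by (auto simp: R_torsion_def)
      then have "?I \<in> fl_cat \<Lambda>" using fl_cat_eq I(1) by simp
      then have "?I \<in> \<T>" using Fac I(3) by auto
      then have "hom_vanishes \<Lambda> ?I N" using perp N by simp
      from hom_vanishesD[OF this mod_hom_inclusion[OF sub], of "f x"] show ?thesis using x by simp
    qed
    then show "M \<in> {M \<in> mod_cat \<Lambda>. \<forall>N\<in>\<F>. hom_vanishes \<Lambda> M N}" using M by (simp add: hom_vanishes_def) }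
  { fix M assume "M \<in> {M \<in> mod_cat \<Lambda>. \<forall>N\<in>\<F>. hom_vanishes \<Lambda> M N}"
    then have M: "M \<in> mod_cat \<Lambda>" and van: "\<And>N. N \<in> \<F> \<Longrightarrow> hom_vanishes \<Lambda> M N" by simp_all
    have "X \<in> \<T>" if X: "X \<in> Fac \<Lambda> M" "X \<in> fl_cat \<Lambda>" for X
    proof -
      have "hom_vanishes \<Lambda> X N" if "N \<in> \<F>" for N
        using Fac_hom_vanishes[OF mod_catD(1)[OF M] fl_catD(3) X(1) van[OF that]] F that by blast
      then show ?thesis using perp X(2) by simp
    qed
    then show "M \<in> fl_closure \<Lambda> \<T>" using M by (auto simp: fl_closure_def) }
qed

lemma tors_restrict_fl:
  assumes C: "\<C> \<in> tors \<Lambda>"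
  shows "\<C> \<inter> fl_cat \<Lambda> \<in> tors_fl \<Lambda>" "\<C> \<subseteq> fl_closure \<Lambda> (\<C> \<inter> fl_cat \<Lambda>)"
proof -
  obtain \<F> where tp: "torsion_pair \<Lambda> (mod_cat \<Lambda>) \<C> \<F>" using C by (auto simp: tors_def torsion_classes_def)
  note perp = torsion_pair_perp[OF tp mod_catD(1)]
  have sc: "is_subcategory \<Lambda> (mod_cat \<Lambda>) \<C>" "is_subcategory \<Lambda> (mod_cat \<Lambda>) \<F>"
    and van: "\<forall>L\<in>\<C>. \<forall>N\<in>\<F>. \<forall>f\<in>mod_hom \<Lambda> L N. \<forall>x\<in>carrier L. f x = \<zero>\<^bsub>N\<^esub>"
    and seq: "\<forall>M\<in>mod_cat \<Lambda>. \<exists>L\<in>\<C>. \<exists>N\<in>\<F>. \<exists>f g. short_exact \<Lambda> L f M g N"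
    using tp by (simp_all add: torsion_pair_def)
  have F: "\<F> \<subseteq> mod_cat \<Lambda>" "\<C> \<subseteq> mod_cat \<Lambda>" using sc by (simp_all add: is_subcategory_def)
  have "torsion_pair \<Lambda> (fl_cat \<Lambda>) (\<C> \<inter> fl_cat \<Lambda>) (\<F> \<inter> fl_cat \<Lambda>)"
    unfolding torsion_pair_def
  proof (intro conjI ballI)
    show "is_subcategory \<Lambda> (fl_cat \<Lambda>) (\<C> \<inter> fl_cat \<Lambda>)" "is_subcategory \<Lambda> (fl_cat \<Lambda>) (\<F> \<inter> fl_cat \<Lambda>)"
      using sc fl_catD(1) unfolding is_subcategory_def by auto
  next
    fix L N f x assume "L \<in> \<C> \<inter> fl_cat \<Lambda>" "N \<in> \<F> \<inter> fl_cat \<Lambda>" "f \<in> mod_hom \<Lambda> L N" "x \<in> carrier L"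
    then show "f x = \<zero>\<^bsub>N\<^esub>" using van[rule_format, of L N f x] by simp
  next
    fix M assume M: "M \<in> fl_cat \<Lambda>"
    have Ml: "left_module \<Lambda> M" by (rule fl_catD(3)[OF M])
    obtain L N f g where L: "L \<in> \<C>" and N: "N \<in> \<F>" and se: "short_exact \<Lambda> L f M g N"
      using seq fl_catD(1)[OF M] by blast
    have f: "f \<in> mod_hom \<Lambda> L M" "inj_on f (carrier L)" and g: "g \<in> mod_hom \<Lambda> M N" "g ` carrier M = carrier N"
      using se by (simp_all add: short_exact_def)
    have Lm: "L \<in> mod_cat \<Lambda>" and Nm: "N \<in> mod_cat \<Lambda>" using L N F by auto
    have Ll: "left_module \<Lambda> L" and Nl: "left_module \<Lambda> N" using Lm Nm mod_catD by auto
    interpret L: left_module \<Lambda> L by fact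
    have "\<exists>s\<in>nonzero. \<eta> s \<odot>\<^bsub>L\<^esub> x = \<zero>\<^bsub>L\<^esub>" if x: "x \<in> carrier L" for x
    proof -
      obtain s where s: "s \<in> nonzero" "\<eta> s \<odot>\<^bsub>M\<^esub> f x = \<zero>\<^bsub>M\<^esub>"
        using fl_catD(2)[OF M] mod_homD(1)[OF f(1) x] unfolding R_torsion_def by blast
      have es: "\<eta> s \<in> carrier \<Lambda>" using s(1) eta_closed by simp
      have "f (\<eta> s \<odot>\<^bsub>L\<^esub> x) = f \<zero>\<^bsub>L\<^esub>"
        using mod_homD(3)[OF f(1) es x] s(2) mod_hom_zero[OF Ll Ml f(1)] by simp
      then have "\<eta> s \<odot>\<^bsub>L\<^esub> x = \<zero>\<^bsub>L\<^esub>" using inj_onD[OF f(2)] es x by simp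
      then show ?thesis using s(1) by blast
    qed
    then have "L \<in> fl_cat \<Lambda>" using fl_cat_eq Lm by (simp add: R_torsion_def)
    moreover have "\<exists>s\<in>nonzero. \<eta> s \<odot>\<^bsub>N\<^esub> y = \<zero>\<^bsub>N\<^esub>" if y: "y \<in> carrier N" for y
    proof -
      obtain x where x: "x \<in> carrier M" "y = g x" using g(2) y by auto
      obtain s where s: "s \<in> nonzero" "\<eta> s \<odot>\<^bsub>M\<^esub> x = \<zero>\<^bsub>M\<^esub>"
        using fl_catD(2)[OF M] x(1) unfolding R_torsion_def by blast
      have "\<eta> s \<odot>\<^bsub>N\<^esub> y = g (\<eta> s \<odot>\<^bsub>M\<^esub> x)"
        using mod_homD(3)[OF g(1) eta_closed x(1)] s(1) x(2) by simp
      then show ?thesis using s mod_hom_zero[OF Ml Nl g(1)] by auto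
    qed
    then have "N \<in> fl_cat \<Lambda>" using fl_cat_eq Nm by (simp add: R_torsion_def)
    ultimately show "\<exists>L\<in>\<C> \<inter> fl_cat \<Lambda>. \<exists>N\<in>\<F> \<inter> fl_cat \<Lambda>. \<exists>f g. short_exact \<Lambda> L f M g N"
      using L N se by blast
  qed
  then show "\<C> \<inter> fl_cat \<Lambda> \<in> tors_fl \<Lambda>" by (auto simp: tors_fl_def torsion_classes_def)
  show "\<C> \<subseteq> fl_closure \<Lambda> (\<C> \<inter> fl_cat \<Lambda>)"
  proof
    fix M assume M: "M \<in> \<C>"
    then have Mm: "M \<in> mod_cat \<Lambda>" using F by auto
    have "X \<in> \<C>" if X: "X \<in> Fac \<Lambda> M" for X
    proof -
      have "hom_vanishes \<Lambda> X N" if N: "N \<in> \<F>" for N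
      proof (rule Fac_hom_vanishes[OF mod_catD(1)[OF Mm] _ X])
        show "left_module \<Lambda> N" using N F mod_catD by auto
        show "hom_vanishes \<Lambda> M N" using perp M N by simp
      qed
      moreover have "X \<in> mod_cat \<Lambda>" using X by (simp add: Fac_def)
      ultimately show ?thesis using perp by simp
    qed
    then show "M \<in> fl_closure \<Lambda> (\<C> \<inter> fl_cat \<Lambda>)" using Mm by (auto simp: fl_closure_def)
  qed
qed

lemma interval_member_fl:
  assumes T: "\<T> \<in> tors_fl \<Lambda>" and C: "\<C> \<in> tors_interval \<Lambda> \<T> (fl_closure \<Lambda> \<T>)"
  shows "\<C> \<inter> fl_cat \<Lambda> = \<T>"
proof
  have "\<T> \<subseteq> fl_cat \<Lambda>"
    using T by (auto simp: tors_fl_def torsion_classes_def torsion_pair_def is_subcategory_def)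
  then show "\<T> \<subseteq> \<C> \<inter> fl_cat \<Lambda>" using C by (simp add: tors_interval_def)
  show "\<C> \<inter> fl_cat \<Lambda> \<subseteq> \<T>"
  proof
    fix M assume M: "M \<in> \<C> \<inter> fl_cat \<Lambda>"
    then have Mc: "M \<in> fl_closure \<Lambda> \<T>" using C by (auto simp: tors_interval_def)
    have "M \<in> Fac \<Lambda> M"
      by (rule image_in_Fac[of _ _ _ "\<lambda>x. x"]) (use M fl_catD in \<open>simp_all add: mod_hom_def\<close>)
    then show "M \<in> \<T>" using Mc M by (auto simp: fl_closure_def)
  qed
qed

lemma tors_eq_Union_intervals:
  "tors \<Lambda> = (\<Union>\<T>\<in>tors_fl \<Lambda>. tors_interval \<Lambda> \<T> (fl_closure \<Lambda> \<T>))"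
proof
  show "tors \<Lambda> \<subseteq> (\<Union>\<T>\<in>tors_fl \<Lambda>. tors_interval \<Lambda> \<T> (fl_closure \<Lambda> \<T>))"
  proof
    fix \<C> assume "\<C> \<in> tors \<Lambda>"
    then show "\<C> \<in> (\<Union>\<T>\<in>tors_fl \<Lambda>. tors_interval \<Lambda> \<T> (fl_closure \<Lambda> \<T>))"
      using tors_restrict_fl[of \<C>] by (intro UN_I[of "\<C> \<inter> fl_cat \<Lambda>"]) (simp_all add: tors_interval_def)
  qed
qed (auto simp: tors_interval_def)

lemma intervals_disjoint:
  "disjoint_family_on (\<lambda>\<T>. tors_interval \<Lambda> \<T> (fl_closure \<Lambda> \<T>)) (tors_fl \<Lambda>)"
  unfolding disjoint_family_on_def using interval_member_fl by blast

end

context order_localization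
begin

text \<open>The class of localizations of members of \<open>\<C>\<close>.\<close>

definition loc_image :: "('l, 'l list set) module set \<Rightarrow> ('b, 'b list set) module set" where
  "loc_image \<C> = {N \<in> mod_cat A. \<exists>M\<in>\<C>. \<exists>j. is_loc M j N}"

lemma hom_vanishes_is_loc_iff:
  assumes M: "left_module \<Lambda> M" and N: "left_module A N" and Y: "left_module A Y" and loc: "is_loc M j N"
  shows "hom_vanishes A N Y \<longleftrightarrow> hom_vanishes \<Lambda> M (res Y)"
proof
  assume van: "hom_vanishes A N Y"
  show "hom_vanishes \<Lambda> M (res Y)"
    unfolding hom_vanishes_def
  proof (intro ballI)
    fix f x assume f: "f \<in> mod_hom \<Lambda> M (res Y)" and x: "x \<in> carrier M"
    obtain F where "F \<in> mod_hom A N Y" "\<And>m. m \<in> carrier M \<Longrightarrow> F (j m) = f m"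
      using is_loc_extend[OF M N Y loc f] by blast
    then show "f x = \<zero>\<^bsub>res Y\<^esub>" using hom_vanishesD[OF van] is_loc_hom(1)[OF loc x] x by fastforce
  qed
next
  assume van: "hom_vanishes \<Lambda> M (res Y)"
  interpret Y: left_module A Y by fact
  show "hom_vanishes A N Y"
    unfolding hom_vanishes_def
  proof (intro ballI)
    fix F n assume F: "F \<in> mod_hom A N Y" and n: "n \<in> carrier N"
    have Fj: "(\<lambda>m. F (j m)) \<in> mod_hom \<Lambda> M (res Y)"
      by (rule mod_hom_compose[OF is_locD(1)[OF loc] mod_hom_eps[OF F]])
    obtain s m where s: "s \<in> nonzero" "m \<in> carrier M" "scale N s n = j m" using is_locD(2)[OF loc n] by blast
    then have "scale Y s (F n) = \<zero>\<^bsub>Y\<^esub>"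
      using scale_hom[OF N Y F _ n, of s] hom_vanishesD[OF van Fj s(2)] by simp
    then show "F n = \<zero>\<^bsub>Y\<^esub>" using scale_eq_zero[OF Y s(1) mod_homD(1)[OF F n]] by simp
  qed
qed

text \<open>The localization of the canonical sequence of a lattice in \<open>X\<close> is the canonical sequence of
  \<open>X\<close>: the torsion part of the lattice generates \<open>X'\<close>, and the quotient of \<open>X\<close> by \<open>X'\<close> is a
  localization of the torsion-free part.\<close>

lemma loc_image_tors:
  assumes C: "\<C> \<in> tors \<Lambda>"
  shows "loc_image \<C> \<in> tors A"
proof -
  obtain \<F> where tp: "torsion_pair \<Lambda> (mod_cat \<Lambda>) \<C> \<F>" using C by (auto simp: tors_def torsion_classes_def)
  note perp = torsion_pair_perp[OF tp mod_catD(1)]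
  have sub: "\<C> \<subseteq> mod_cat \<Lambda>" "\<F> \<subseteq> mod_cat \<Lambda>"
    and seq: "\<forall>M\<in>mod_cat \<Lambda>. \<exists>L\<in>\<C>. \<exists>N\<in>\<F>. \<exists>f g. short_exact \<Lambda> L f M g N"
    using tp by (simp_all add: torsion_pair_def is_subcategory_def)
  let ?F = "{Y \<in> mod_cat A. \<forall>N\<in>loc_image \<C>. hom_vanishes A N Y}"
  have "torsion_pair A (mod_cat A) (loc_image \<C>) ?F"
    unfolding torsion_pair_def
  proof (intro conjI ballI)
    show "is_subcategory A (mod_cat A) (loc_image \<C>)"
      unfolding is_subcategory_def
    proof (intro conjI ballI impI)
      fix N N' assume N: "N \<in> loc_image \<C>" and N': "N' \<in> mod_cat A" and iso: "mod_iso A N N'"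
      obtain M j where M: "M \<in> \<C>" "is_loc M j N" and Nm: "N \<in> mod_cat A" using N by (auto simp: loc_image_def)
      obtain h where "h \<in> mod_hom A N N'" "bij_betw h (carrier N) (carrier N')" using iso by (elim mod_isoE)
      then have "is_loc M (\<lambda>x. h (j x)) N'"
        by (rule is_loc_iso_codomain[OF mod_catD(1)[OF Nm] mod_catD(1)[OF N'] M(2)])
      then show "N' \<in> loc_image \<C>" using N' M(1) by (auto simp: loc_image_def)
    qed (auto simp: loc_image_def)
    show "is_subcategory A (mod_cat A) ?F"
      unfolding is_subcategory_def
    proof (intro conjI ballI impI)
      fix M N assume M: "M \<in> ?F" and N: "N \<in> mod_cat A" and iso: "mod_iso A M N"
      have "left_module A M" "left_module A N" using M N mod_catD by auto
      then have "hom_vanishes A X N" if "X \<in> loc_image \<C>" for X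
        using hom_vanishes_iso_codomain[of A M N X] M iso that by simp
      then show "N \<in> ?F" using N by simp
    qed auto
  next
    fix L N f x assume "L \<in> loc_image \<C>" "N \<in> ?F" "f \<in> mod_hom A L N" "x \<in> carrier L"
    then show "f x = \<zero>\<^bsub>N\<^esub>" by (simp add: hom_vanishes_def)
  next
    fix X assume X: "X \<in> mod_cat A"
    note Xl = mod_catD(1)[OF X]
    interpret X: left_module A X by (rule Xl)
    have resX: "left_module \<Lambda> (res X)" by (rule left_module_eps[OF Xl])
    obtain M i where M: "M \<in> mod_cat \<Lambda>" and loc: "is_loc M i X"
      using lattice_exists[OF Xl mod_catD(2)[OF X]] by blast
    obtain L N f g where L: "L \<in> \<C>" and N: "N \<in> \<F>" and se: "short_exact \<Lambda> L f M g N"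
      using seq M by blast
    have f: "f \<in> mod_hom \<Lambda> L M" "inj_on f (carrier L)" and g: "g \<in> mod_hom \<Lambda> M N" "g ` carrier M = carrier N"
      and ker: "f ` carrier L = {x \<in> carrier M. g x = \<zero>\<^bsub>N\<^esub>}"
      using se by (simp_all add: short_exact_def a_kernel_def')
    have Lm: "L \<in> mod_cat \<Lambda>" and Nm: "N \<in> mod_cat \<Lambda>" using L N sub by auto
    have Ml: "left_module \<Lambda> M" and Ll: "left_module \<Lambda> L" and Nl: "left_module \<Lambda> N"
      using M Lm Nm mod_catD by auto
    interpret M: left_module \<Lambda> M by fact
    interpret L: left_module \<Lambda> L by fact
    interpret N: left_module \<Lambda> N by fact
    note i = is_loc_hom[OF loc] and f' = mod_homD[OF f(1)] and g' = mod_homD[OF g(1)]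
    have fL: "submodule (f ` carrier L) \<Lambda> M" by (rule submodule_image[OF Ll Ml f(1) L.submodule_carrier])
    let ?U = "i ` f ` carrier L"
    have U: "submodule ?U \<Lambda> (res X)" by (rule submodule_image[OF Ml resX is_locD(1)[OF loc] fL])
    \<comment> \<open>the \<open>A\<close>-submodule generated by the torsion part \<open>L\<close> of the lattice\<close>
    define X' where "X' = {x \<in> carrier X. \<exists>s\<in>nonzero. scale X s x \<in> ?U}"
    have X': "submodule X' A X" and UX': "\<And>x. x \<in> ?U \<Longrightarrow> x \<in> X'"
      using submodule_saturation[OF Xl U] unfolding X'_def by blast+
    note x' = X.submoduleD[OF X']
    have X'l: "left_module A (X \<restriction> X')" by (rule left_module_restr[OF Xl X'])
    have locL: "is_loc L (\<lambda>l. i (f l)) (X \<restriction> X')"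
      unfolding is_loc_def
    proof (intro conjI ballI impI)
      have "(\<lambda>l. i (f l)) \<in> mod_hom \<Lambda> L (res X \<restriction> X')"
        by (rule mod_hom_restr_codomain[OF mod_hom_compose[OF f(1) is_locD(1)[OF loc]]]) (use UX' in auto)
      then show "(\<lambda>l. i (f l)) \<in> mod_hom \<Lambda> L (res (X \<restriction> X'))" by (simp add: restrict_scalars_def)
    next
      fix n assume "n \<in> carrier (X \<restriction> X')"
      then show "\<exists>s\<in>nonzero. \<exists>m\<in>carrier L. scale (X \<restriction> X') s n = i (f m)" by (auto simp: X'_def)
    next
      fix l assume l: "l \<in> carrier L" "i (f l) = \<zero>\<^bsub>X \<restriction> X'\<^esub>"
      then have "i (f l) = \<zero>\<^bsub>X\<^esub>" by simp
      then obtain s where s: "s \<in> nonzero" "\<eta> s \<odot>\<^bsub>M\<^esub> f l = \<zero>\<^bsub>M\<^esub>"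
        using is_locD(3)[OF loc f'(1)[OF l(1)]] by blast
      have es: "\<eta> s \<in> carrier \<Lambda>" using s(1) eta_closed by simp
      have "f (\<eta> s \<odot>\<^bsub>L\<^esub> l) = f \<zero>\<^bsub>L\<^esub>" using f'(3)[OF es l(1)] s(2) mod_hom_zero[OF Ll Ml f(1)] by simp
      then have "\<eta> s \<odot>\<^bsub>L\<^esub> l = \<zero>\<^bsub>L\<^esub>" using inj_onD[OF f(2)] es l by simp
      then show "\<exists>s\<in>nonzero. \<eta> s \<odot>\<^bsub>L\<^esub> l = \<zero>\<^bsub>L\<^esub>" using s(1) by blast
    qed
    have X'm: "X \<restriction> X' \<in> mod_cat A"
      using X'l is_loc_finitely_generated[OF Ll X'l locL mod_catD(2)[OF Lm]] by (simp add: mod_cat_def)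
    then have X'C: "X \<restriction> X' \<in> loc_image \<C>" using L locL by (auto simp: loc_image_def)
    obtain Y q where Y: "Y \<in> mod_cat A" and q: "q \<in> mod_hom A X Y" "q ` carrier X = carrier Y"
      and kq: "\<And>x. x \<in> carrier X \<Longrightarrow> q x = \<zero>\<^bsub>Y\<^esub> \<longleftrightarrow> x \<in> X'"
      using quotient_mod_cat[OF Xl mod_catD(2)[OF X] X'] by blast
    note Yl = mod_catD(1)[OF Y]
    have resY: "left_module \<Lambda> (res Y)" by (rule left_module_eps[OF Yl])
    have qi: "(\<lambda>m. q (i m)) \<in> mod_hom \<Lambda> M (res Y)"
      by (rule mod_hom_compose[OF is_locD(1)[OF loc] mod_hom_eps[OF q(1)]])
    have qi0: "q (i m) = \<zero>\<^bsub>res Y\<^esub>" if m: "m \<in> carrier M" "g m = \<zero>\<^bsub>N\<^esub>" for m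
    proof -
      have "m \<in> f ` carrier L" using ker m by simp
      then show ?thesis using kq[OF i(1)[OF m(1)]] UX'[OF imageI] by simp
    qed
    obtain j where j: "j \<in> mod_hom \<Lambda> N (res Y)" "\<And>m. m \<in> carrier M \<Longrightarrow> j (g m) = q (i m)"
      using mod_hom_factor[OF Ml Nl resY g qi qi0] by blast
    \<comment> \<open>the quotient of \<open>X\<close> by \<open>X'\<close> is a localization of the torsion-free part \<open>N\<close>\<close>
    have locN: "is_loc N j Y"
      unfolding is_loc_def
    proof (intro conjI ballI impI)
      show "j \<in> mod_hom \<Lambda> N (res Y)" by (rule j(1))
    next
      fix y assume "y \<in> carrier Y"
      then obtain x where x: "x \<in> carrier X" "y = q x" using q(2) by (metis imageE)
      obtain s m where s: "s \<in> nonzero" "m \<in> carrier M" "scale X s x = i m" using is_locD(2)[OF loc x(1)] by blast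
      then have "scale Y s y = j (g m)" using scale_hom[OF Xl Yl q(1) _ x(1), of s] x(2) j(2) by simp
      then show "\<exists>s\<in>nonzero. \<exists>n\<in>carrier N. scale Y s y = j n" using s g'(1) by blast
    next
      fix n assume n: "n \<in> carrier N" "j n = \<zero>\<^bsub>Y\<^esub>"
      then obtain m where m: "m \<in> carrier M" "n = g m" using g(2) by (metis imageE)
      then have "i m \<in> X'" using n(2) j(2) kq i(1) by simp
      then obtain s l where s: "s \<in> nonzero" "l \<in> carrier L" "scale X s (i m) = i (f l)" unfolding X'_def by blast
      have es: "\<eta> s \<in> carrier \<Lambda>" "s \<in> carrier R" using s(1) eta_closed by auto
      have c: "\<eta> s \<odot>\<^bsub>M\<^esub> m \<in> carrier M" "f l \<in> carrier M" using es m f'(1) s by auto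
      have "i (\<eta> s \<odot>\<^bsub>M\<^esub> m) = i (f l)" using i(4)[OF es(2) m(1)] s(3) by simp
      then have "i (\<eta> s \<odot>\<^bsub>M\<^esub> m \<ominus>\<^bsub>M\<^esub> f l) = \<zero>\<^bsub>X\<^esub>"
        using mod_hom_minus[OF Ml resX is_locD(1)[OF loc] c] left_module.diff_eq_zero_iff[OF resX] i(1) c by simp
      then obtain t where t: "t \<in> nonzero" "\<eta> t \<odot>\<^bsub>M\<^esub> (\<eta> s \<odot>\<^bsub>M\<^esub> m \<ominus>\<^bsub>M\<^esub> f l) = \<zero>\<^bsub>M\<^esub>"
        using is_locD(3)[OF loc, of "\<eta> s \<odot>\<^bsub>M\<^esub> m \<ominus>\<^bsub>M\<^esub> f l"] c by auto
      have et: "\<eta> t \<in> carrier \<Lambda>" "t \<in> carrier R" using t(1) eta_closed by auto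
      have "\<eta> t \<odot>\<^bsub>M\<^esub> (\<eta> s \<odot>\<^bsub>M\<^esub> m) = \<eta> t \<odot>\<^bsub>M\<^esub> f l"
        using t(2) M.smult_diff[OF et(1) c] M.diff_eq_zero_iff et c by simp
      then have "\<eta> t \<odot>\<^bsub>N\<^esub> (\<eta> s \<odot>\<^bsub>N\<^esub> n) = \<eta> t \<odot>\<^bsub>N\<^esub> g (f l)"
        using g'(3)[OF et(1) c(1)] g'(3)[OF es(1) m(1)] g'(3)[OF et(1) c(2)] m(2) by simp
      also have "g (f l) = \<zero>\<^bsub>N\<^esub>" using ker s(2) by blast
      finally have "\<eta> (t \<otimes>\<^bsub>R\<^esub> s) \<odot>\<^bsub>N\<^esub> n = \<zero>\<^bsub>N\<^esub>" using eta_mult_smult(1)[OF Nl et(2) es(2) n(1)] et by simp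
      then show "\<exists>s\<in>nonzero. \<eta> s \<odot>\<^bsub>N\<^esub> n = \<zero>\<^bsub>N\<^esub>" using nonzero_mult[OF t(1) s(1)] by blast
    qed
    have "hom_vanishes A Z Y" if Z: "Z \<in> loc_image \<C>" for Z
    proof -
      obtain M1 j1 where M1: "M1 \<in> \<C>" "is_loc M1 j1 Z" and Zm: "Z \<in> mod_cat A" using Z by (auto simp: loc_image_def)
      have M1m: "M1 \<in> mod_cat \<Lambda>" using M1 sub by auto
      have "hom_vanishes \<Lambda> M1 N" using perp M1(1) N by simp
      then have "hom_vanishes \<Lambda> M1 (res Y)"
        by (rule hom_vanishes_localization[OF mod_catD[OF M1m] mod_catD[OF Nm] Yl locN])
      then show ?thesis using hom_vanishes_is_loc_iff[OF mod_catD(1)[OF M1m] mod_catD(1)[OF Zm] Yl M1(2)] by simp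
    qed
    then have YF: "Y \<in> ?F" using Y by simp
    have "short_exact A (X \<restriction> X') (\<lambda>x. x) X q Y"
      unfolding short_exact_def
    proof (intro conjI)
      show "(\<lambda>x. x) \<in> mod_hom A (X \<restriction> X') X" by (rule mod_hom_inclusion[OF x'(1)])
      show "(\<lambda>x. x) ` carrier (X \<restriction> X') = a_kernel X Y q" using kq x'(1) by (auto simp: a_kernel_def')
    qed (use q in simp_all)
    then show "\<exists>L\<in>loc_image \<C>. \<exists>N\<in>?F. \<exists>f g. short_exact A L f X g N" using X'C YF by blast
  qed
  then show ?thesis by (auto simp: tors_def torsion_classes_def)
qed

lemma zero_cat_subset_tors:
  assumes "\<D> \<in> tors A" shows "zero_cat A \<subseteq> \<D>"
proof -
  obtain \<F> where tp: "torsion_pair A (mod_cat A) \<D> \<F>" using assms by (auto simp: tors_def torsion_classes_def)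
  have F: "\<F> \<subseteq> mod_cat A" using tp by (simp add: torsion_pair_def is_subcategory_def)
  note perp = torsion_pair_perp[OF tp mod_catD(1)]
  show ?thesis
  proof
    fix M assume "M \<in> zero_cat A"
    then have M: "M \<in> mod_cat A" "carrier M = {\<zero>\<^bsub>M\<^esub>}" by (simp_all add: zero_cat_def)
    have "hom_vanishes A M N" if "N \<in> \<F>" for N
      using hom_vanishes_zero_module[OF mod_catD(1)[OF M(1)] _ M(2)] F that mod_catD(1) by auto
    then show "M \<in> \<D>" using perp M(1) by simp
  qed
qed

text \<open>The preimage of a torsion class \<open>\<D>\<close> of \<open>A\<close> in the interval of \<open>\<T>\<close>: the modules of the closure
  of \<open>\<T>\<close> with localization in \<open>\<D>\<close>, described by vanishing of homomorphisms.\<close>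

lemma loc_image_surj:
  assumes T: "\<T> \<in> tors_fl \<Lambda>" and D: "\<D> \<in> tors A" "\<D> \<subseteq> loc_image (fl_closure \<Lambda> \<T>)"
  obtains \<C> where "\<C> \<in> tors_interval \<Lambda> \<T> (fl_closure \<Lambda> \<T>)" "loc_image \<C> = \<D>"
proof -
  obtain \<F> where tp: "torsion_pair \<Lambda> (fl_cat \<Lambda>) \<T> \<F>" using T by (auto simp: tors_fl_def torsion_classes_def)
  obtain \<G> where tpA: "torsion_pair A (mod_cat A) \<D> \<G>" using D(1) by (auto simp: tors_def torsion_classes_def)
  note perp = torsion_pair_perp[OF tp fl_catD(3)] and perpA = torsion_pair_perp[OF tpA mod_catD(1)]
    and clos = fl_closure_perp[OF tp]
  have "\<F> \<subseteq> fl_cat \<Lambda>" "\<G> \<subseteq> mod_cat A" using tp tpA by (simp_all add: torsion_pair_def is_subcategory_def)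
  then have F: "N \<in> \<F> \<Longrightarrow> left_module \<Lambda> N" and G: "Y \<in> \<G> \<Longrightarrow> left_module A Y" for N Y
    using fl_catD(3)[of N] mod_catD(1)[of Y A] by auto
  have rG: "\<And>Y. Y \<in> \<G> \<Longrightarrow> left_module \<Lambda> (res Y)" using left_module_eps[OF G] .
  define Q where "Q M \<longleftrightarrow> (\<forall>N\<in>\<F>. hom_vanishes \<Lambda> M N) \<and> (\<forall>Y\<in>\<G>. hom_vanishes \<Lambda> M (res Y))"
    for M :: "('l, 'l list set) module"
  let ?C = "{M \<in> mod_cat \<Lambda>. Q M}"
  have "?C \<in> tors \<Lambda>"
  proof (rule torsion_classI)
    show "noetherian_mod \<Lambda> M" if "M \<in> mod_cat \<Lambda>" for M
      by (rule noetherian_over_algebra[OF mod_catD[OF that]])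
    show "Q N" if "mod_iso \<Lambda> M N" "Q M" for M N
      unfolding Q_def
    proof (intro conjI ballI)
      show "hom_vanishes \<Lambda> N Y" if "Y \<in> \<F>" for Y
        by (rule hom_vanishes_iso[OF _ \<open>mod_iso \<Lambda> M N\<close>]) (use \<open>Q M\<close> that in \<open>simp add: Q_def\<close>)
      show "hom_vanishes \<Lambda> N (res Y)" if "Y \<in> \<G>" for Y
        by (rule hom_vanishes_iso[OF _ \<open>mod_iso \<Lambda> M N\<close>]) (use \<open>Q M\<close> that in \<open>simp add: Q_def\<close>)
    qed
    show "Q M" if "M \<in> mod_cat \<Lambda>" "carrier M = {\<zero>\<^bsub>M\<^esub>}" for M
      unfolding Q_def
    proof (intro conjI ballI)
      show "hom_vanishes \<Lambda> M Y" if "Y \<in> \<F>" for Y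
        by (rule hom_vanishes_zero_module[OF mod_catD(1)[OF \<open>M \<in> mod_cat \<Lambda>\<close>] F[OF that] \<open>carrier M = _\<close>])
      show "hom_vanishes \<Lambda> M (res Y)" if "Y \<in> \<G>" for Y
        by (rule hom_vanishes_zero_module[OF mod_catD(1)[OF \<open>M \<in> mod_cat \<Lambda>\<close>] rG[OF that] \<open>carrier M = _\<close>])
    qed
  next
    fix X M N f g
    assume X: "X \<in> mod_cat \<Lambda>" and M: "M \<in> mod_cat \<Lambda>" and N: "N \<in> mod_cat \<Lambda>"
      and fg: "f \<in> mod_hom \<Lambda> X N" "g \<in> mod_hom \<Lambda> M N" "g ` carrier M = carrier N"
      and Q: "Q X" "Q (M \<restriction> {x \<in> carrier M. g x = \<zero>\<^bsub>N\<^esub>})"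
    note ext = hom_vanishes_ext[OF mod_catD(1)[OF M] mod_catD(1)[OF N] mod_catD(1)[OF X] _ fg]
    show "Q (M \<restriction> {x \<in> carrier M. g x \<in> f ` carrier X})"
      unfolding Q_def
    proof (intro conjI ballI)
      fix Y assume "Y \<in> \<F>"
      then show "hom_vanishes \<Lambda> (M \<restriction> {x \<in> carrier M. g x \<in> f ` carrier X}) Y"
        using ext[OF F] Q unfolding Q_def by blast
    next
      fix Y assume "Y \<in> \<G>"
      then show "hom_vanishes \<Lambda> (M \<restriction> {x \<in> carrier M. g x \<in> f ` carrier X}) (res Y)"
        using ext[OF rG] Q unfolding Q_def by blast
    qed
  qed
  moreover have "\<T> \<subseteq> ?C"
  proof
    fix M assume "M \<in> \<T>"
    then have M: "M \<in> fl_cat \<Lambda>" "\<And>N. N \<in> \<F> \<Longrightarrow> hom_vanishes \<Lambda> M N" using perp by simp_all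
    have "f x = \<zero>\<^bsub>Y\<^esub>" if Y: "Y \<in> \<G>" and f: "f \<in> mod_hom \<Lambda> M (res Y)" and x: "x \<in> carrier M" for Y f x
    proof -
      obtain s where s: "s \<in> nonzero" "\<eta> s \<odot>\<^bsub>M\<^esub> x = \<zero>\<^bsub>M\<^esub>"
        using fl_catD(2)[OF M(1)] x unfolding R_torsion_def by blast
      have "scale Y s (f x) = f (\<eta> s \<odot>\<^bsub>M\<^esub> x)" using mod_homD(3)[OF f eta_closed x] s(1) by simp
      also have "\<dots> = \<zero>\<^bsub>Y\<^esub>" using s(2) mod_hom_zero[OF fl_catD(3)[OF M(1)] rG[OF Y] f] by simp
      finally show ?thesis using scale_eq_zero[OF G[OF Y] s(1)] mod_homD(1)[OF f x] by simp
    qed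
    then have "Q M" using M(2) by (simp add: Q_def hom_vanishes_def)
    then show "M \<in> ?C" using fl_catD(1)[OF M(1)] by simp
  qed
  moreover have "?C \<subseteq> fl_closure \<Lambda> \<T>" using clos by (auto simp: Q_def)
  moreover have "loc_image ?C = \<D>"
  proof (intro equalityI subsetI)
    fix N assume "N \<in> loc_image ?C"
    then obtain M j where M: "M \<in> mod_cat \<Lambda>" "Q M" "is_loc M j N" and N: "N \<in> mod_cat A"
      by (auto simp: loc_image_def)
    have "hom_vanishes A N Y" if Y: "Y \<in> \<G>" for Y
      using hom_vanishes_is_loc_iff[OF mod_catD(1)[OF M(1)] mod_catD(1)[OF N] G[OF Y] M(3)] M(2) Y
      by (simp add: Q_def)
    then show "N \<in> \<D>" using perpA N by simp
  next
    fix N assume ND: "N \<in> \<D>"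
    then have N: "N \<in> mod_cat A" "\<And>Y. Y \<in> \<G> \<Longrightarrow> hom_vanishes A N Y" using perpA by simp_all
    obtain M j where M: "M \<in> fl_closure \<Lambda> \<T>" "is_loc M j N" using D(2) ND by (auto simp: loc_image_def)
    have Mm: "M \<in> mod_cat \<Lambda>" "\<And>N. N \<in> \<F> \<Longrightarrow> hom_vanishes \<Lambda> M N" using clos M(1) by simp_all
    have "hom_vanishes \<Lambda> M (res Y)" if Y: "Y \<in> \<G>" for Y
      using hom_vanishes_is_loc_iff[OF mod_catD(1)[OF Mm(1)] mod_catD(1)[OF N(1)] G[OF Y] M(2)] N(2)[OF Y] by simp
    then have "M \<in> ?C" using Mm by (simp add: Q_def)
    then show "N \<in> loc_image ?C" using N(1) M(2) by (auto simp: loc_image_def)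
  qed
  ultimately show thesis using that by (auto simp: tors_interval_def)
qed

end

text \<open>Localizations of finitely generated modules exist, with carrier in the type chosen for the
  category of finitely generated \<open>A\<close>-modules.\<close>

locale order_localization_exists = order_localization +
  assumes localization_exists: "M \<in> mod_cat \<Lambda> \<Longrightarrow> \<exists>N\<in>mod_cat A. \<exists>j. is_loc M j N"
begin

text \<open>The image \<open>I\<close> of a homomorphism from a member of \<open>\<C>1\<close> to a torsion-free module for \<open>\<C>2\<close> has
  localization zero, so it is a finite length factor module of a member of \<open>\<C>1\<close>.\<close>

lemma loc_image_reflects:
  assumes C1: "\<C>1 \<in> tors \<Lambda>" and C2: "\<C>2 \<in> tors \<Lambda>"
    and fl: "\<C>1 \<inter> fl_cat \<Lambda> \<subseteq> \<C>2" and im: "loc_image \<C>1 \<subseteq> loc_image \<C>2"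
  shows "\<C>1 \<subseteq> \<C>2"
proof
  fix M assume MC: "M \<in> \<C>1"
  obtain \<F>1 where tp1: "torsion_pair \<Lambda> (mod_cat \<Lambda>) \<C>1 \<F>1" using C1 by (auto simp: tors_def torsion_classes_def)
  obtain \<F>2 where tp2: "torsion_pair \<Lambda> (mod_cat \<Lambda>) \<C>2 \<F>2" using C2 by (auto simp: tors_def torsion_classes_def)
  note perp2 = torsion_pair_perp[OF tp2 mod_catD(1)]
  have sub: "\<C>1 \<subseteq> mod_cat \<Lambda>" "\<C>2 \<subseteq> mod_cat \<Lambda>" "\<F>2 \<subseteq> mod_cat \<Lambda>"
    using tp1 tp2 by (simp_all add: torsion_pair_def is_subcategory_def)
  have M: "M \<in> mod_cat \<Lambda>" using MC sub by auto
  note Ml = mod_catD(1)[OF M]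
  obtain X j where X: "X \<in> mod_cat A" "is_loc M j X" using localization_exists[OF M] by blast
  then have "X \<in> loc_image \<C>2" using MC im by (auto simp: loc_image_def)
  then obtain M2 j2 where M2: "M2 \<in> \<C>2" "is_loc M2 j2 X" by (auto simp: loc_image_def)
  have M2m: "M2 \<in> mod_cat \<Lambda>" using M2 sub by auto
  have "f x = \<zero>\<^bsub>N\<^esub>" if N: "N \<in> \<F>2" and f: "f \<in> mod_hom \<Lambda> M N" and x: "x \<in> carrier M" for N f x
  proof -
    have Nm: "N \<in> mod_cat \<Lambda>" using N sub by auto
    let ?I = "N \<restriction> f ` carrier M"
    note I = image_in_mod_cat[OF M Nm f]
    have sub': "f ` carrier M \<subseteq> carrier N" using mod_homD(1)[OF f] by auto
    obtain Y k where Y: "Y \<in> mod_cat A" "is_loc ?I k Y" using localization_exists[OF I(1)] by blast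
    note Yl = mod_catD(1)[OF Y(1)]
    have "hom_vanishes \<Lambda> M2 N" using perp2 M2(1) N by simp
    then have "hom_vanishes \<Lambda> M2 ?I" by (rule hom_vanishes_submodule[OF _ sub'])
    then have "hom_vanishes \<Lambda> M2 (res Y)"
      by (rule hom_vanishes_localization[OF mod_catD[OF M2m] mod_catD[OF I(1)] Yl Y(2)])
    then have van: "hom_vanishes \<Lambda> M (res Y)"
      using hom_vanishes_is_loc_iff[OF mod_catD(1)[OF M2m] mod_catD(1)[OF X(1)] Yl M2(2)]
        hom_vanishes_is_loc_iff[OF Ml mod_catD(1)[OF X(1)] Yl X(2)] by simp
    have "\<exists>s\<in>nonzero. \<eta> s \<odot>\<^bsub>?I\<^esub> y = \<zero>\<^bsub>?I\<^esub>" if y: "y \<in> carrier ?I" for y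
    proof -
      obtain m where m: "m \<in> carrier M" "y = f m" using y by auto
      have "k y = \<zero>\<^bsub>Y\<^esub>"
        using hom_vanishesD[OF van mod_hom_compose[OF I(2) is_locD(1)[OF Y(2)]] m(1)] m(2) by simp
      then show ?thesis using is_locD(3)[OF Y(2) y] by blast
    qed
    then have "?I \<in> fl_cat \<Lambda>" using fl_cat_eq I(1) by (simp add: R_torsion_def)
    moreover have "M \<in> fl_closure \<Lambda> (\<C>1 \<inter> fl_cat \<Lambda>)" using tors_restrict_fl(2)[OF C1] MC by auto
    ultimately have "?I \<in> \<C>2" using I(3) fl by (auto simp: fl_closure_def)
    then have "hom_vanishes \<Lambda> ?I N" using perp2 N by simp
    from hom_vanishesD[OF this mod_hom_inclusion[OF sub'], of "f x"] show ?thesis using x by simp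
  qed
  then show "M \<in> \<C>2" using perp2 M by (simp add: hom_vanishes_def)
qed

lemma loc_image_bij_betw:
  "bij_betw (\<lambda>(\<T>, \<C>). (\<T>, loc_image \<C>))
      (SIGMA \<T>:tors_fl \<Lambda>. tors_interval \<Lambda> \<T> (fl_closure \<Lambda> \<T>))
      (SIGMA \<T>:tors_fl \<Lambda>. tors_interval A (zero_cat A) (loc_image (fl_closure \<Lambda> \<T>)))"
    (is "bij_betw ?K ?S ?S'")
proof (rule bij_betw_imageI)
  show "inj_on ?K ?S"
  proof (rule inj_onI)
    fix p p' assume "p \<in> ?S" "p' \<in> ?S" "?K p = ?K p'"
    then obtain \<T> \<C>1 \<C>2 where p: "p = (\<T>, \<C>1)" "p' = (\<T>, \<C>2)" and T: "\<T> \<in> tors_fl \<Lambda>"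
      and C1: "\<C>1 \<in> tors_interval \<Lambda> \<T> (fl_closure \<Lambda> \<T>)"
      and C2: "\<C>2 \<in> tors_interval \<Lambda> \<T> (fl_closure \<Lambda> \<T>)" and eq: "loc_image \<C>1 = loc_image \<C>2"
      by auto
    have t: "\<C>1 \<in> tors \<Lambda>" "\<C>2 \<in> tors \<Lambda>" using C1 C2 by (simp_all add: tors_interval_def)
    have fl: "\<C>1 \<inter> fl_cat \<Lambda> = \<C>2 \<inter> fl_cat \<Lambda>"
      using interval_member_fl[OF T C1] interval_member_fl[OF T C2] by simp
    have "\<C>1 = \<C>2"
    proof
      show "\<C>1 \<subseteq> \<C>2" by (rule loc_image_reflects[OF t]) (use fl eq in auto)
      show "\<C>2 \<subseteq> \<C>1" by (rule loc_image_reflects[OF t(2,1)]) (use fl eq in auto)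
    qed
    then show "p = p'" using p by simp
  qed
  show "?K ` ?S = ?S'"
  proof (intro equalityI subsetI)
    fix p assume "p \<in> ?K ` ?S"
    then obtain \<T> \<C> where p: "p = (\<T>, loc_image \<C>)" "\<T> \<in> tors_fl \<Lambda>"
      "\<C> \<in> tors \<Lambda>" "\<C> \<subseteq> fl_closure \<Lambda> \<T>" by (auto simp: tors_interval_def)
    have "loc_image \<C> \<subseteq> loc_image (fl_closure \<Lambda> \<T>)" using p(4) by (auto simp: loc_image_def)
    then show "p \<in> ?S'"
      using p(1,2) loc_image_tors[OF p(3)] zero_cat_subset_tors[OF loc_image_tors[OF p(3)]]
      by (simp add: tors_interval_def)
  next
    fix p assume "p \<in> ?S'"
    then obtain \<T> \<D> where p: "p = (\<T>, \<D>)" "\<T> \<in> tors_fl \<Lambda>" "\<D> \<in> tors A" "\<D> \<subseteq> loc_image (fl_closure \<Lambda> \<T>)"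
      by (auto simp: tors_interval_def)
    obtain \<C> where "\<C> \<in> tors_interval \<Lambda> \<T> (fl_closure \<Lambda> \<T>)" "loc_image \<C> = \<D>"
      using loc_image_surj[OF p(2-4)] by blast
    then show "p \<in> ?K ` ?S" using p(1,2) by force
  qed
qed

end

section \<open>The tensor product with the field of fractions\<close>

text \<open>The base change of the algebra and of its modules along \<open>\<iota> : R \<rightarrow> K\<close>.\<close>

locale fraction_field_base_change = dim_one_order R \<Lambda> \<eta>
  for R :: "('r, 'c) ring_scheme" (structure) and \<Lambda> :: "('l, 'e) ring_scheme" (structure) and \<eta> +
  fixes K :: "('k, 'd) ring_scheme" and \<iota> :: "'r \<Rightarrow> 'k"
  assumes frac: "fraction_field R K \<iota>"
begin

sublocale K: field K
  using frac by (simp add: fraction_field_def)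

lemma iota_hom: "\<iota> \<in> ring_hom R K"
  using frac by (simp add: fraction_field_def)

lemmas iota_closed = ring_hom_memE(1)[OF iota_hom]
  and iota_mult = ring_hom_memE(2)[OF iota_hom]
  and iota_add = ring_hom_memE(3)[OF iota_hom]

lemma iota_zero: "\<iota> \<zero>\<^bsub>R\<^esub> = \<zero>\<^bsub>K\<^esub>"
  by (rule ring_hom_zero[OF iota_hom R.ring_axioms K.ring_axioms])

lemma iota_inj: "a \<in> carrier R \<Longrightarrow> b \<in> carrier R \<Longrightarrow> \<iota> a = \<iota> b \<longleftrightarrow> a = b"
  using frac inj_on_eq_iff[of \<iota> "carrier R" a b] by (simp add: fraction_field_def)

lemma iota_inverse:
  assumes "s \<in> nonzero"
  obtains u where "u \<in> carrier K" "\<iota> s \<otimes>\<^bsub>K\<^esub> u = \<one>\<^bsub>K\<^esub>"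
proof -
  have "\<iota> s \<noteq> \<zero>\<^bsub>K\<^esub>" using assms iota_inj[of s "\<zero>\<^bsub>R\<^esub>"] iota_zero by simp
  then have "\<iota> s \<in> Units K" using assms iota_closed K.field_Units by simp
  then show thesis using that[of "inv\<^bsub>K\<^esub> \<iota> s"] by simp
qed

lemma fraction:
  assumes "k \<in> carrier K"
  obtains a b u where "a \<in> carrier R" "b \<in> nonzero" "u \<in> carrier K" "\<iota> b \<otimes>\<^bsub>K\<^esub> u = \<one>\<^bsub>K\<^esub>"
    "k = \<iota> a \<otimes>\<^bsub>K\<^esub> u"
proof -
  obtain a b where ab: "a \<in> carrier R" "b \<in> nonzero" "k = \<iota> a \<otimes>\<^bsub>K\<^esub> inv\<^bsub>K\<^esub> (\<iota> b)"
    using frac assms unfolding fraction_field_def by blast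
  have "\<iota> b \<noteq> \<zero>\<^bsub>K\<^esub>" using ab(2) iota_inj[of b "\<zero>\<^bsub>R\<^esub>"] iota_zero by simp
  then have "\<iota> b \<in> Units K" using ab(2) iota_closed K.field_Units by simp
  then show thesis using that[OF ab(1,2), of "inv\<^bsub>K\<^esub> \<iota> b"] ab(3) by simp
qed

lemma common_denominator:
  assumes "k \<in> carrier K" "k' \<in> carrier K"
  obtains u s a a' where "u \<in> carrier K" "s \<in> nonzero" "a \<in> carrier R" "a' \<in> carrier R"
    "\<iota> s \<otimes>\<^bsub>K\<^esub> u = \<one>\<^bsub>K\<^esub>" "k = \<iota> a \<otimes>\<^bsub>K\<^esub> u" "k' = \<iota> a' \<otimes>\<^bsub>K\<^esub> u"
proof -
  obtain a b u where 1: "a \<in> carrier R" "b \<in> nonzero" "u \<in> carrier K" "\<iota> b \<otimes>\<^bsub>K\<^esub> u = \<one>\<^bsub>K\<^esub>" "k = \<iota> a \<otimes>\<^bsub>K\<^esub> u"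
    using fraction[OF assms(1)] by blast
  obtain a' b' u' where 2: "a' \<in> carrier R" "b' \<in> nonzero" "u' \<in> carrier K" "\<iota> b' \<otimes>\<^bsub>K\<^esub> u' = \<one>\<^bsub>K\<^esub>" "k' = \<iota> a' \<otimes>\<^bsub>K\<^esub> u'"
    using fraction[OF assms(2)] by blast
  have c: "\<iota> a \<in> carrier K" "\<iota> a' \<in> carrier K" "\<iota> b \<in> carrier K" "\<iota> b' \<in> carrier K"
    using 1 2 iota_closed by auto
  have "\<iota> (b \<otimes>\<^bsub>R\<^esub> b') \<otimes>\<^bsub>K\<^esub> (u \<otimes>\<^bsub>K\<^esub> u') = (\<iota> b \<otimes>\<^bsub>K\<^esub> u) \<otimes>\<^bsub>K\<^esub> (\<iota> b' \<otimes>\<^bsub>K\<^esub> u')"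
    using 1(2,3) 2(2,3) c by (simp add: iota_mult K.m_ac)
  moreover have "\<iota> (a \<otimes>\<^bsub>R\<^esub> b') \<otimes>\<^bsub>K\<^esub> (u \<otimes>\<^bsub>K\<^esub> u') = (\<iota> a \<otimes>\<^bsub>K\<^esub> u) \<otimes>\<^bsub>K\<^esub> (\<iota> b' \<otimes>\<^bsub>K\<^esub> u')"
    using 1(1,3) 2(2,3) c by (simp add: iota_mult K.m_ac)
  moreover have "\<iota> (a' \<otimes>\<^bsub>R\<^esub> b) \<otimes>\<^bsub>K\<^esub> (u \<otimes>\<^bsub>K\<^esub> u') = (\<iota> a' \<otimes>\<^bsub>K\<^esub> u') \<otimes>\<^bsub>K\<^esub> (\<iota> b \<otimes>\<^bsub>K\<^esub> u)"
    using 1(2,3) 2(1,3) c by (simp add: iota_mult K.m_ac)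
  ultimately show thesis
    using that[of "u \<otimes>\<^bsub>K\<^esub> u'" "b \<otimes>\<^bsub>R\<^esub> b'" "a \<otimes>\<^bsub>R\<^esub> b'" "a' \<otimes>\<^bsub>R\<^esub> b"] 1 2 c nonzero_mult[OF 1(2) 2(2)] by simp
qed

subsection \<open>The kernel of the presentation\<close>

text \<open>The group \<open>K \<otimes>\<^sub>R M\<close> is the quotient of the group \<open>frags M\<close> of formal sums by the subgroup
  \<open>ker M\<close>, which is generated by the bilinearity relations \<open>rels M\<close>.\<close>

abbreviation frags :: "('l, 'a) module \<Rightarrow> ('k \<times> 'a \<Rightarrow>\<^sub>0 int) monoid" where
  "frags M \<equiv> free_Abelian_group (carrier K \<times> carrier M)"

abbreviation rels :: "('l, 'a) module \<Rightarrow> ('k \<times> 'a \<Rightarrow>\<^sub>0 int) set" where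
  "rels M \<equiv> tensor_relations R (restrict_scalars \<iota> (regular_module K)) (restrict_scalars \<eta> M)"

abbreviation ker :: "('l, 'a) module \<Rightarrow> ('k \<times> 'a \<Rightarrow>\<^sub>0 int) set" where
  "ker M \<equiv> tensor_kernel R (restrict_scalars \<iota> (regular_module K)) (restrict_scalars \<eta> M)"

lemma rels_iff:
  "x \<in> rels M \<longleftrightarrow>
    (\<exists>k k' m. x = frag_of (k \<oplus>\<^bsub>K\<^esub> k', m) - frag_of (k, m) - frag_of (k', m) \<and>
      k \<in> carrier K \<and> k' \<in> carrier K \<and> m \<in> carrier M) \<or>
    (\<exists>k m m'. x = frag_of (k, m \<oplus>\<^bsub>M\<^esub> m') - frag_of (k, m) - frag_of (k, m') \<and>
      k \<in> carrier K \<and> m \<in> carrier M \<and> m' \<in> carrier M) \<or>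
    (\<exists>r k m. x = frag_of (\<iota> r \<otimes>\<^bsub>K\<^esub> k, m) - frag_of (k, \<eta> r \<odot>\<^bsub>M\<^esub> m) \<and>
      r \<in> carrier R \<and> k \<in> carrier K \<and> m \<in> carrier M)"
  by (simp add: tensor_relations_def)

lemma keys_frag_diff2:
  "a \<in> S \<Longrightarrow> b \<in> S \<Longrightarrow> Poly_Mapping.keys (frag_of a - frag_of b :: 'x \<Rightarrow>\<^sub>0 int) \<subseteq> S"
  using keys_diff[of "frag_of a" "frag_of b :: 'x \<Rightarrow>\<^sub>0 int"] by (auto simp: keys_frag_of)

lemma keys_frag_diff3:
  "a \<in> S \<Longrightarrow> b \<in> S \<Longrightarrow> c \<in> S \<Longrightarrow>
    Poly_Mapping.keys (frag_of a - frag_of b - frag_of c :: 'x \<Rightarrow>\<^sub>0 int) \<subseteq> S"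
  using keys_diff[of "frag_of a - frag_of b" "frag_of c :: 'x \<Rightarrow>\<^sub>0 int"] keys_frag_diff2[of a S b]
  by (auto simp: keys_frag_of)

lemma rels_carrier:
  assumes M: "left_module \<Lambda> M"
  shows "rels M \<subseteq> carrier (frags M)"
proof
  interpret M: left_module \<Lambda> M by fact
  fix x assume "x \<in> rels M"
  then consider (1) k k' m where "x = frag_of (k \<oplus>\<^bsub>K\<^esub> k', m) - frag_of (k, m) - frag_of (k', m)"
      "k \<in> carrier K" "k' \<in> carrier K" "m \<in> carrier M"
    | (2) k m m' where "x = frag_of (k, m \<oplus>\<^bsub>M\<^esub> m') - frag_of (k, m) - frag_of (k, m')"
      "k \<in> carrier K" "m \<in> carrier M" "m' \<in> carrier M"
    | (3) r k m where "x = frag_of (\<iota> r \<otimes>\<^bsub>K\<^esub> k, m) - frag_of (k, \<eta> r \<odot>\<^bsub>M\<^esub> m)"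
      "r \<in> carrier R" "k \<in> carrier K" "m \<in> carrier M"
    unfolding rels_iff by blast
  then show "x \<in> carrier (frags M)"
  proof cases
    case 1
    then show ?thesis using keys_frag_diff3[of "(k \<oplus>\<^bsub>K\<^esub> k', m)" "carrier K \<times> carrier M"] by simp
  next
    case 2
    then show ?thesis using keys_frag_diff3[of "(k, m \<oplus>\<^bsub>M\<^esub> m')" "carrier K \<times> carrier M"] by simp
  next
    case 3
    then show ?thesis
      using keys_frag_diff2[of "(\<iota> r \<otimes>\<^bsub>K\<^esub> k, m)" "carrier K \<times> carrier M" "(k, \<eta> r \<odot>\<^bsub>M\<^esub> m)"]
        iota_closed eta_closed by simp
  qed
qed

lemma ker_eq: "ker M = generate (frags M) (rels M)"
  by (simp add: tensor_kernel_def)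

lemma subgroup_ker: "left_module \<Lambda> M \<Longrightarrow> subgroup (ker M) (frags M)"
  unfolding ker_eq by (rule group.generate_is_subgroup[OF group_free_Abelian_group rels_carrier])

lemma
  assumes M: "left_module \<Lambda> M"
  shows ker_keys: "x \<in> ker M \<Longrightarrow> Poly_Mapping.keys x \<subseteq> carrier K \<times> carrier M"
    and ker_zero: "0 \<in> ker M"
    and ker_add: "x \<in> ker M \<Longrightarrow> y \<in> ker M \<Longrightarrow> x + y \<in> ker M"
    and ker_uminus: "x \<in> ker M \<Longrightarrow> - x \<in> ker M"
proof -
  interpret S: subgroup "ker M" "frags M" by (rule subgroup_ker[OF M])
  show k: "x \<in> ker M \<Longrightarrow> Poly_Mapping.keys x \<subseteq> carrier K \<times> carrier M" for x
    using S.mem_carrier[of x] by simp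
  show "0 \<in> ker M" using S.one_closed by simp
  show "x \<in> ker M \<Longrightarrow> y \<in> ker M \<Longrightarrow> x + y \<in> ker M" using S.m_closed[of x y] by simp
  show "x \<in> ker M \<Longrightarrow> - x \<in> ker M" using S.m_inv_closed[of x] k[of x] by simp
qed

lemma ker_diff: "left_module \<Lambda> M \<Longrightarrow> x \<in> ker M \<Longrightarrow> y \<in> ker M \<Longrightarrow> x - y \<in> ker M"
  using ker_add[of M x "- y"] ker_uminus[of M y] by simp

lemma ker_rel: "x \<in> rels M \<Longrightarrow> x \<in> ker M"
  unfolding ker_eq by (rule generate.incl)

lemma ker_left:
  "k \<in> carrier K \<Longrightarrow> k' \<in> carrier K \<Longrightarrow> m \<in> carrier M \<Longrightarrow>
    frag_of (k \<oplus>\<^bsub>K\<^esub> k', m) - frag_of (k, m) - frag_of (k', m) \<in> ker M"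
  by (rule ker_rel) (unfold rels_iff, blast)

lemma ker_right:
  "k \<in> carrier K \<Longrightarrow> m \<in> carrier M \<Longrightarrow> m' \<in> carrier M \<Longrightarrow>
    frag_of (k, m \<oplus>\<^bsub>M\<^esub> m') - frag_of (k, m) - frag_of (k, m') \<in> ker M"
  by (rule ker_rel) (unfold rels_iff, blast)

lemma ker_scalar:
  "r \<in> carrier R \<Longrightarrow> k \<in> carrier K \<Longrightarrow> m \<in> carrier M \<Longrightarrow>
    frag_of (\<iota> r \<otimes>\<^bsub>K\<^esub> k, m) - frag_of (k, \<eta> r \<odot>\<^bsub>M\<^esub> m) \<in> ker M"
  by (rule ker_rel) (unfold rels_iff, blast)

lemma ker_induct [consumes 2, case_names zero left right scalar uminus add]:
  assumes M: "left_module \<Lambda> M" and x: "x \<in> ker M"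
    and zero: "P 0"
    and left: "\<And>k k' m. k \<in> carrier K \<Longrightarrow> k' \<in> carrier K \<Longrightarrow> m \<in> carrier M \<Longrightarrow>
      P (frag_of (k \<oplus>\<^bsub>K\<^esub> k', m) - frag_of (k, m) - frag_of (k', m))"
    and right: "\<And>k m m'. k \<in> carrier K \<Longrightarrow> m \<in> carrier M \<Longrightarrow> m' \<in> carrier M \<Longrightarrow>
      P (frag_of (k, m \<oplus>\<^bsub>M\<^esub> m') - frag_of (k, m) - frag_of (k, m'))"
    and scalar: "\<And>r k m. r \<in> carrier R \<Longrightarrow> k \<in> carrier K \<Longrightarrow> m \<in> carrier M \<Longrightarrow>
      P (frag_of (\<iota> r \<otimes>\<^bsub>K\<^esub> k, m) - frag_of (k, \<eta> r \<odot>\<^bsub>M\<^esub> m))"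
    and uminus: "\<And>x. x \<in> ker M \<Longrightarrow> P x \<Longrightarrow> P (- x)"
    and add: "\<And>x y. x \<in> ker M \<Longrightarrow> y \<in> ker M \<Longrightarrow> P x \<Longrightarrow> P y \<Longrightarrow> P (x + y)"
  shows "P x"
proof -
  have rel: "P y" if "y \<in> rels M" for y
    using that left right scalar unfolding rels_iff by (elim disjE exE conjE) simp_all
  have "x \<in> generate (frags M) (rels M)" using x by (simp add: ker_eq)
  then show ?thesis
  proof (induction rule: generate.induct)
    case one
    then show ?case using zero by simp
  next
    case (incl h)
    then show ?case by (rule rel)
  next
    case (inv h)
    have "Poly_Mapping.keys h \<subseteq> carrier K \<times> carrier M" using ker_keys[OF M ker_rel[OF inv]] .
    then show ?case using uminus[OF ker_rel[OF inv] rel[OF inv]] by simp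
  next
    case (eng h1 h2)
    then show ?case using add[of h1 h2] by (simp add: ker_eq)
  qed
qed

subsection \<open>Classes of formal sums\<close>

abbreviation bc :: "('l, 'a) module \<Rightarrow> (('k \<times> 'l \<Rightarrow>\<^sub>0 int) set, ('k \<times> 'a \<Rightarrow>\<^sub>0 int) set) module" where
  "bc M \<equiv> base_change_module R K \<iota> \<eta> M"

text \<open>The class of a formal sum in \<open>K \<otimes>\<^sub>R M\<close>.\<close>

definition cl :: "('l, 'a) module \<Rightarrow> ('k \<times> 'a \<Rightarrow>\<^sub>0 int) \<Rightarrow> ('k \<times> 'a \<Rightarrow>\<^sub>0 int) set" where
  "cl M \<tau> = ker M #>\<^bsub>frags M\<^esub> \<tau>"

lemma cl_eq_image: "cl M \<tau> = (\<lambda>h. h + \<tau>) ` ker M"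
  by (auto simp: cl_def r_coset_def)

lemma cl_eq_iff:
  assumes M: "left_module \<Lambda> M"
  shows "cl M \<tau> = cl M \<sigma> \<longleftrightarrow> \<tau> - \<sigma> \<in> ker M"
proof
  assume eq: "cl M \<tau> = cl M \<sigma>"
  have "\<tau> \<in> cl M \<tau>" using ker_zero[OF M] unfolding cl_eq_image by force
  then show "\<tau> - \<sigma> \<in> ker M" unfolding eq unfolding cl_eq_image by auto
next
  assume k: "\<tau> - \<sigma> \<in> ker M"
  have *: "cl M \<tau> \<subseteq> cl M \<sigma>" if "\<tau> - \<sigma> \<in> ker M" for \<tau> \<sigma>
  proof
    fix x assume "x \<in> cl M \<tau>"
    then obtain h where h: "h \<in> ker M" "x = h + \<tau>" unfolding cl_eq_image by blast
    then have "x = (h + (\<tau> - \<sigma>)) + \<sigma>" by simp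
    then show "x \<in> cl M \<sigma>" using ker_add[OF M h(1) that] unfolding cl_eq_image by blast
  qed
  have "\<sigma> - \<tau> \<in> ker M" using ker_uminus[OF M k] by simp
  then show "cl M \<tau> = cl M \<sigma>" using * k by blast
qed

lemma set_mult_cl:
  assumes M: "left_module \<Lambda> M"
  shows "cl M \<tau> <#>\<^bsub>frags M\<^esub> cl M \<sigma> = cl M (\<tau> + \<sigma>)"
proof (intro equalityI subsetI)
  fix x assume "x \<in> cl M \<tau> <#>\<^bsub>frags M\<^esub> cl M \<sigma>"
  then obtain h h' where h: "h \<in> ker M" "h' \<in> ker M" "x = (h + \<tau>) + (h' + \<sigma>)"
    unfolding set_mult_def cl_eq_image by auto
  then have "x = (h + h') + (\<tau> + \<sigma>)" by (simp add: algebra_simps)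
  then show "x \<in> cl M (\<tau> + \<sigma>)" using ker_add[OF M h(1,2)] unfolding cl_eq_image by blast
next
  fix x assume "x \<in> cl M (\<tau> + \<sigma>)"
  then obtain h where h: "h \<in> ker M" "x = h + (\<tau> + \<sigma>)" unfolding cl_eq_image by blast
  then have "x = (h + \<tau>) + (0 + \<sigma>)" by (simp add: algebra_simps)
  then show "x \<in> cl M \<tau> <#>\<^bsub>frags M\<^esub> cl M \<sigma>"
    using h(1) ker_zero[OF M] unfolding set_mult_def cl_eq_image by fastforce
qed

lemma bc_carrier: "carrier (bc M) = cl M ` {\<tau>. Poly_Mapping.keys \<tau> \<subseteq> carrier K \<times> carrier M}"
  by (auto simp: base_change_module_def tensor_group_def FactGroup_def RCOSETS_def cl_def Let_def)

lemma bc_zero: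
  assumes "left_module \<Lambda> M" shows "\<zero>\<^bsub>bc M\<^esub> = cl M 0"
  by (simp add: base_change_module_def tensor_group_def FactGroup_def cl_eq_image Let_def)

lemma bc_add:
  assumes "left_module \<Lambda> M" shows "cl M \<tau> \<oplus>\<^bsub>bc M\<^esub> cl M \<sigma> = cl M (\<tau> + \<sigma>)"
  using set_mult_cl[OF assms]
  by (simp add: base_change_module_def tensor_group_def FactGroup_def Let_def)

lemma bc_smult: "a \<odot>\<^bsub>bc M\<^esub> t = (\<Union>\<alpha>\<in>a. \<Union>\<tau>\<in>t. cl M (frag_action K M \<alpha> \<tau>))"
  by (simp add: base_change_module_def Let_def cl_def)

text \<open>The elementary tensor \<open>k \<otimes> m\<close>.\<close>

definition tens :: "('l, 'a) module \<Rightarrow> 'k \<Rightarrow> 'a \<Rightarrow> ('k \<times> 'a \<Rightarrow>\<^sub>0 int) set" where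
  "tens M k m = cl M (frag_of (k, m))"

lemma tens_closed: "k \<in> carrier K \<Longrightarrow> m \<in> carrier M \<Longrightarrow> tens M k m \<in> carrier (bc M)"
  unfolding bc_carrier tens_def by (intro imageI) (simp add: keys_frag_of)

lemma tens_add_right:
  assumes M: "left_module \<Lambda> M" and "k \<in> carrier K" "m \<in> carrier M" "m' \<in> carrier M"
  shows "tens M k (m \<oplus>\<^bsub>M\<^esub> m') = tens M k m \<oplus>\<^bsub>bc M\<^esub> tens M k m'"
  using ker_right[OF assms(2-4)] by (simp add: tens_def bc_add[OF M] cl_eq_iff[OF M] diff_diff_add)

lemma tens_scalar:
  assumes M: "left_module \<Lambda> M" and "r \<in> carrier R" "k \<in> carrier K" "m \<in> carrier M"
  shows "tens M (\<iota> r \<otimes>\<^bsub>K\<^esub> k) m = tens M k (\<eta> r \<odot>\<^bsub>M\<^esub> m)"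
  using ker_scalar[OF assms(2-4)] by (simp add: tens_def cl_eq_iff[OF M])

lemma abelian_group_bc:
  assumes M: "left_module \<Lambda> M"
  shows "abelian_group (bc M)"
proof (rule abelian_groupI)
  note simps = bc_add[OF M] bc_zero[OF M]
  fix x assume "x \<in> carrier (bc M)"
  then obtain \<tau> where x: "x = cl M \<tau>" "Poly_Mapping.keys \<tau> \<subseteq> carrier K \<times> carrier M" by (auto simp: bc_carrier)
  show "\<zero>\<^bsub>bc M\<^esub> \<oplus>\<^bsub>bc M\<^esub> x = x" by (simp add: simps x)
  have "cl M (- \<tau>) \<in> carrier (bc M)" using x(2) by (auto simp: bc_carrier)
  moreover have "cl M (- \<tau>) \<oplus>\<^bsub>bc M\<^esub> x = \<zero>\<^bsub>bc M\<^esub>" by (simp add: simps x)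
  ultimately show "\<exists>y\<in>carrier (bc M). y \<oplus>\<^bsub>bc M\<^esub> x = \<zero>\<^bsub>bc M\<^esub>" by blast
  fix y assume "y \<in> carrier (bc M)"
  then obtain \<sigma> where y: "y = cl M \<sigma>" "Poly_Mapping.keys \<sigma> \<subseteq> carrier K \<times> carrier M" by (auto simp: bc_carrier)
  have "Poly_Mapping.keys (\<tau> + \<sigma>) \<subseteq> carrier K \<times> carrier M" using x(2) y(2) keys_add[of \<tau> \<sigma>] by auto
  then show "x \<oplus>\<^bsub>bc M\<^esub> y \<in> carrier (bc M)" by (auto simp: simps x y bc_carrier)
  show "x \<oplus>\<^bsub>bc M\<^esub> y = y \<oplus>\<^bsub>bc M\<^esub> x" by (simp add: simps x y add.commute)
  fix z assume "z \<in> carrier (bc M)"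
  then obtain \<rho> where z: "z = cl M \<rho>" by (auto simp: bc_carrier)
  show "x \<oplus>\<^bsub>bc M\<^esub> y \<oplus>\<^bsub>bc M\<^esub> z = x \<oplus>\<^bsub>bc M\<^esub> (y \<oplus>\<^bsub>bc M\<^esub> z)" by (simp add: simps x y z add.assoc)
next
  show "\<zero>\<^bsub>bc M\<^esub> \<in> carrier (bc M)" unfolding bc_zero[OF M] bc_carrier by (rule imageI) simp
qed

text \<open>With a common denominator, two elementary tensors have the same first factor.\<close>

lemma tens_common:
  assumes M: "left_module \<Lambda> M" and "k \<in> carrier K" "m \<in> carrier M" "k' \<in> carrier K" "m' \<in> carrier M"
  obtains u x x' where "u \<in> carrier K" "x \<in> carrier M" "x' \<in> carrier M"
    "tens M k m = tens M u x" "tens M k' m' = tens M u x'"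
proof -
  interpret M: left_module \<Lambda> M by fact
  obtain u s a a' where "u \<in> carrier K" "s \<in> nonzero" "a \<in> carrier R" "a' \<in> carrier R"
    "\<iota> s \<otimes>\<^bsub>K\<^esub> u = \<one>\<^bsub>K\<^esub>" "k = \<iota> a \<otimes>\<^bsub>K\<^esub> u" "k' = \<iota> a' \<otimes>\<^bsub>K\<^esub> u"
    by (rule common_denominator[OF assms(2,4)])
  then show thesis
    using that[of u "\<eta> a \<odot>\<^bsub>M\<^esub> m" "\<eta> a' \<odot>\<^bsub>M\<^esub> m'"] tens_scalar[OF M, of a u m] tens_scalar[OF M, of a' u m']
      assms eta_closed by simp
qed

text \<open>Hence every element of \<open>K \<otimes>\<^sub>R M\<close> is an elementary tensor.\<close>

lemma bc_elem:
  assumes M: "left_module \<Lambda> M" and x: "x \<in> carrier (bc M)"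
  obtains k m where "k \<in> carrier K" "m \<in> carrier M" "x = tens M k m"
proof -
  interpret M: left_module \<Lambda> M by fact
  obtain \<tau> where \<tau>: "x = cl M \<tau>" "Poly_Mapping.keys \<tau> \<subseteq> carrier K \<times> carrier M" using x by (auto simp: bc_carrier)
  have "\<exists>k\<in>carrier K. \<exists>m\<in>carrier M. cl M \<tau> = tens M k m"
    using \<tau>(2)
  proof (induction \<tau> rule: frag_induction)
    case zero
    have "frag_of (\<zero>\<^bsub>K\<^esub> \<oplus>\<^bsub>K\<^esub> \<zero>\<^bsub>K\<^esub>, \<zero>\<^bsub>M\<^esub>) - frag_of (\<zero>\<^bsub>K\<^esub>, \<zero>\<^bsub>M\<^esub>) - frag_of (\<zero>\<^bsub>K\<^esub>, \<zero>\<^bsub>M\<^esub>) \<in> ker M"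
      by (rule ker_left) simp_all
    then have "cl M 0 = tens M \<zero>\<^bsub>K\<^esub> \<zero>\<^bsub>M\<^esub>" by (simp add: tens_def cl_eq_iff[OF M])
    then show ?case by blast
  next
    case (one p)
    then show ?case by (cases p) (auto simp: tens_def)
  next
    case (diff \<sigma> \<rho>)
    then obtain k m k' m' where 1: "k \<in> carrier K" "m \<in> carrier M" "cl M \<sigma> = tens M k m"
      "k' \<in> carrier K" "m' \<in> carrier M" "cl M \<rho> = tens M k' m'" by blast
    obtain u y y' where 2: "u \<in> carrier K" "y \<in> carrier M" "y' \<in> carrier M"
      "tens M k m = tens M u y" "tens M k' m' = tens M u y'" using tens_common[OF M 1(1,2,4,5)] by blast
    have \<sigma>: "\<sigma> - frag_of (u, y) \<in> ker M" and \<rho>: "\<rho> - frag_of (u, y') \<in> ker M"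
      using 1 2 by (simp_all add: tens_def flip: cl_eq_iff[OF M])
    have c: "y \<ominus>\<^bsub>M\<^esub> y' \<in> carrier M" "(y \<ominus>\<^bsub>M\<^esub> y') \<oplus>\<^bsub>M\<^esub> y' = y"
      using 2(2,3) by (simp_all add: a_minus_def M.M.a_assoc M.M.l_neg)
    have "frag_of (u, (y \<ominus>\<^bsub>M\<^esub> y') \<oplus>\<^bsub>M\<^esub> y') - frag_of (u, y \<ominus>\<^bsub>M\<^esub> y') - frag_of (u, y') \<in> ker M"
      by (rule ker_right[OF 2(1) c(1) 2(3)])
    then have "frag_of (u, y) - frag_of (u, y \<ominus>\<^bsub>M\<^esub> y') - frag_of (u, y') \<in> ker M" unfolding c(2) .
    then have "(\<sigma> - frag_of (u, y)) - (\<rho> - frag_of (u, y')) +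
        (frag_of (u, y) - frag_of (u, y \<ominus>\<^bsub>M\<^esub> y') - frag_of (u, y')) \<in> ker M"
      by (rule ker_add[OF M ker_diff[OF M \<sigma> \<rho>]])
    then have "(\<sigma> - \<rho>) - frag_of (u, y \<ominus>\<^bsub>M\<^esub> y') \<in> ker M" by (simp add: algebra_simps)
    then have "cl M (\<sigma> - \<rho>) = tens M u (y \<ominus>\<^bsub>M\<^esub> y')" by (simp add: tens_def cl_eq_iff[OF M])
    then show ?case using 2(1) c(1) by blast
  qed
  then show thesis using that \<tau>(1) by blast
qed

lemma bc_elem2:
  assumes M: "left_module \<Lambda> M" and x: "x \<in> carrier (bc M)" and y: "y \<in> carrier (bc M)"
  obtains u m m' where "u \<in> carrier K" "m \<in> carrier M" "m' \<in> carrier M" "x = tens M u m" "y = tens M u m'"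
proof -
  obtain k m where 1: "k \<in> carrier K" "m \<in> carrier M" "x = tens M k m" by (rule bc_elem[OF M x])
  obtain k' m' where 2: "k' \<in> carrier K" "m' \<in> carrier M" "y = tens M k' m'" by (rule bc_elem[OF M y])
  show thesis using tens_common[OF M 1(1,2) 2(1,2)] that 1(3) 2(3) by metis
qed

subsection \<open>The action\<close>

abbreviation act :: "('l, 'a) module \<Rightarrow> ('k \<times> 'l \<Rightarrow>\<^sub>0 int) \<Rightarrow> ('k \<times> 'a \<Rightarrow>\<^sub>0 int) \<Rightarrow> ('k \<times> 'a \<Rightarrow>\<^sub>0 int)" where
  "act M \<equiv> frag_action K M"

lemma act_of: "act M (frag_of (k, a)) (frag_of (k', m)) = frag_of (k \<otimes>\<^bsub>K\<^esub> k', a \<odot>\<^bsub>M\<^esub> m)"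
  by (simp add: frag_action_def)

lemma act_add_left: "act M (\<alpha> + \<beta>) \<tau> = act M \<alpha> \<tau> + act M \<beta> \<tau>"
  by (simp add: frag_action_def frag_extend_add)

lemma act_diff_left: "act M (\<alpha> - \<beta>) \<tau> = act M \<alpha> \<tau> - act M \<beta> \<tau>"
  by (simp add: frag_action_def frag_extend_diff)

lemma act_uminus_left: "act M (- \<alpha>) \<tau> = - act M \<alpha> \<tau>"
  by (simp add: frag_action_def frag_extend_minus)

lemma act_zero_left: "act M 0 \<tau> = 0"
  by (simp add: frag_action_def)

lemma act_add_right: "act M \<alpha> (\<tau> + \<sigma>) = act M \<alpha> \<tau> + act M \<alpha> \<sigma>"
  using subset_UNIV[of "Poly_Mapping.keys \<alpha>"]
proof (induction \<alpha> rule: frag_induction)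
  case (one p)
  then show ?case by (cases p) (simp add: frag_action_def frag_extend_add)
qed (simp_all add: act_zero_left act_diff_left)

lemma act_zero_right: "act M \<alpha> 0 = 0"
  using act_add_right[of M \<alpha> 0 0] by simp

lemma act_uminus_right: "act M \<alpha> (- \<tau>) = - act M \<alpha> \<tau>"
  using act_add_right[of M \<alpha> \<tau> "- \<tau>"] by (simp add: act_zero_right eq_neg_iff_add_eq_0 add.commute)

lemma act_diff_right: "act M \<alpha> (\<tau> - \<sigma>) = act M \<alpha> \<tau> - act M \<alpha> \<sigma>"
  using act_add_right[of M \<alpha> \<tau> "- \<sigma>"] by (simp add: act_uminus_right)

lemma act_ker_right:
  assumes M: "left_module \<Lambda> M" and \<alpha>: "Poly_Mapping.keys \<alpha> \<subseteq> carrier K \<times> carrier \<Lambda>" and \<tau>: "\<tau> \<in> ker M"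
  shows "act M \<alpha> \<tau> \<in> ker M"
  using \<alpha>
proof (induction \<alpha> rule: frag_induction)
  case zero
  then show ?case by (simp add: act_zero_left ker_zero[OF M])
next
  case (one p)
  interpret M: left_module \<Lambda> M by fact
  obtain k a where p: "p = (k, a)" "k \<in> carrier K" "a \<in> carrier \<Lambda>" using one by auto
  show ?case
    unfolding p(1) using M \<tau>
  proof (induction rule: ker_induct)
    case zero
    then show ?case by (simp add: act_zero_right ker_zero[OF M])
  next
    case (left k1 k2 m)
    then show ?case using ker_left[of "k \<otimes>\<^bsub>K\<^esub> k1" "k \<otimes>\<^bsub>K\<^esub> k2" "a \<odot>\<^bsub>M\<^esub> m" M] p
      by (simp add: act_diff_right act_of K.r_distr)
  next
    case (right k1 m m')
    then show ?case using ker_right[of "k \<otimes>\<^bsub>K\<^esub> k1" "a \<odot>\<^bsub>M\<^esub> m" M "a \<odot>\<^bsub>M\<^esub> m'"] p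
      by (simp add: act_diff_right act_of M.smult_r_distr)
  next
    case (scalar r k1 m)
    have "k \<otimes>\<^bsub>K\<^esub> (\<iota> r \<otimes>\<^bsub>K\<^esub> k1) = \<iota> r \<otimes>\<^bsub>K\<^esub> (k \<otimes>\<^bsub>K\<^esub> k1)"
      using scalar p iota_closed by (simp add: K.m_lcomm)
    then show ?case using scalar ker_scalar[of r "k \<otimes>\<^bsub>K\<^esub> k1" "a \<odot>\<^bsub>M\<^esub> m" M] p
      by (simp add: act_diff_right act_of eta_commute[OF M])
  next
    case (uminus x)
    then show ?case by (simp add: act_uminus_right ker_uminus[OF M])
  next
    case (add x y)
    then show ?case by (simp add: act_add_right ker_add[OF M])
  qed
next
  case (diff \<alpha> \<beta>)
  then show ?case by (simp add: act_diff_left ker_diff[OF M])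
qed

abbreviation reg :: "('l, 'l) module" where "reg \<equiv> regular_module \<Lambda>"

lemma left_module_reg: "left_module \<Lambda> reg"
  by (rule left_module_regular[OF \<Lambda>.ring_axioms])

lemma act_ker_left:
  assumes M: "left_module \<Lambda> M" and \<alpha>: "\<alpha> \<in> ker reg" and \<tau>: "Poly_Mapping.keys \<tau> \<subseteq> carrier K \<times> carrier M"
  shows "act M \<alpha> \<tau> \<in> ker M"
  using \<tau>
proof (induction \<tau> rule: frag_induction)
  case zero
  then show ?case by (simp add: act_zero_right ker_zero[OF M])
next
  case (one p)
  interpret M: left_module \<Lambda> M by fact
  obtain k m where p: "p = (k, m)" "k \<in> carrier K" "m \<in> carrier M" using one by auto
  show ?case
    unfolding p(1) using left_module_reg \<alpha>
  proof (induction rule: ker_induct)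
    case zero
    then show ?case by (simp add: act_zero_left ker_zero[OF M])
  next
    case (left k1 k2 a)
    then show ?case using ker_left[of "k1 \<otimes>\<^bsub>K\<^esub> k" "k2 \<otimes>\<^bsub>K\<^esub> k" "a \<odot>\<^bsub>M\<^esub> m" M] p
      by (simp add: act_diff_left act_of K.l_distr)
  next
    case (right k1 a b)
    then show ?case using ker_right[of "k1 \<otimes>\<^bsub>K\<^esub> k" "a \<odot>\<^bsub>M\<^esub> m" M "b \<odot>\<^bsub>M\<^esub> m"] p
      by (simp add: act_diff_left act_of M.smult_l_distr)
  next
    case (scalar r k1 a)
    then show ?case using ker_scalar[of r "k1 \<otimes>\<^bsub>K\<^esub> k" "a \<odot>\<^bsub>M\<^esub> m" M] p iota_closed eta_closed
      by (simp add: act_diff_left act_of K.m_assoc M.smult_assoc)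
  next
    case (uminus x)
    then show ?case by (simp add: act_uminus_left ker_uminus[OF M])
  next
    case (add x y)
    then show ?case by (simp add: act_add_left ker_add[OF M])
  qed
next
  case (diff \<sigma> \<rho>)
  then show ?case by (simp add: act_diff_right ker_diff[OF M])
qed

text \<open>The union over representatives in the definition of the action is the union of a single class.\<close>

lemma tens_smult:
  assumes M: "left_module \<Lambda> M" and c: "k \<in> carrier K" "a \<in> carrier \<Lambda>" "k' \<in> carrier K" "m \<in> carrier M"
  shows "tens reg k a \<odot>\<^bsub>bc M\<^esub> tens M k' m = tens M (k \<otimes>\<^bsub>K\<^esub> k') (a \<odot>\<^bsub>M\<^esub> m)"
proof -
  have "cl M (act M \<alpha> \<tau>) = tens M (k \<otimes>\<^bsub>K\<^esub> k') (a \<odot>\<^bsub>M\<^esub> m)"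
    if \<alpha>: "\<alpha> \<in> tens reg k a" and \<tau>: "\<tau> \<in> tens M k' m" for \<alpha> \<tau>
  proof -
    obtain h where h: "h \<in> ker reg" "\<alpha> = h + frag_of (k, a)" using \<alpha> by (auto simp: tens_def cl_eq_image)
    obtain h' where h': "h' \<in> ker M" "\<tau> = h' + frag_of (k', m)" using \<tau> by (auto simp: tens_def cl_eq_image)
    have "Poly_Mapping.keys \<tau> \<subseteq> carrier K \<times> carrier M"
      using ker_keys[OF M h'(1)] c(3,4) keys_add[of h' "frag_of (k', m)"] h'(2) by (auto simp: keys_frag_of)
    then have 1: "act M h \<tau> \<in> ker M" by (rule act_ker_left[OF M h(1)])
    have 2: "act M (frag_of (k, a)) h' \<in> ker M"
      by (rule act_ker_right[OF M _ h'(1)]) (use c in \<open>simp add: keys_frag_of\<close>)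
    have "act M \<alpha> \<tau> - frag_of (k \<otimes>\<^bsub>K\<^esub> k', a \<odot>\<^bsub>M\<^esub> m) = act M h \<tau> + act M (frag_of (k, a)) h'"
      unfolding h(2) act_add_left by (subst (2) h'(2)) (simp add: act_add_right act_of)
    then show ?thesis using ker_add[OF M 1 2] by (simp add: tens_def cl_eq_iff[OF M])
  qed
  moreover have "frag_of (k, a) \<in> tens reg k a" "frag_of (k', m) \<in> tens M k' m"
    using ker_zero[OF left_module_reg] ker_zero[OF M] unfolding tens_def cl_eq_image by force+
  ultimately show ?thesis unfolding bc_smult by blast
qed

subsection \<open>The base change of the algebra and of its modules\<close>

abbreviation A :: "('k \<times> 'l \<Rightarrow>\<^sub>0 int) set ring" where "A \<equiv> base_change_ring R K \<iota> \<Lambda> \<eta>"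

lemma A_simps:
  "carrier A = carrier (bc reg)" "\<zero>\<^bsub>A\<^esub> = \<zero>\<^bsub>bc reg\<^esub>" "x \<oplus>\<^bsub>A\<^esub> y = x \<oplus>\<^bsub>bc reg\<^esub> y"
  "x \<otimes>\<^bsub>A\<^esub> y = x \<odot>\<^bsub>bc reg\<^esub> y" "\<one>\<^bsub>A\<^esub> = tens reg \<one>\<^bsub>K\<^esub> \<one>\<^bsub>\<Lambda>\<^esub>"
  by (simp_all add: base_change_ring_def Let_def tens_def cl_def)

lemma tens_mult:
  assumes "k \<in> carrier K" "a \<in> carrier \<Lambda>" "k' \<in> carrier K" "b \<in> carrier \<Lambda>"
  shows "tens reg k a \<otimes>\<^bsub>A\<^esub> tens reg k' b = tens reg (k \<otimes>\<^bsub>K\<^esub> k') (a \<otimes>\<^bsub>\<Lambda>\<^esub> b)"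
  using tens_smult[OF left_module_reg assms(1-3), of b] assms(4) by (simp add: A_simps)

lemma bc_smult_closed:
  assumes M: "left_module \<Lambda> M" and a: "a \<in> carrier (bc reg)" and x: "x \<in> carrier (bc M)"
  shows "a \<odot>\<^bsub>bc M\<^esub> x \<in> carrier (bc M)"
proof -
  interpret M: left_module \<Lambda> M by fact
  obtain k b where 1: "k \<in> carrier K" "b \<in> carrier reg" "a = tens reg k b" by (rule bc_elem[OF left_module_reg a])
  obtain k' m where 2: "k' \<in> carrier K" "m \<in> carrier M" "x = tens M k' m" by (rule bc_elem[OF M x])
  show ?thesis using 1 2 by (simp add: tens_smult[OF M] tens_closed)
qed

lemma bc_smult_l_distr:
  assumes M: "left_module \<Lambda> M" and a: "a \<in> carrier (bc reg)" "b \<in> carrier (bc reg)" and x: "x \<in> carrier (bc M)"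
  shows "(a \<oplus>\<^bsub>bc reg\<^esub> b) \<odot>\<^bsub>bc M\<^esub> x = a \<odot>\<^bsub>bc M\<^esub> x \<oplus>\<^bsub>bc M\<^esub> b \<odot>\<^bsub>bc M\<^esub> x"
proof -
  interpret M: left_module \<Lambda> M by fact
  obtain k c d where 1: "k \<in> carrier K" "c \<in> carrier reg" "d \<in> carrier reg" "a = tens reg k c" "b = tens reg k d"
    by (rule bc_elem2[OF left_module_reg a])
  obtain k' m where 2: "k' \<in> carrier K" "m \<in> carrier M" "x = tens M k' m" by (rule bc_elem[OF M x])
  have "a \<oplus>\<^bsub>bc reg\<^esub> b = tens reg k (c \<oplus>\<^bsub>\<Lambda>\<^esub> d)" using tens_add_right[OF left_module_reg 1(1-3)] 1(4,5) by simp
  then show ?thesis using 1 2 by (simp add: tens_smult[OF M] M.smult_l_distr tens_add_right[OF M])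
qed

lemma bc_smult_r_distr:
  assumes M: "left_module \<Lambda> M" and a: "a \<in> carrier (bc reg)" and x: "x \<in> carrier (bc M)" "y \<in> carrier (bc M)"
  shows "a \<odot>\<^bsub>bc M\<^esub> (x \<oplus>\<^bsub>bc M\<^esub> y) = a \<odot>\<^bsub>bc M\<^esub> x \<oplus>\<^bsub>bc M\<^esub> a \<odot>\<^bsub>bc M\<^esub> y"
proof -
  interpret M: left_module \<Lambda> M by fact
  obtain k c where 1: "k \<in> carrier K" "c \<in> carrier reg" "a = tens reg k c"
    by (rule bc_elem[OF left_module_reg a])
  obtain k' m m' where 2: "k' \<in> carrier K" "m \<in> carrier M" "m' \<in> carrier M" "x = tens M k' m" "y = tens M k' m'"
    by (rule bc_elem2[OF M x])
  have "x \<oplus>\<^bsub>bc M\<^esub> y = tens M k' (m \<oplus>\<^bsub>M\<^esub> m')" using tens_add_right[OF M 2(1-3)] 2(4,5) by simp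
  moreover have "a \<odot>\<^bsub>bc M\<^esub> tens M k' (m \<oplus>\<^bsub>M\<^esub> m') = a \<odot>\<^bsub>bc M\<^esub> x \<oplus>\<^bsub>bc M\<^esub> a \<odot>\<^bsub>bc M\<^esub> y"
  proof -
    have "a \<odot>\<^bsub>bc M\<^esub> tens M k' (m \<oplus>\<^bsub>M\<^esub> m') = tens M (k \<otimes>\<^bsub>K\<^esub> k') (c \<odot>\<^bsub>M\<^esub> m \<oplus>\<^bsub>M\<^esub> c \<odot>\<^bsub>M\<^esub> m')"
      using 1 2 by (simp add: tens_smult[OF M] M.smult_r_distr)
    then show ?thesis using 1 2 by (simp add: tens_smult[OF M] tens_add_right[OF M])
  qed
  ultimately show ?thesis by simp
qed

lemma bc_smult_assoc:
  assumes M: "left_module \<Lambda> M" and a: "a \<in> carrier (bc reg)" "b \<in> carrier (bc reg)" and x: "x \<in> carrier (bc M)"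
  shows "(a \<odot>\<^bsub>bc reg\<^esub> b) \<odot>\<^bsub>bc M\<^esub> x = a \<odot>\<^bsub>bc M\<^esub> (b \<odot>\<^bsub>bc M\<^esub> x)"
proof -
  interpret M: left_module \<Lambda> M by fact
  obtain k c where 1: "k \<in> carrier K" "c \<in> carrier reg" "a = tens reg k c" by (rule bc_elem[OF left_module_reg a(1)])
  obtain l d where 2: "l \<in> carrier K" "d \<in> carrier reg" "b = tens reg l d" by (rule bc_elem[OF left_module_reg a(2)])
  obtain k' m where 3: "k' \<in> carrier K" "m \<in> carrier M" "x = tens M k' m" by (rule bc_elem[OF M x])
  show ?thesis using 1 2 3
    by (simp add: tens_smult[OF M] tens_smult[OF left_module_reg] K.m_assoc M.smult_assoc)
qed

lemma bc_smult_one: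
  assumes M: "left_module \<Lambda> M" and x: "x \<in> carrier (bc M)"
  shows "tens reg \<one>\<^bsub>K\<^esub> \<one>\<^bsub>\<Lambda>\<^esub> \<odot>\<^bsub>bc M\<^esub> x = x"
proof -
  interpret M: left_module \<Lambda> M by fact
  obtain k' m where 3: "k' \<in> carrier K" "m \<in> carrier M" "x = tens M k' m" by (rule bc_elem[OF M x])
  then show ?thesis by (simp add: tens_smult[OF M])
qed

lemma ring_A: "ring A"
proof (rule ringI)
  interpret B: abelian_group "bc reg" by (rule abelian_group_bc[OF left_module_reg])
  show "abelian_group A"
  proof (rule abelian_groupI)
    show "\<exists>y\<in>carrier A. y \<oplus>\<^bsub>A\<^esub> x = \<zero>\<^bsub>A\<^esub>" if "x \<in> carrier A" for x
      using that B.l_neg[of x] B.a_inv_closed[of x] unfolding A_simps by (intro bexI)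
  qed (simp_all add: A_simps B.a_ac)
  show "monoid A"
  proof (rule monoidI)
    show "\<one>\<^bsub>A\<^esub> \<in> carrier A" by (simp add: A_simps tens_closed)
    fix x assume x: "x \<in> carrier A"
    show "\<one>\<^bsub>A\<^esub> \<otimes>\<^bsub>A\<^esub> x = x" using x bc_smult_one[OF left_module_reg] by (simp add: A_simps)
    obtain k a where "k \<in> carrier K" "a \<in> carrier reg" "x = tens reg k a"
      using bc_elem[OF left_module_reg, of x] x by (auto simp: A_simps)
    then show "x \<otimes>\<^bsub>A\<^esub> \<one>\<^bsub>A\<^esub> = x" using tens_mult[of k a "\<one>\<^bsub>K\<^esub>" "\<one>\<^bsub>\<Lambda>\<^esub>"] by (simp add: A_simps(5))
  qed (simp_all add: A_simps bc_smult_closed[OF left_module_reg] bc_smult_assoc[OF left_module_reg])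
qed (simp_all add: A_simps bc_smult_l_distr[OF left_module_reg] bc_smult_r_distr[OF left_module_reg])

lemma left_module_bc:
  assumes M: "left_module \<Lambda> M" shows "left_module A (bc M)"
proof -
  have "left_module_axioms A (bc M)"
    by unfold_locales
      (simp_all add: A_simps bc_smult_closed[OF M] bc_smult_l_distr[OF M] bc_smult_r_distr[OF M]
        bc_smult_assoc[OF M] bc_smult_one[OF M])
  then show ?thesis using ring_A abelian_group_bc[OF M] by (simp add: left_module_def)
qed

text \<open>The canonical homomorphism \<open>\<Lambda> \<rightarrow> A\<close>.\<close>

definition eps :: "'l \<Rightarrow> ('k \<times> 'l \<Rightarrow>\<^sub>0 int) set" where "eps a = tens reg \<one>\<^bsub>K\<^esub> a"

lemma eps_smult:
  assumes M: "left_module \<Lambda> M" and "a \<in> carrier \<Lambda>" "k \<in> carrier K" "m \<in> carrier M"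
  shows "eps a \<odot>\<^bsub>bc M\<^esub> tens M k m = tens M k (a \<odot>\<^bsub>M\<^esub> m)"
  using tens_smult[OF M _ assms(2-4), of "\<one>\<^bsub>K\<^esub>"] assms(3) by (simp add: eps_def)

lemma clear_denominator:
  assumes M: "left_module \<Lambda> M" and x: "x \<in> carrier (bc M)"
  obtains s m where "s \<in> nonzero" "m \<in> carrier M" "eps (\<eta> s) \<odot>\<^bsub>bc M\<^esub> x = tens M \<one>\<^bsub>K\<^esub> m"
proof -
  interpret M: left_module \<Lambda> M by fact
  obtain k m where 1: "k \<in> carrier K" "m \<in> carrier M" "x = tens M k m" by (rule bc_elem[OF M x])
  obtain a b u where 2: "a \<in> carrier R" "b \<in> nonzero" "u \<in> carrier K" "\<iota> b \<otimes>\<^bsub>K\<^esub> u = \<one>\<^bsub>K\<^esub>" "k = \<iota> a \<otimes>\<^bsub>K\<^esub> u"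
    using fraction[OF 1(1)] by blast
  have c: "\<iota> a \<in> carrier K" "\<iota> b \<in> carrier K" "b \<in> carrier R" using 2 iota_closed by auto
  have "\<iota> b \<otimes>\<^bsub>K\<^esub> k = \<iota> a \<otimes>\<^bsub>K\<^esub> (\<iota> b \<otimes>\<^bsub>K\<^esub> u)" unfolding 2(5) using c 2(3) by (simp add: K.m_lcomm)
  then have k: "\<iota> b \<otimes>\<^bsub>K\<^esub> k = \<iota> a \<otimes>\<^bsub>K\<^esub> \<one>\<^bsub>K\<^esub>" using 2(4) by simp
  have "eps (\<eta> b) \<odot>\<^bsub>bc M\<^esub> x = tens M k (\<eta> b \<odot>\<^bsub>M\<^esub> m)"
    using eps_smult[OF M eta_closed[OF c(3)] 1(1,2)] 1(3) by simp
  also have "\<dots> = tens M (\<iota> a \<otimes>\<^bsub>K\<^esub> \<one>\<^bsub>K\<^esub>) m" using tens_scalar[OF M c(3) 1(1,2)] k by simp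
  also have "\<dots> = tens M \<one>\<^bsub>K\<^esub> (\<eta> a \<odot>\<^bsub>M\<^esub> m)" using tens_scalar[OF M 2(1) _ 1(2), of "\<one>\<^bsub>K\<^esub>"] by simp
  finally show thesis using that[OF 2(2), of "\<eta> a \<odot>\<^bsub>M\<^esub> m"] eta_closed[OF 2(1)] 1(2) by simp
qed

lemma order_localization_A: "order_localization R \<Lambda> \<eta> A eps"
proof (unfold order_localization_def order_localization_axioms_def, intro conjI allI impI)
  show "dim_one_order R \<Lambda> \<eta>" by (rule dim_one_order_axioms)
  show "ring A" by (rule ring_A)
  show "eps \<in> ring_hom \<Lambda> A"
  proof (rule ring_hom_memI)
    show "eps x \<in> carrier A" if "x \<in> carrier \<Lambda>" for x using that by (simp add: eps_def A_simps tens_closed)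
    show "eps (x \<otimes>\<^bsub>\<Lambda>\<^esub> y) = eps x \<otimes>\<^bsub>A\<^esub> eps y" if "x \<in> carrier \<Lambda>" "y \<in> carrier \<Lambda>" for x y
      using that tens_mult[of "\<one>\<^bsub>K\<^esub>" x "\<one>\<^bsub>K\<^esub>" y] by (simp add: eps_def)
    show "eps (x \<oplus>\<^bsub>\<Lambda>\<^esub> y) = eps x \<oplus>\<^bsub>A\<^esub> eps y" if "x \<in> carrier \<Lambda>" "y \<in> carrier \<Lambda>" for x y
      using that tens_add_right[OF left_module_reg, of "\<one>\<^bsub>K\<^esub>" x y] by (simp add: eps_def A_simps)
    show "eps \<one>\<^bsub>\<Lambda>\<^esub> = \<one>\<^bsub>A\<^esub>" by (simp add: eps_def A_simps)
  qed
next
  fix s assume s: "s \<in> nonzero"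
  then obtain u where u: "u \<in> carrier K" "\<iota> s \<otimes>\<^bsub>K\<^esub> u = \<one>\<^bsub>K\<^esub>" using iota_inverse by blast
  have es: "\<eta> s \<in> carrier \<Lambda>" using s eta_closed by simp
  have "tens reg u \<one>\<^bsub>\<Lambda>\<^esub> \<otimes>\<^bsub>A\<^esub> eps (\<eta> s) = tens reg u (\<eta> s)"
    using tens_mult[OF u(1) _ _ es, of "\<one>\<^bsub>\<Lambda>\<^esub>" "\<one>\<^bsub>K\<^esub>"] u(1) es by (simp add: eps_def)
  also have "\<dots> = \<one>\<^bsub>A\<^esub>"
    using tens_scalar[OF left_module_reg _ u(1), of s "\<one>\<^bsub>\<Lambda>\<^esub>"] s u(2) es by (simp add: A_simps)
  finally show "\<exists>t\<in>carrier A. t \<otimes>\<^bsub>A\<^esub> eps (\<eta> s) = \<one>\<^bsub>A\<^esub>"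
    using tens_closed[OF u(1), of "\<one>\<^bsub>\<Lambda>\<^esub>" reg] by (auto simp: A_simps(1))
next
  fix a assume a: "a \<in> carrier A"
  obtain s b where "s \<in> nonzero" "b \<in> carrier reg" "eps (\<eta> s) \<odot>\<^bsub>bc reg\<^esub> a = tens reg \<one>\<^bsub>K\<^esub> b"
    using clear_denominator[OF left_module_reg, of a] a by (auto simp: A_simps)
  then show "\<exists>s\<in>nonzero. \<exists>b\<in>carrier \<Lambda>. eps (\<eta> s) \<otimes>\<^bsub>A\<^esub> a = eps b"
    unfolding A_simps(4) eps_def regular_module_simps by blast
next
  fix s a assume s: "s \<in> carrier R" and a: "a \<in> carrier A"
  obtain k b where b: "k \<in> carrier K" "b \<in> carrier reg" "a = tens reg k b"
    using bc_elem[OF left_module_reg, of a] a by (auto simp: A_simps)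
  show "eps (\<eta> s) \<otimes>\<^bsub>A\<^esub> a = a \<otimes>\<^bsub>A\<^esub> eps (\<eta> s)"
    using b tens_mult[of "\<one>\<^bsub>K\<^esub>" "\<eta> s" k b] tens_mult[of k b "\<one>\<^bsub>K\<^esub>" "\<eta> s"] eta_closed[OF s] central[OF s, of b]
    by (simp add: eps_def)
qed

text \<open>An element \<open>m\<close> with \<open>1 \<otimes> m = 0\<close> is torsion. For nonzero \<open>s \<in> R\<close> let \<open>h s\<close> be the additive map
  on formal sums that sends \<open>(k, x)\<close> to \<open>(s k) x\<close> if \<open>s k\<close> lies in \<open>R\<close>, and to zero otherwise. An
  element of the kernel is a combination of finitely many relations, so \<open>h\<close> sends it to zero for all
  nonzero multiples of a common denominator. For \<open>(1, m)\<close> the value of \<open>h s\<close> is \<open>s m\<close>.\<close>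

lemma tens_one_eq_zero:
  assumes M: "left_module \<Lambda> M" and m: "m \<in> carrier M" and zero: "tens M \<one>\<^bsub>K\<^esub> m = \<zero>\<^bsub>bc M\<^esub>"
  obtains s where "s \<in> nonzero" "\<eta> s \<odot>\<^bsub>M\<^esub> m = \<zero>\<^bsub>M\<^esub>"
proof -
  interpret M: left_module \<Lambda> M by fact
  have in_ker: "frag_of (\<one>\<^bsub>K\<^esub>, m) \<in> ker M"
    using zero by (simp add: tens_def bc_zero[OF M] cl_eq_iff[OF M])
  define \<phi> where "\<phi> s p = (if \<exists>a\<in>carrier R. \<iota> s \<otimes>\<^bsub>K\<^esub> fst p = \<iota> a
      then \<eta> (THE a. a \<in> carrier R \<and> \<iota> s \<otimes>\<^bsub>K\<^esub> fst p = \<iota> a) \<odot>\<^bsub>M\<^esub> snd p else \<zero>\<^bsub>M\<^esub>)" for s p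
  have \<phi>: "\<phi> s (k, x) = \<eta> a \<odot>\<^bsub>M\<^esub> x" if a: "a \<in> carrier R" "\<iota> s \<otimes>\<^bsub>K\<^esub> k = \<iota> a" for s k x a
  proof -
    have "(THE b. b \<in> carrier R \<and> \<iota> s \<otimes>\<^bsub>K\<^esub> k = \<iota> b) = a"
      using a iota_inj by (intro the_equality) auto
    then show ?thesis using a unfolding \<phi>_def fst_conv snd_conv by auto
  qed
  have \<phi>_closed: "\<phi> s ` (carrier K \<times> carrier M) \<subseteq> carrier (add_monoid M)" for s
  proof
    fix y assume "y \<in> \<phi> s ` (carrier K \<times> carrier M)"
    then obtain k x where y: "y = \<phi> s (k, x)" "x \<in> carrier M" by auto
    show "y \<in> carrier (add_monoid M)"
    proof (cases "\<exists>a\<in>carrier R. \<iota> s \<otimes>\<^bsub>K\<^esub> k = \<iota> a")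
      case True
      then obtain a where "a \<in> carrier R" "\<iota> s \<otimes>\<^bsub>K\<^esub> k = \<iota> a" by blast
      then show ?thesis using y \<phi> eta_closed by simp
    qed (simp add: y \<phi>_def)
  qed
  have "\<exists>h. h \<in> hom (frags M) (add_monoid M) \<and> (\<forall>p\<in>carrier K \<times> carrier M. h (frag_of p) = \<phi> s p)" for s
    by (rule comm_group.free_Abelian_group_universal[OF M.M.a_comm_group \<phi>_closed[of s]]) blast
  then obtain h where h: "\<And>s. h s \<in> hom (frags M) (add_monoid M)"
    "\<And>s p. p \<in> carrier K \<times> carrier M \<Longrightarrow> h s (frag_of p) = \<phi> s p" by metis
  have gh: "group_hom (frags M) (add_monoid M) (h s)" for s
    using h(1) M.M.a_group by (simp add: group_hom_def group_hom_axioms_def)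
  have h_closed: "h s x \<in> carrier M" if "Poly_Mapping.keys x \<subseteq> carrier K \<times> carrier M" for s x
    using group_hom.hom_closed[OF gh, of x s] that by simp
  have h_add: "h s (x + y) = h s x \<oplus>\<^bsub>M\<^esub> h s y"
    if "Poly_Mapping.keys x \<subseteq> carrier K \<times> carrier M" "Poly_Mapping.keys y \<subseteq> carrier K \<times> carrier M" for s x y
    using group_hom.hom_mult[OF gh, of x y s] that by simp
  have h_uminus: "h s (- x) = \<ominus>\<^bsub>M\<^esub> h s x" if "Poly_Mapping.keys x \<subseteq> carrier K \<times> carrier M" for s x
    using group_hom.hom_inv[OF gh, of x s] that by (simp add: a_inv_def)
  have h_zero: "h s 0 = \<zero>\<^bsub>M\<^esub>" for s using group_hom.hom_one[OF gh, of s] by simp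
  have h_diff: "h s (x - y) = h s x \<ominus>\<^bsub>M\<^esub> h s y"
    if "Poly_Mapping.keys x \<subseteq> carrier K \<times> carrier M" "Poly_Mapping.keys y \<subseteq> carrier K \<times> carrier M" for s x y
    using h_add[of x "- y" s] h_uminus[of y s] that by (simp add: a_minus_def)
  have h_diff2: "h s (frag_of p - frag_of q) = \<phi> s p \<ominus>\<^bsub>M\<^esub> \<phi> s q"
    if "p \<in> carrier K \<times> carrier M" "q \<in> carrier K \<times> carrier M" for s p q
    using that h(2)[OF that(1), of s] h(2)[OF that(2), of s]
      h_diff[of "frag_of p" "frag_of q" s] by (simp add: keys_frag_of)
  have h_diff3: "h s (frag_of p - frag_of q - frag_of r) = \<phi> s p \<ominus>\<^bsub>M\<^esub> \<phi> s q \<ominus>\<^bsub>M\<^esub> \<phi> s r"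
    if "p \<in> carrier K \<times> carrier M" "q \<in> carrier K \<times> carrier M" "r \<in> carrier K \<times> carrier M" for s p q r
    using that h_diff2[OF that(1,2)] h(2)[OF that(3), of s]
      h_diff[OF keys_frag_diff2[OF that(1,2)], of "frag_of r" s] by (simp add: keys_frag_of)
  have mult: "\<iota> (t \<otimes>\<^bsub>R\<^esub> s) \<otimes>\<^bsub>K\<^esub> k = \<iota> (t \<otimes>\<^bsub>R\<^esub> a)"
    if "t \<in> carrier R" "s \<in> carrier R" "a \<in> carrier R" "k \<in> carrier K" "\<iota> s \<otimes>\<^bsub>K\<^esub> k = \<iota> a" for t s a k
    using that iota_closed by (simp add: iota_mult K.m_assoc)
  have clear: "\<iota> s \<otimes>\<^bsub>K\<^esub> (\<iota> a \<otimes>\<^bsub>K\<^esub> u) = \<iota> a"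
    if "s \<in> carrier R" "a \<in> carrier R" "u \<in> carrier K" "\<iota> s \<otimes>\<^bsub>K\<^esub> u = \<one>\<^bsub>K\<^esub>" for s a u
    using that iota_closed K.m_lcomm[of "\<iota> s" "\<iota> a" u] by simp
  have cancel: "(x \<oplus>\<^bsub>M\<^esub> y) \<ominus>\<^bsub>M\<^esub> x \<ominus>\<^bsub>M\<^esub> y = \<zero>\<^bsub>M\<^esub>" if "x \<in> carrier M" "y \<in> carrier M" for x y
  proof -
    have "(x \<oplus>\<^bsub>M\<^esub> y) \<ominus>\<^bsub>M\<^esub> x \<ominus>\<^bsub>M\<^esub> y = (x \<oplus>\<^bsub>M\<^esub> y) \<ominus>\<^bsub>M\<^esub> (x \<oplus>\<^bsub>M\<^esub> y)"
      using that by (simp add: a_minus_def M.M.a_assoc M.M.minus_add)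
    then show ?thesis using that by (simp add: M.diff_eq_zero_iff)
  qed
  have "\<exists>s\<in>nonzero. \<forall>t\<in>nonzero. h (t \<otimes>\<^bsub>R\<^esub> s) (frag_of (\<one>\<^bsub>K\<^esub>, m)) = \<zero>\<^bsub>M\<^esub>"
    using M in_ker
  proof (induction rule: ker_induct)
    case zero
    then show ?case using one_nonzero h_zero by blast
  next
    case (left k k' x)
    obtain u s a a' where d: "u \<in> carrier K" "s \<in> nonzero" "a \<in> carrier R" "a' \<in> carrier R"
      "\<iota> s \<otimes>\<^bsub>K\<^esub> u = \<one>\<^bsub>K\<^esub>" "k = \<iota> a \<otimes>\<^bsub>K\<^esub> u" "k' = \<iota> a' \<otimes>\<^bsub>K\<^esub> u"
      by (rule common_denominator[OF left(1,2)])
    have sc: "s \<in> carrier R" using d(2) by simp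
    have "h (t \<otimes>\<^bsub>R\<^esub> s) (frag_of (k \<oplus>\<^bsub>K\<^esub> k', x) - frag_of (k, x) - frag_of (k', x)) = \<zero>\<^bsub>M\<^esub>"
      if "t \<in> nonzero" for t
    proof -
      have tc: "t \<in> carrier R" using that by simp
      have k: "\<iota> (t \<otimes>\<^bsub>R\<^esub> s) \<otimes>\<^bsub>K\<^esub> k = \<iota> (t \<otimes>\<^bsub>R\<^esub> a)" "\<iota> (t \<otimes>\<^bsub>R\<^esub> s) \<otimes>\<^bsub>K\<^esub> k' = \<iota> (t \<otimes>\<^bsub>R\<^esub> a')"
        using mult[OF tc sc d(3) left(1)] mult[OF tc sc d(4) left(2)] clear[OF sc d(3) d(1) d(5)]
          clear[OF sc d(4) d(1) d(5)] d(6,7) by simp_all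
      then have kk: "\<iota> (t \<otimes>\<^bsub>R\<^esub> s) \<otimes>\<^bsub>K\<^esub> (k \<oplus>\<^bsub>K\<^esub> k') = \<iota> (t \<otimes>\<^bsub>R\<^esub> a \<oplus>\<^bsub>R\<^esub> t \<otimes>\<^bsub>R\<^esub> a')"
        using left tc sc d(3,4) iota_closed by (simp add: K.r_distr iota_add)
      have e: "\<eta> (t \<otimes>\<^bsub>R\<^esub> a) \<in> carrier \<Lambda>" "\<eta> (t \<otimes>\<^bsub>R\<^esub> a') \<in> carrier \<Lambda>" using tc d(3,4) eta_closed by simp_all
      have "\<phi> (t \<otimes>\<^bsub>R\<^esub> s) (k \<oplus>\<^bsub>K\<^esub> k', x) = \<phi> (t \<otimes>\<^bsub>R\<^esub> s) (k, x) \<oplus>\<^bsub>M\<^esub> \<phi> (t \<otimes>\<^bsub>R\<^esub> s) (k', x)"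
        using \<phi>[OF _ k(1), of x] \<phi>[OF _ k(2), of x] \<phi>[OF _ kk, of x] tc d(3,4) e left(3)
        by (simp add: eta_add M.smult_l_distr)
      moreover have "\<phi> (t \<otimes>\<^bsub>R\<^esub> s) (k, x) \<in> carrier M" "\<phi> (t \<otimes>\<^bsub>R\<^esub> s) (k', x) \<in> carrier M"
        using \<phi>[OF _ k(1), of x] \<phi>[OF _ k(2), of x] tc d(3,4) e left(3) by simp_all
      ultimately show ?thesis using h_diff3[of "(k \<oplus>\<^bsub>K\<^esub> k', x)" "(k, x)" "(k', x)"] left cancel by simp
    qed
    then show ?case using d(2) by blast
  next
    case (right k x y)
    obtain a s u where d: "a \<in> carrier R" "s \<in> nonzero" "u \<in> carrier K" "\<iota> s \<otimes>\<^bsub>K\<^esub> u = \<one>\<^bsub>K\<^esub>" "k = \<iota> a \<otimes>\<^bsub>K\<^esub> u"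
      by (rule fraction[OF right(1)])
    have sc: "s \<in> carrier R" using d(2) by simp
    have "h (t \<otimes>\<^bsub>R\<^esub> s) (frag_of (k, x \<oplus>\<^bsub>M\<^esub> y) - frag_of (k, x) - frag_of (k, y)) = \<zero>\<^bsub>M\<^esub>"
      if "t \<in> nonzero" for t
    proof -
      have tc: "t \<in> carrier R" using that by simp
      have k: "\<iota> (t \<otimes>\<^bsub>R\<^esub> s) \<otimes>\<^bsub>K\<^esub> k = \<iota> (t \<otimes>\<^bsub>R\<^esub> a)"
        using mult[OF tc sc d(1) right(1)] clear[OF sc d(1,3,4)] d(5) by simp
      have e: "\<eta> (t \<otimes>\<^bsub>R\<^esub> a) \<in> carrier \<Lambda>" "t \<otimes>\<^bsub>R\<^esub> a \<in> carrier R" using tc d(1) eta_closed by simp_all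
      show ?thesis
        using h_diff3[of "(k, x \<oplus>\<^bsub>M\<^esub> y)" "(k, x)" "(k, y)"] right \<phi>[OF e(2) k] e(1) cancel
        by (simp add: M.smult_r_distr)
    qed
    then show ?case using d(2) by blast
  next
    case (scalar r k x)
    obtain a s u where d: "a \<in> carrier R" "s \<in> nonzero" "u \<in> carrier K" "\<iota> s \<otimes>\<^bsub>K\<^esub> u = \<one>\<^bsub>K\<^esub>" "k = \<iota> a \<otimes>\<^bsub>K\<^esub> u"
      by (rule fraction[OF scalar(2)])
    have sc: "s \<in> carrier R" using d(2) by simp
    have "h (t \<otimes>\<^bsub>R\<^esub> s) (frag_of (\<iota> r \<otimes>\<^bsub>K\<^esub> k, x) - frag_of (k, \<eta> r \<odot>\<^bsub>M\<^esub> x)) = \<zero>\<^bsub>M\<^esub>"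
      if "t \<in> nonzero" for t
    proof -
      have tc: "t \<in> carrier R" using that by simp
      have k: "\<iota> (t \<otimes>\<^bsub>R\<^esub> s) \<otimes>\<^bsub>K\<^esub> k = \<iota> (t \<otimes>\<^bsub>R\<^esub> a)"
        using mult[OF tc sc d(1) scalar(2)] clear[OF sc d(1,3,4)] d(5) by simp
      have ta: "t \<otimes>\<^bsub>R\<^esub> a \<in> carrier R" "r \<otimes>\<^bsub>R\<^esub> (t \<otimes>\<^bsub>R\<^esub> a) \<in> carrier R" using tc d(1) scalar(1) by simp_all
      have c: "\<iota> (t \<otimes>\<^bsub>R\<^esub> s) \<in> carrier K" "\<iota> r \<in> carrier K" using tc sc scalar(1) iota_closed by simp_all
      have "\<iota> (t \<otimes>\<^bsub>R\<^esub> s) \<otimes>\<^bsub>K\<^esub> (\<iota> r \<otimes>\<^bsub>K\<^esub> k) = \<iota> r \<otimes>\<^bsub>K\<^esub> \<iota> (t \<otimes>\<^bsub>R\<^esub> a)"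
        using K.m_lcomm[OF c scalar(2)] k by simp
      then have rk: "\<iota> (t \<otimes>\<^bsub>R\<^esub> s) \<otimes>\<^bsub>K\<^esub> (\<iota> r \<otimes>\<^bsub>K\<^esub> k) = \<iota> (r \<otimes>\<^bsub>R\<^esub> (t \<otimes>\<^bsub>R\<^esub> a))"
        using iota_mult[OF scalar(1) ta(1)] by simp
      have e: "\<eta> r \<odot>\<^bsub>M\<^esub> x \<in> carrier M" using scalar eta_closed by simp
      have "\<phi> (t \<otimes>\<^bsub>R\<^esub> s) (\<iota> r \<otimes>\<^bsub>K\<^esub> k, x) = \<phi> (t \<otimes>\<^bsub>R\<^esub> s) (k, \<eta> r \<odot>\<^bsub>M\<^esub> x)"
        using \<phi>[OF ta(2) rk] \<phi>[OF ta(1) k] eta_mult_smult(2)[OF M scalar(1) ta(1) scalar(3)] by simp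
      moreover have "\<phi> (t \<otimes>\<^bsub>R\<^esub> s) (k, \<eta> r \<odot>\<^bsub>M\<^esub> x) \<in> carrier M" using \<phi>[OF ta(1) k] eta_closed[OF ta(1)] e by simp
      ultimately show ?thesis
        using h_diff2[of "(\<iota> r \<otimes>\<^bsub>K\<^esub> k, x)" "(k, \<eta> r \<odot>\<^bsub>M\<^esub> x)"] scalar c e by (simp add: M.diff_eq_zero_iff)
    qed
    then show ?case using d(2) by blast
  next
    case (uminus x)
    then obtain s where s: "s \<in> nonzero" "\<And>t. t \<in> nonzero \<Longrightarrow> h (t \<otimes>\<^bsub>R\<^esub> s) x = \<zero>\<^bsub>M\<^esub>" by blast
    have "h (t \<otimes>\<^bsub>R\<^esub> s) (- x) = \<zero>\<^bsub>M\<^esub>" if "t \<in> nonzero" for t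
      using h_uminus[OF ker_keys[OF M uminus(1)]] s(2)[OF that] M.M.minus_equality[of "\<zero>\<^bsub>M\<^esub>" "\<zero>\<^bsub>M\<^esub>"] by simp
    then show ?case using s(1) by blast
  next
    case (add x y)
    then obtain s s' where s: "s \<in> nonzero" "\<And>t. t \<in> nonzero \<Longrightarrow> h (t \<otimes>\<^bsub>R\<^esub> s) x = \<zero>\<^bsub>M\<^esub>"
      and s': "s' \<in> nonzero" "\<And>t. t \<in> nonzero \<Longrightarrow> h (t \<otimes>\<^bsub>R\<^esub> s') y = \<zero>\<^bsub>M\<^esub>" by blast
    have "h (t \<otimes>\<^bsub>R\<^esub> (s \<otimes>\<^bsub>R\<^esub> s')) (x + y) = \<zero>\<^bsub>M\<^esub>" if t: "t \<in> nonzero" for t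
    proof -
      have "t \<otimes>\<^bsub>R\<^esub> (s \<otimes>\<^bsub>R\<^esub> s') = (t \<otimes>\<^bsub>R\<^esub> s') \<otimes>\<^bsub>R\<^esub> s" "t \<otimes>\<^bsub>R\<^esub> (s \<otimes>\<^bsub>R\<^esub> s') = (t \<otimes>\<^bsub>R\<^esub> s) \<otimes>\<^bsub>R\<^esub> s'"
        using s(1) s'(1) t by (simp_all add: R.m_ac)
      then show ?thesis
        using h_add[OF ker_keys[OF M add(1)] ker_keys[OF M add(2)], of "t \<otimes>\<^bsub>R\<^esub> (s \<otimes>\<^bsub>R\<^esub> s')"]
          s(2)[OF nonzero_mult[OF t s'(1)]] s'(2)[OF nonzero_mult[OF t s(1)]] by simp
    qed
    then show ?case using nonzero_mult[OF s(1) s'(1)] by blast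
  qed
  then obtain s where s: "s \<in> nonzero" "h (\<one>\<^bsub>R\<^esub> \<otimes>\<^bsub>R\<^esub> s) (frag_of (\<one>\<^bsub>K\<^esub>, m)) = \<zero>\<^bsub>M\<^esub>"
    using one_nonzero by blast
  then have "\<phi> s (\<one>\<^bsub>K\<^esub>, m) = \<zero>\<^bsub>M\<^esub>" using h(2)[of "(\<one>\<^bsub>K\<^esub>, m)" s] m by simp
  then have "\<eta> s \<odot>\<^bsub>M\<^esub> m = \<zero>\<^bsub>M\<^esub>" using \<phi>[of s s "\<one>\<^bsub>K\<^esub>" m] s(1) iota_closed by simp
  then show thesis using that s(1) by blast
qed

sublocale loc: order_localization R \<Lambda> \<eta> A eps
  by (rule order_localization_A)

lemma is_loc_bc:
  assumes M: "left_module \<Lambda> M" shows "loc.is_loc M (tens M \<one>\<^bsub>K\<^esub>) (bc M)"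
  unfolding loc.is_loc_def
proof (intro conjI ballI impI)
  interpret M: left_module \<Lambda> M by fact
  show "tens M \<one>\<^bsub>K\<^esub> \<in> mod_hom \<Lambda> M (loc.res (bc M))"
    by (rule mod_homI) (simp_all add: tens_closed tens_add_right[OF M] eps_smult[OF M])
next
  fix x assume x: "x \<in> carrier (bc M)"
  then show "\<exists>s\<in>nonzero. \<exists>m\<in>carrier M. loc.scale (bc M) s x = tens M \<one>\<^bsub>K\<^esub> m"
    using clear_denominator[OF M x] by metis
next
  fix m assume "m \<in> carrier M" "tens M \<one>\<^bsub>K\<^esub> m = \<zero>\<^bsub>bc M\<^esub>"
  then show "\<exists>s\<in>nonzero. \<eta> s \<odot>\<^bsub>M\<^esub> m = \<zero>\<^bsub>M\<^esub>" using tens_one_eq_zero[OF M] by metis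
qed

sublocale loc: order_localization_exists R \<Lambda> \<eta> A eps
proof
  fix M :: "('l, 'l list set) module" assume M: "M \<in> mod_cat \<Lambda>"
  note Ml = mod_catD(1)[OF M]
  note bc = left_module_bc[OF Ml] and loc = is_loc_bc[OF Ml]
  obtain N where N: "N \<in> mod_cat A" "mod_iso A (bc M) N"
    using fg_module_has_copy[OF bc loc.is_loc_finitely_generated[OF Ml bc loc mod_catD(2)[OF M]]] by blast
  obtain h where "h \<in> mod_hom A (bc M) N" "bij_betw h (carrier (bc M)) (carrier N)"
    using N(2) by (elim mod_isoE)
  then have "loc.is_loc M (\<lambda>x. h (tens M \<one>\<^bsub>K\<^esub> x)) N"
    by (rule loc.is_loc_iso_codomain[OF bc mod_catD(1)[OF N(1)] loc])
  then show "\<exists>N\<in>mod_cat A. \<exists>j. loc.is_loc M j N" using N(1) by blast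
qed

lemma K_image_eq_loc_image:
  assumes "\<C> \<subseteq> mod_cat \<Lambda>"
  shows "K_image R K \<iota> \<Lambda> \<eta> \<C> = loc.loc_image \<C>"
proof -
  have "mod_iso A (bc M) N \<longleftrightarrow> (\<exists>j. loc.is_loc M j N)" if M: "M \<in> \<C>" and N: "N \<in> mod_cat A" for M N
  proof
    have Ml: "left_module \<Lambda> M" using M assms mod_catD by auto
    note bc = left_module_bc[OF Ml] and loc = is_loc_bc[OF Ml] and Nl = mod_catD(1)[OF N]
    show "\<exists>j. loc.is_loc M j N" if "mod_iso A (bc M) N"
      using that loc.is_loc_iso_codomain[OF bc Nl loc] by (elim mod_isoE) blast
    show "mod_iso A (bc M) N" if "\<exists>j. loc.is_loc M j N"
      using that loc.is_loc_unique[OF Ml bc Nl loc] by blast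
  qed
  then show ?thesis unfolding K_image_def loc.loc_image_def Let_def by blast
qed

end

theorem theorem1p7:
  fixes R :: "('r, 'c) ring_scheme" and K :: "('k, 'd) ring_scheme"
    and \<Lambda> :: "('l, 'e) ring_scheme"
    and \<iota> :: "'r \<Rightarrow> 'k" and \<eta> :: "'r \<Rightarrow> 'l"
    and A :: "('k \<times> 'l \<Rightarrow>\<^sub>0 int) set ring"
  assumes "domain R" and "noetherian_ring R" and "local_ring R" and "krull_dim R = 1"
    and "fraction_field R K \<iota>"
    and "module_finite_algebra R \<Lambda> \<eta>"
    and "A = base_change_ring R K \<iota> \<Lambda> \<eta>"
  shows "tors \<Lambda> = (\<Union>\<T>\<in>tors_fl \<Lambda>. tors_interval \<Lambda> \<T> (fl_closure \<Lambda> \<T>)) \<and>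
    disjoint_family_on (\<lambda>\<T>. tors_interval \<Lambda> \<T> (fl_closure \<Lambda> \<T>)) (tors_fl \<Lambda>) \<and>
    bij_betw (\<lambda>(\<T>, \<C>). (\<T>, K_image R K \<iota> \<Lambda> \<eta> \<C>))
      (SIGMA \<T>:tors_fl \<Lambda>. tors_interval \<Lambda> \<T> (fl_closure \<Lambda> \<T>))
      (SIGMA \<T>:tors_fl \<Lambda>.
         tors_interval A (zero_cat A) (K_image R K \<iota> \<Lambda> \<eta> (fl_closure \<Lambda> \<T>)))"
proof -
  interpret fraction_field_base_change R \<Lambda> \<eta> K \<iota>
    using assms(1-6)
    by (simp add: fraction_field_base_change_def fraction_field_base_change_axioms_def
        dim_one_order_def dim_one_order_axioms_def)
  have closure: "K_image R K \<iota> \<Lambda> \<eta> (fl_closure \<Lambda> \<T>) = loc.loc_image (fl_closure \<Lambda> \<T>)" for \<T>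
    by (rule K_image_eq_loc_image) (auto simp: fl_closure_def)
  have member: "K_image R K \<iota> \<Lambda> \<eta> \<C> = loc.loc_image \<C>"
    if "\<C> \<in> tors_interval \<Lambda> \<T> (fl_closure \<Lambda> \<T>)" for \<C> \<T>
    by (rule K_image_eq_loc_image) (use that in \<open>auto simp: tors_interval_def fl_closure_def\<close>)
  have "bij_betw (\<lambda>(\<T>, \<C>). (\<T>, K_image R K \<iota> \<Lambda> \<eta> \<C>))
      (SIGMA \<T>:tors_fl \<Lambda>. tors_interval \<Lambda> \<T> (fl_closure \<Lambda> \<T>))
      (SIGMA \<T>:tors_fl \<Lambda>. tors_interval A (zero_cat A) (loc.loc_image (fl_closure \<Lambda> \<T>)))"
    unfolding assms(7)
    using loc.loc_image_bij_betw by (rule bij_betw_cong[THEN iffD1, rotated]) (use member in auto)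
  then show ?thesis
    unfolding closure using tors_eq_Union_intervals intervals_disjoint by simp
qed

end
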